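(* Let $n\ge 1$ and let $f:E\to E$ be an $n$-toral map over $B$ such that for every positive divisor $m$ of $n$ one has $0\neq N_B(f^m)=R_B(f^m)$. Then $$A_n(f)=N_BP_n(f).$$
   Context: Standing assumptions: $p:E\to B$ is a fibration; $E$, $B$ and the fibres are compact path-connected manifolds without boundary. A map over $B$ is a continuous $f:E\to E$ with $p\circ f=p$. $I=[0,1]$; $\ast$ is concatenation of paths and $^{-1}$ the reversed path. Reidemeister classes. Fix $x_0\in E$, $Y=p^{-1}(p(x_0))$. For a map $h:E\to E$ over $B$ and a path $\eta$ in $Y$ from $x_0$ to $h(x_0)$: for $[c]\in\pi_1(E,x_0)$, $[\theta]\in\pi_1(Y,x_0)$ choose (homotopy lifting) $\widetilde H:I\times I\to E$ with $p(\widetilde H(t,s))=p(c(t))$, $\widetilde H(t,0)=c(t)$, $\widetilde H(t,1)=h(c(t))$, $\widetilde H(0,s)=(\theta\ast\eta)(s)$, and put $[c]\ast_B[\theta]=[\widetilde H(1,-)\ast\eta^{-1}]\in\pi_1(Y,x_0)$ (this depends only on $[c]$, $[\theta]$, $\eta$). $[\theta],[\theta']$ are related if $[\theta']=[c]\ast_B[\theta]$ for some $[c]$; $\mathcal R_B(h;x_0,\eta)$ is the set of equivalence classes and $R_B(h)$ its cardinality. Nielsen classes and index. Let $E_B(h)=\{(x,\alpha)\in E\times E^I: p(\alpha(t))=p(x)\ \forall t,\ \alpha(0)=x,\ \alpha(1)=h(x)\}$ and $p_1(x,\alpha)=x$. Two points $x,y\in Fix(h)$ are Nielsen equivalent over $B$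 if there are a path $\lambda$ from $x$ to $y$ in $E$ and $H:I\times I\to E$ with $H(t,0)=\lambda(t)$, $H(t,1)=h(\lambda(t))$, $H(0,s)=x$, $H(1,s)=y$ and $H(\{t\}\times I)\subset p^{-1}(p(\lambda(t)))$; equivalently $(x,c_x)$ and $(y,c_y)$ lie in the same path component of $E_B(h)$ ($c_x$ the constant path). $\mathcal N_B(h)$ is the set of Nielsen classes. The index is that of Gonçalves–Koschorke (where $p$ is a smooth fibre bundle): after a small homotopy over $B$, $(h,\mathrm{id}):E\to E\times_B E$ is smooth and transverse to the diagonal, so $C=Fix(h)$ is a closed manifold of dimension $b=\dim B$ with normal bundle in $E$ canonically identified with the restriction of $TF=\ker(dp)$; with the map $C\to E_B(h)$ (induced by $x\mapsto(x,c_x)$ and the small homotopy) this gives a normal bordism class in $\Omega_b(E_B(h);p_1^*(TF-TE))=\bigoplus_A\Omega_b(A;p_1^*(TF-TE)|_A)$, $A\in\pi_0(E_B(h))$. The index of the Nielsen class corresponding to $A$ is the $A$-component. $N_B(h)$ is the number of Nielsen classes with nonzero index. There is an injection $\phi:\mathcal N_B(h)\to\mathcal R_B(h;x_0,\eta)$ sending the class of $x$ to the $[\theta]$ such that $(x_0,\theta\ast\eta)$ and $(x,c_x)$ lie in the same path component of $E_B(h)$. The index of $[\alpha]\in\mathcal R_B(h;x_0,\eta)$ is that of $\mathcal F$ if $[\alpha]=\phi(\mathcal F)$, and $0$ otherwise; $[\alpha]$ is essential if its index is nonzero. Periodic classes. Fix a path $\omega$ in $Y$ from $x_0$ to $f(x_0)$.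 Put $n(\omega)=\omega\ast f(\omega)\ast\cdots\ast f^{n-1}(\omega)$ and $f^{n\omega}:\pi_1(Y,x_0)\to\pi_1(Y,x_0)$, $f^{n\omega}(\alpha)=n(\omega)\ast f^n(\alpha)\ast n(\omega)^{-1}$, $f^\omega=f^{1\omega}$. On $\mathcal R_B(f^n;x_0,n(\omega))$, with elements written $[\theta]_n$, there is the well-defined map $[f^\omega]([\theta]_n)=[f^\omega(\theta)]_n$, whose $n$-th iterate is the identity. The orbit $\langle[\theta]_n\rangle$ is the $[f^\omega]$-orbit; its length $l$ is the least $r\ge1$ with $[f^\omega]^r([\theta]_n)=[\theta]_n$. For $m\mid n$, $\gamma_{m,n}(\theta)=\theta\ast f^{m\omega}(\theta)\ast f^{2m\omega}(\theta)\ast\cdots\ast f^{(n-m)\omega}(\theta)$ induces $[\gamma_{m,n}]:\mathcal R_B(f^m;x_0,m(\omega))\to\mathcal R_B(f^n;x_0,n(\omega))$. $[\alpha]_n$ is reducible to $m$ if it lies in the image of $[\gamma_{m,n}]$; it is irreducible if it is not reducible to any $m<n$. Its depth $d$ is the smallest $m$ to which it is reducible; depth and essentiality are constant on orbits. $O_n(f)$ is the number of irreducible essential orbits in $\mathcal R_B(f^n;x_0,n(\omega))$, and $N_BP_n(f)=n\times O_n(f)$. $f$ is $n$-toral over $B$ if (i) for every $m\mid n$ and each $[\alpha]_m\in\mathcal R_B(f^m;x_0,m(\omega))$, $d(\langle[\alpha]_m\rangle)=l(\langle[\alpha]_m\rangle)$; and (ii) for all $m\mid n$, $[\gamma_{m,n}]$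 is injective. Inductively, $A_1(f)=N_B(f)$ and $A_n(f)=N_B(f^n)-\sum_{k\mid n,\,k<n}A_k(f)$. *)

theory Defs
  imports "HOL-Analysis.Analysis"
begin

section \<open>Smooth manifolds\<close>

text \<open>
  Local models live in the single type \<open>nat \<Rightarrow> real\<close> (with its product topology), so that the
  dimension is a natural number, may be 0, and may vary inside a formula.  The subspace topology
  on \<open>rspace n\<close> is the Euclidean one.
\<close>

type_synonym rvec = "nat \<Rightarrow> real"
type_synonym rmat = "nat \<Rightarrow> nat \<Rightarrow> real"
type_synonym 'a chart = "'a set \<times> ('a \<Rightarrow> rvec)"

definition rspace :: "nat \<Rightarrow> rvec set" where
  "rspace n = {x. \<forall>i\<ge>n. x i = 0}"

text \<open>The half-space of dimension \<open>n + 1\<close>; its boundary hyperplane is exactly \<open>rspace n\<close>.\<close>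

definition halfspace :: "nat \<Rightarrow> rvec set" where
  "halfspace n = {x \<in> rspace (Suc n). 0 \<le> x n}"

text \<open>
  Partial derivatives on a relatively open subset \<open>A\<close> of \<open>rspace n\<close> or of a half-space; at boundary
  points of a half-space the derivative in the last direction is one-sided.
\<close>

definition pdiff :: "nat \<Rightarrow> rvec set \<Rightarrow> (rvec \<Rightarrow> real) \<Rightarrow> rvec \<Rightarrow> real" where
  "pdiff i A g x = vector_derivative (\<lambda>t. g (x(i := t))) (at (x i) within {t. x(i := t) \<in> A})"

primrec Ck_on :: "nat \<Rightarrow> nat \<Rightarrow> rvec set \<Rightarrow> (rvec \<Rightarrow> real) \<Rightarrow> bool" where
  "Ck_on 0 n A g \<longleftrightarrow> continuous_on A g"
| "Ck_on (Suc k) n A g \<longleftrightarrow> continuous_on A g \<and>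
     (\<forall>i<n. (\<forall>x\<in>A. (\<lambda>t. g (x(i := t))) differentiable (at (x i) within {t. x(i := t) \<in> A})) \<and>
            Ck_on k n A (pdiff i A g))"

definition smooth_fn :: "nat \<Rightarrow> nat \<Rightarrow> rvec set \<Rightarrow> (rvec \<Rightarrow> rvec) \<Rightarrow> bool" where
  "smooth_fn n m A g \<longleftrightarrow> (\<forall>r<m. \<forall>k. Ck_on k n A (\<lambda>y. g y r))"

definition jac :: "rvec set \<Rightarrow> (rvec \<Rightarrow> rvec) \<Rightarrow> rvec \<Rightarrow> rmat" where
  "jac A g x = (\<lambda>r c. pdiff c A (\<lambda>y. g y r) x)"

definition chart_inv :: "'a chart \<Rightarrow> rvec \<Rightarrow> 'a" where
  "chart_inv c = inv_into (fst c) (snd c)"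

definition chart_on :: "rvec set \<Rightarrow> 'a::topological_space set \<Rightarrow> 'a chart \<Rightarrow> bool" where
  "chart_on K M c \<longleftrightarrow> openin (top_of_set M) (fst c) \<and> openin (top_of_set K) (snd c ` fst c) \<and>
     homeomorphism (fst c) (snd c ` fst c) (snd c) (chart_inv c)"

definition trans_dom :: "'a chart \<Rightarrow> 'a chart \<Rightarrow> rvec set" where
  "trans_dom c d = snd c ` (fst c \<inter> fst d)"

definition trans_map :: "'a chart \<Rightarrow> 'a chart \<Rightarrow> rvec \<Rightarrow> rvec" where
  "trans_map c d = snd d \<circ> chart_inv c"

definition compatible :: "nat \<Rightarrow> 'a chart \<Rightarrow> 'a chart \<Rightarrow> bool" where
  "compatible n c d \<longleftrightarrow>
     smooth_fn n n (trans_dom c d) (trans_map c d) \<and> smooth_fn n n (trans_dom d c) (trans_map d c)"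

text \<open>
  \<open>n\<close> is the dimension and \<open>K\<close> the local model: \<open>K = rspace n\<close> for manifolds without boundary,
  \<open>K = halfspace (n - 1)\<close> for manifolds with boundary.
\<close>

definition smooth_manifold ::
    "nat \<Rightarrow> rvec set \<Rightarrow> 'a::topological_space set \<Rightarrow> 'a chart set \<Rightarrow> bool" where
  "smooth_manifold n K M \<A> \<longleftrightarrow>
     Hausdorff_space (top_of_set M) \<and> second_countable (top_of_set M) \<and>
     (\<forall>c\<in>\<A>. chart_on K M c) \<and> \<Union>(fst ` \<A>) = M \<and> (\<forall>c\<in>\<A>. \<forall>d\<in>\<A>. compatible n c d)"

definition max_atlas ::
    "nat \<Rightarrow> rvec set \<Rightarrow> 'a::topological_space set \<Rightarrow> 'a chart set \<Rightarrow> 'a chart set" where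
  "max_atlas n K M \<A> = {c. chart_on K M c \<and> (\<forall>d\<in>\<A>. compatible n c d)}"

definition map_dom :: "'a chart \<Rightarrow> 'b chart \<Rightarrow> ('a \<Rightarrow> 'b) \<Rightarrow> rvec set" where
  "map_dom c d g = snd c ` {x \<in> fst c. g x \<in> fst d}"

definition map_rep :: "'a chart \<Rightarrow> 'b chart \<Rightarrow> ('a \<Rightarrow> 'b) \<Rightarrow> rvec \<Rightarrow> rvec" where
  "map_rep c d g = snd d \<circ> g \<circ> chart_inv c"

definition smooth_map :: "nat \<Rightarrow> 'a::topological_space set \<Rightarrow> 'a chart set \<Rightarrow>
    nat \<Rightarrow> 'b::topological_space set \<Rightarrow> 'b chart set \<Rightarrow> ('a \<Rightarrow> 'b) \<Rightarrow> bool" where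
  "smooth_map m M \<A> n N \<B> g \<longleftrightarrow> g ` M \<subseteq> N \<and> continuous_on M g \<and>
     (\<forall>c\<in>\<A>. \<forall>d\<in>\<B>. smooth_fn m n (map_dom c d g) (map_rep c d g))"

definition diffeo :: "nat \<Rightarrow> 'a::topological_space set \<Rightarrow> 'a chart set \<Rightarrow>
    'b::topological_space set \<Rightarrow> 'b chart set \<Rightarrow> ('a \<Rightarrow> 'b) \<Rightarrow> bool" where
  "diffeo n M \<A> N \<B> g \<longleftrightarrow> bij_betw g M N \<and>
     smooth_map n M \<A> n N \<B> g \<and> smooth_map n N \<B> n M \<A> (inv_into M g)"

definition restrict_atlas :: "'a set \<Rightarrow> 'a chart set \<Rightarrow> 'a chart set" where
  "restrict_atlas U \<A> = (\<lambda>c. (fst c \<inter> U, snd c)) ` \<A>"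

definition product_atlas :: "nat \<Rightarrow> 'a chart set \<Rightarrow> 'b chart set \<Rightarrow> ('a \<times> 'b) chart set" where
  "product_atlas m \<A> \<B> =
     (\<lambda>(c, d). (fst c \<times> fst d,
        \<lambda>(x, y) i. if i < m then snd c x i else snd d y (i - m))) ` (\<A> \<times> \<B>)"

text \<open>
  The submanifold structure of dimension \<open>n\<close> on \<open>C\<close>: restrictions of the slice charts of the ambient
  manifold, of dimension \<open>m\<close> and with maximal atlas \<open>\<A>\<close>.
\<close>

definition slice_atlas :: "nat \<Rightarrow> nat \<Rightarrow> 'a chart set \<Rightarrow> 'a set \<Rightarrow> 'a chart set" where
  "slice_atlas n m \<A> C =
     (\<lambda>c. (fst c \<inter> C, \<lambda>x i. if i < n then snd c x i else 0)) `
       {c \<in> \<A>. fst c \<inter> C = {x \<in> fst c. \<forall>i. n \<le> i \<and> i < m \<longrightarrow> snd c x i = 0}}"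

definition mfd_boundary :: "nat \<Rightarrow> 'a chart set \<Rightarrow> 'a set" where
  "mfd_boundary n \<A> = {x. \<exists>c\<in>\<A>. x \<in> fst c \<and> snd c x n = 0}"


section \<open>Fibrations and smooth fibre bundles\<close>

text \<open>Total space and base with atlases, the projection, and the dimensions of base and fibre.\<close>

record ('a, 'b) fibred =
  tot :: "'a set"
  totA :: "'a chart set"
  bas :: "'b set"
  basA :: "'b chart set"
  prj :: "'a \<Rightarrow> 'b"
  bdim :: nat
  fdim :: nat

definition tdim :: "('a, 'b) fibred \<Rightarrow> nat" where
  "tdim P = bdim P + fdim P"

definition fibre :: "('a, 'b) fibred \<Rightarrow> 'b \<Rightarrow> 'a set" where
  "fibre P y = {x \<in> tot P. prj P x = y}"

text \<open>
  The homotopy lifting property.  HOL cannot quantify over the type carrying the test space \<open>X\<close>; the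
  type below carries the mapping path space of the projection, which is the universal test space, so
  this is the property for all spaces.  (The factor \<open>real\<close> provides the interval directly.)
\<close>

definition fibration :: "('a::topological_space, 'b::topological_space) fibred \<Rightarrow> bool" where
  "fibration P \<longleftrightarrow> prj P ` tot P \<subseteq> bas P \<and> continuous_on (tot P) (prj P) \<and>
     (\<forall>(X :: (real \<times> 'a \<times> (real \<Rightarrow> 'b)) topology) G g.
        continuous_map (prod_topology X (top_of_set {0..1::real})) (top_of_set (bas P)) G \<and>
        continuous_map X (top_of_set (tot P)) g \<and>
        (\<forall>x\<in>topspace X. prj P (g x) = G (x, 0)) \<longrightarrow>
        (\<exists>G'. continuous_map (prod_topology X (top_of_set {0..1::real})) (top_of_set (tot P)) G' \<and>
              (\<forall>x\<in>topspace X. G' (x, 0) = g x) \<and>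
              (\<forall>x\<in>topspace X. \<forall>t\<in>{0..1}. prj P (G' (x, t)) = G (x, t))))"

definition smooth_fibre_bundle :: "('a::topological_space, 'b::topological_space) fibred \<Rightarrow>
    'c::topological_space set \<Rightarrow> 'c chart set \<Rightarrow> bool" where
  "smooth_fibre_bundle P F FA \<longleftrightarrow>
     smooth_manifold (tdim P) (rspace (tdim P)) (tot P) (totA P) \<and>
     smooth_manifold (bdim P) (rspace (bdim P)) (bas P) (basA P) \<and>
     smooth_manifold (fdim P) (rspace (fdim P)) F FA \<and>
     smooth_map (tdim P) (tot P) (totA P) (bdim P) (bas P) (basA P) (prj P) \<and>
     (\<forall>y\<in>bas P. \<exists>U \<Phi>. y \<in> U \<and> openin (top_of_set (bas P)) U \<and>
        (let V = {x \<in> tot P. prj P x \<in> U} in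
          diffeo (tdim P) V (restrict_atlas V (totA P))
            (U \<times> F) (product_atlas (bdim P) (restrict_atlas U (basA P)) FA) \<Phi> \<and>
          (\<forall>x\<in>V. fst (\<Phi> x) = prj P x)))"

definition map_over :: "('a::topological_space, 'b) fibred \<Rightarrow> ('a \<Rightarrow> 'a) \<Rightarrow> bool" where
  "map_over P h \<longleftrightarrow> continuous_on (tot P) h \<and> h ` tot P \<subseteq> tot P \<and>
     (\<forall>x\<in>tot P. prj P (h x) = prj P x)"


section \<open>Vector bundles given by coordinate transformations\<close>

text \<open>
  \<open>vb_tr \<xi> i j x\<close> is the matrix carrying fibre coordinates over \<open>x\<close> in the \<open>i\<close>-th local
  trivialization to those in the \<open>j\<close>-th.  Only the entries with both indices below the rank count.
\<close>

record ('i, 'x) vbundle =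
  vb_rank :: nat
  vb_ix :: "'i set"
  vb_dom :: "'i \<Rightarrow> 'x set"
  vb_tr :: "'i \<Rightarrow> 'i \<Rightarrow> 'x \<Rightarrow> rmat"

definition mmul :: "nat \<Rightarrow> rmat \<Rightarrow> rmat \<Rightarrow> rmat" where
  "mmul N A B = (\<lambda>r c. \<Sum>l<N. A r l * B l c)"

definition idm :: rmat where
  "idm = (\<lambda>r c. if r = c then 1 else 0)"

definition inv_mat :: "nat \<Rightarrow> rmat \<Rightarrow> bool" where
  "inv_mat N A \<longleftrightarrow> (\<exists>B. \<forall>r<N. \<forall>c<N. mmul N A B r c = idm r c \<and> mmul N B A r c = idm r c)"

text \<open>Block diagonal sum; the upper left block is \<open>m \<times> m\<close>.\<close>

definition dsum :: "nat \<Rightarrow> rmat \<Rightarrow> rmat \<Rightarrow> rmat" where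
  "dsum m A B = (\<lambda>r c. if r < m \<and> c < m then A r c
                       else if m \<le> r \<and> m \<le> c then B (r - m) (c - m) else 0)"

definition vb_sum :: "('i, 'x) vbundle \<Rightarrow> ('j, 'x) vbundle \<Rightarrow> ('i \<times> 'j, 'x) vbundle" where
  "vb_sum \<xi> \<zeta> = \<lparr> vb_rank = vb_rank \<xi> + vb_rank \<zeta>,
     vb_ix = vb_ix \<xi> \<times> vb_ix \<zeta>,
     vb_dom = (\<lambda>(i, j). vb_dom \<xi> i \<inter> vb_dom \<zeta> j),
     vb_tr = (\<lambda>(i, j) (i', j') x. dsum (vb_rank \<xi>) (vb_tr \<xi> i i' x) (vb_tr \<zeta> j j' x)) \<rparr>"

definition vb_pull :: "('x \<Rightarrow> 'y) \<Rightarrow> ('i, 'y) vbundle \<Rightarrow> ('i, 'x) vbundle" where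
  "vb_pull g \<xi> = \<lparr> vb_rank = vb_rank \<xi>, vb_ix = vb_ix \<xi>,
     vb_dom = (\<lambda>i. g -` vb_dom \<xi> i), vb_tr = (\<lambda>i j x. vb_tr \<xi> i j (g x)) \<rparr>"

definition vb_triv :: "nat \<Rightarrow> (unit, 'x) vbundle" where
  "vb_triv r = \<lparr> vb_rank = r, vb_ix = UNIV, vb_dom = (\<lambda>_. UNIV), vb_tr = (\<lambda>_ _ _. idm) \<rparr>"

definition vb_iso :: "'x topology \<Rightarrow> ('i, 'x) vbundle \<Rightarrow> ('j, 'x) vbundle \<Rightarrow>
    ('i \<Rightarrow> 'j \<Rightarrow> 'x \<Rightarrow> rmat) \<Rightarrow> bool" where
  "vb_iso X \<xi> \<zeta> \<Theta> \<longleftrightarrow> vb_rank \<xi> = vb_rank \<zeta> \<and>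
     (\<forall>i\<in>vb_ix \<xi>. \<forall>j\<in>vb_ix \<zeta>. let D = topspace X \<inter> vb_dom \<xi> i \<inter> vb_dom \<zeta> j in
        (\<forall>r<vb_rank \<xi>. \<forall>c<vb_rank \<xi>.
           continuous_map (subtopology X D) euclideanreal (\<lambda>x. \<Theta> i j x r c)) \<and>
        (\<forall>x\<in>D. inv_mat (vb_rank \<xi>) (\<Theta> i j x))) \<and>
     (\<forall>i\<in>vb_ix \<xi>. \<forall>i'\<in>vb_ix \<xi>. \<forall>j\<in>vb_ix \<zeta>. \<forall>j'\<in>vb_ix \<zeta>.
        \<forall>x\<in>topspace X \<inter> vb_dom \<xi> i \<inter> vb_dom \<xi> i' \<inter> vb_dom \<zeta> j \<inter> vb_dom \<zeta> j'.
          \<forall>r<vb_rank \<xi>. \<forall>c<vb_rank \<xi>.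
            mmul (vb_rank \<xi>) (\<Theta> i' j' x) (vb_tr \<xi> i i' x) r c =
            mmul (vb_rank \<xi>) (vb_tr \<zeta> j j' x) (\<Theta> i j x) r c)"

definition tangent :: "nat \<Rightarrow> 'a chart set \<Rightarrow> ('a chart, 'a) vbundle" where
  "tangent n \<A> = \<lparr> vb_rank = n, vb_ix = \<A>, vb_dom = fst,
     vb_tr = (\<lambda>c d x. jac (trans_dom c d) (trans_map c d) (snd c x)) \<rparr>"

abbreviation tot_max_atlas :: "('a::topological_space, 'b) fibred \<Rightarrow> 'a chart set" where
  "tot_max_atlas P \<equiv> max_atlas (tdim P) (rspace (tdim P)) (tot P) (totA P)"

definition TE :: "('a::topological_space, 'b) fibred \<Rightarrow> ('a chart, 'a) vbundle" where
  "TE P = tangent (tdim P) (tot_max_atlas P)"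

text \<open>
  Charts of the total space in which the projection is the projection to the first \<open>bdim P\<close>
  coordinates.  In them the kernel of the differential of the projection is spanned by the last
  \<open>fdim P\<close> coordinate directions.
\<close>

definition adapted_charts ::
    "('a::topological_space, 'b::topological_space) fibred \<Rightarrow> 'a chart set" where
  "adapted_charts P = {c \<in> tot_max_atlas P.
     \<exists>d\<in>max_atlas (bdim P) (rspace (bdim P)) (bas P) (basA P).
       prj P ` fst c \<subseteq> fst d \<and> (\<forall>x\<in>fst c. \<forall>i<bdim P. snd c x i = snd d (prj P x) i)}"

definition TF :: "('a::topological_space, 'b::topological_space) fibred \<Rightarrow> ('a chart, 'a) vbundle" where
  "TF P = \<lparr> vb_rank = fdim P, vb_ix = adapted_charts P, vb_dom = fst,
     vb_tr = (\<lambda>c d x r s.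
       jac (trans_dom c d) (trans_map c d) (snd c x) (bdim P + r) (bdim P + s)) \<rparr>"


section \<open>Normal bordism\<close>

text \<open>
  Representatives of classes in the normal bordism group of dimension \<open>n\<close> of a space \<open>Y\<close> with
  coefficients in the virtual bundle \<open>\<phi>p - \<phi>m\<close>: a closed \<open>n\<close>-manifold \<open>S\<close>, a map \<open>g : S \<rightarrow> Y\<close> and a
  stable isomorphism \<open>TS \<oplus> g^*\<phi>p \<cong> g^*\<phi>m\<close>, i.e. an isomorphism after adding trivial bundles of
  ranks \<open>r\<close> and \<open>s\<close>.
\<close>

record ('s, 'y, 'i, 'j) nrep =
  nr_set :: "'s set"
  nr_atlas :: "'s chart set"
  nr_map :: "'s \<Rightarrow> 'y"
  nr_r :: nat
  nr_s :: nat
  nr_iso :: "('s chart \<times> 'i) \<times> unit \<Rightarrow> 'j \<times> unit \<Rightarrow> 's \<Rightarrow> rmat"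

definition normal_rep :: "nat \<Rightarrow> 'y topology \<Rightarrow> ('i, 'y) vbundle \<Rightarrow> ('j, 'y) vbundle \<Rightarrow>
    ('s::topological_space, 'y, 'i, 'j) nrep \<Rightarrow> bool" where
  "normal_rep n Y \<phi>p \<phi>m R \<longleftrightarrow>
     smooth_manifold n (rspace n) (nr_set R) (nr_atlas R) \<and> compact (nr_set R) \<and>
     continuous_map (top_of_set (nr_set R)) Y (nr_map R) \<and>
     vb_iso (top_of_set (nr_set R))
       (vb_sum (vb_sum (tangent n (nr_atlas R)) (vb_pull (nr_map R) \<phi>p)) (vb_triv (nr_r R)))
       (vb_sum (vb_pull (nr_map R) \<phi>m) (vb_triv (nr_s R)))
       (nr_iso R)"

text \<open>
  \<open>W\<close> is an \<open>(n+1)\<close>-manifold with boundary, \<open>G : W \<rightarrow> Y\<close>, and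
  \<open>\<Omega> : TW \<oplus> G^*\<phi>p \<oplus> \<epsilon>^q \<cong> G^*\<phi>m \<oplus> \<epsilon>^(q'+1)\<close>.  The representative \<open>R\<close> is an end of \<open>W\<close> via the
  diffeomorphism \<open>j\<close> onto an open and closed part of the boundary: on \<open>j(S)\<close>, \<open>\<Omega>\<close> restricts to the
  stabilized isomorphism of \<open>R\<close> into \<open>G^*\<phi>m \<oplus> \<epsilon>^q'\<close>, and the last trivial coordinate of \<open>\<Omega>\<close> on
  inward pointing tangent vectors has the sign \<open>\<sigma>\<close>.  In a boundary chart \<open>d\<close> the coordinates on the
  left are ordered as \<open>n\<close> tangent to the boundary, the inward one, \<open>\<phi>p\<close>, \<open>\<epsilon>^q\<close>; \<open>L\<close> is the matrix of
  \<open>dj \<oplus> id\<close>.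
\<close>

definition bordism_end :: "nat \<Rightarrow> ('i, 'y) vbundle \<Rightarrow> ('j, 'y) vbundle \<Rightarrow> nat \<Rightarrow> nat \<Rightarrow>
    'w::topological_space chart set \<Rightarrow> ('w \<Rightarrow> 'y) \<Rightarrow>
    (('w chart \<times> 'i) \<times> unit \<Rightarrow> 'j \<times> unit \<Rightarrow> 'w \<Rightarrow> rmat) \<Rightarrow> real \<Rightarrow>
    ('s \<Rightarrow> 'w) \<Rightarrow> ('s::topological_space, 'y, 'i, 'j) nrep \<Rightarrow> bool" where
  "bordism_end n \<phi>p \<phi>m q q' \<W> G \<Omega> \<sigma> j R \<longleftrightarrow>
     diffeo n (nr_set R) (nr_atlas R) (j ` nr_set R) (restrict_atlas (j ` nr_set R) \<W>) j \<and>
     (\<forall>x\<in>nr_set R. G (j x) = nr_map R x) \<and>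
     (\<exists>t. q = nr_r R + t \<and> q' = nr_s R + t) \<and>
     (\<forall>c\<in>nr_atlas R. \<forall>d\<in>\<W>. \<forall>i\<in>vb_ix \<phi>p. \<forall>k\<in>vb_ix \<phi>m.
        \<forall>x\<in>nr_set R. x \<in> fst c \<and> j x \<in> fst d \<and>
            nr_map R x \<in> vb_dom \<phi>p i \<and> nr_map R x \<in> vb_dom \<phi>m k \<longrightarrow>
          (let N = vb_rank \<phi>m + q';
               J = jac (map_dom c d j) (map_rep c d j) (snd c x);
               L = (\<lambda>r l. if l < n then (if r < Suc n then J r l else 0) else idm r (Suc l));
               T = \<Omega> ((d, i), ()) (k, ()) (j x)
           in (\<forall>r<N. \<forall>l<N. mmul (Suc N) T L r l =
                 dsum (vb_rank \<phi>m + nr_s R) (nr_iso R ((c, i), ()) (k, ()) x) idm r l) \<and>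
              (\<forall>l<N. mmul (Suc N) T L N l = 0) \<and>
              0 < \<sigma> * T N n))"

text \<open>
  Bordisms may be taken inside \<open>nat \<Rightarrow> real\<close>, since every compact manifold embeds in some
  \<open>rspace N\<close>.
\<close>

definition normally_bordant :: "nat \<Rightarrow> 'y topology \<Rightarrow> ('i, 'y) vbundle \<Rightarrow> ('j, 'y) vbundle \<Rightarrow>
    ('s::topological_space, 'y, 'i, 'j) nrep \<Rightarrow> ('t::topological_space, 'y, 'i, 'j) nrep \<Rightarrow> bool"
where
  "normally_bordant n Y \<phi>p \<phi>m R0 R1 \<longleftrightarrow>
     (\<exists>(W :: rvec set) \<W> G q q' \<Omega> j0 j1.
        smooth_manifold (Suc n) (halfspace n) W \<W> \<and> compact W \<and>
        continuous_map (top_of_set W) Y G \<and>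
        vb_iso (top_of_set W)
          (vb_sum (vb_sum (tangent (Suc n) \<W>) (vb_pull G \<phi>p)) (vb_triv q))
          (vb_sum (vb_pull G \<phi>m) (vb_triv (Suc q')))
          \<Omega> \<and>
        j0 ` nr_set R0 \<union> j1 ` nr_set R1 = mfd_boundary n \<W> \<and>
        j0 ` nr_set R0 \<inter> j1 ` nr_set R1 = {} \<and>
        bordism_end n \<phi>p \<phi>m q q' \<W> G \<Omega> 1 j0 R0 \<and>
        bordism_end n \<phi>p \<phi>m q q' \<W> G \<Omega> (- 1) j1 R1)"

definition bordism_class :: "nat \<Rightarrow> 'y topology \<Rightarrow> ('i, 'y) vbundle \<Rightarrow> ('j, 'y) vbundle \<Rightarrow>
    ('s::topological_space, 'y, 'i, 'j) nrep \<Rightarrow> (rvec, 'y, 'i, 'j) nrep set" where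
  "bordism_class n Y \<phi>p \<phi>m R =
     {R'. normal_rep n Y \<phi>p \<phi>m R' \<and> normally_bordant n Y \<phi>p \<phi>m R R'}"

text \<open>The zero element: the class of the empty manifold (the ranks just have to match).\<close>

definition bordism_zero :: "nat \<Rightarrow> 'y topology \<Rightarrow> ('i, 'y) vbundle \<Rightarrow> ('j, 'y) vbundle \<Rightarrow>
    (rvec, 'y, 'i, 'j) nrep set" where
  "bordism_zero n Y \<phi>p \<phi>m = bordism_class n Y \<phi>p \<phi>m
     (\<lparr> nr_set = {}, nr_atlas = {}, nr_map = (\<lambda>_. undefined),
        nr_r = vb_rank \<phi>m, nr_s = n + vb_rank \<phi>p, nr_iso = (\<lambda>_ _ _. idm) \<rparr>
      :: (rvec, 'y, 'i, 'j) nrep)"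


section \<open>The space \<open>E\<^sub>B(h)\<close> and Nielsen classes\<close>

definition paths_in :: "'a::topological_space set \<Rightarrow> (real \<Rightarrow> 'a) set" where
  "paths_in S = {\<alpha> \<in> extensional {0..1}. continuous_on {0..1} \<alpha> \<and> \<alpha> ` {0..1} \<subseteq> S}"

definition path_space :: "'a::topological_space set \<Rightarrow> (real \<Rightarrow> 'a) topology" where
  "path_space S = topology_generated_by
     {{\<alpha> \<in> paths_in S. \<alpha> ` K \<subseteq> U} | K U. compact K \<and> K \<subseteq> {0..1} \<and> openin (top_of_set S) U}"

definition EB :: "('a::topological_space, 'b) fibred \<Rightarrow> ('a \<Rightarrow> 'a) \<Rightarrow> ('a \<times> (real \<Rightarrow> 'a)) topology" where
  "EB P h = subtopology (prod_topology (top_of_set (tot P)) (path_space (tot P)))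
     {(x, \<alpha>). (\<forall>t\<in>{0..1}. prj P (\<alpha> t) = prj P x) \<and> \<alpha> 0 = x \<and> \<alpha> 1 = h x}"

text \<open>Paths as functions on all of \<open>real\<close> are turned into points of the path space by restriction.\<close>

definition to_path :: "(real \<Rightarrow> 'a) \<Rightarrow> real \<Rightarrow> 'a" where
  "to_path \<alpha> = restrict \<alpha> {0..1}"

definition Fix :: "('a, 'b) fibred \<Rightarrow> ('a \<Rightarrow> 'a) \<Rightarrow> 'a set" where
  "Fix P h = {x \<in> tot P. h x = x}"

definition nielsen_rel :: "('a::topological_space, 'b) fibred \<Rightarrow> ('a \<Rightarrow> 'a) \<Rightarrow> ('a \<times> 'a) set" where
  "nielsen_rel P h = {(x, y). x \<in> Fix P h \<and> y \<in> Fix P h \<and>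
     (\<exists>l (H :: real \<times> real \<Rightarrow> 'a).
        path l \<and> path_image l \<subseteq> tot P \<and> pathstart l = x \<and> pathfinish l = y \<and>
        continuous_on ({0..1} \<times> {0..1}) H \<and>
        (\<forall>t\<in>{0..1}. H (t, 0) = l t \<and> H (t, 1) = h (l t)) \<and>
        (\<forall>s\<in>{0..1}. H (0, s) = x \<and> H (1, s) = y) \<and>
        (\<forall>t\<in>{0..1}. \<forall>s\<in>{0..1}. H (t, s) \<in> fibre P (prj P (l t))))}"

definition nielsen_classes :: "('a::topological_space, 'b) fibred \<Rightarrow> ('a \<Rightarrow> 'a) \<Rightarrow> 'a set set" where
  "nielsen_classes P h = Fix P h // nielsen_rel P h"

text \<open>The path component of \<open>E\<^sub>B(h)\<close> that corresponds to a Nielsen class.\<close>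

definition nielsen_comp ::
    "('a::topological_space, 'b) fibred \<Rightarrow> ('a \<Rightarrow> 'a) \<Rightarrow> 'a set \<Rightarrow> ('a \<times> (real \<Rightarrow> 'a)) set" where
  "nielsen_comp P h N =
     (\<Union>x\<in>N. Collect (path_component_of (EB P h) (x, to_path (\<lambda>_. x))))"


section \<open>The index\<close>

text \<open>
  A homotopy \<open>H\<close> over the base from \<open>h\<close> to a smooth map \<open>h'\<close> such that \<open>(h', id)\<close> is transverse to the
  diagonal of the fibrewise product.  In an adapted chart the tangent space of the fibrewise product
  at a diagonal point consists of the pairs \<open>(u, v)\<close> with equal first \<open>bdim P\<close> coordinates.
  The homotopy is not required to be small: the bordism class below does not depend on it.
\<close>

definition transverse_approx :: "('a::topological_space, 'b::topological_space) fibred \<Rightarrow>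
    ('a \<Rightarrow> 'a) \<Rightarrow> (real \<times> 'a \<Rightarrow> 'a) \<Rightarrow> bool" where
  "transverse_approx P h H \<longleftrightarrow>
     continuous_on ({0..1} \<times> tot P) H \<and>
     (\<forall>t\<in>{0..1}. \<forall>x\<in>tot P. H (t, x) \<in> fibre P (prj P x)) \<and>
     (\<forall>x\<in>tot P. H (0, x) = h x) \<and>
     (let h' = (\<lambda>x. H (1, x)) in
       smooth_map (tdim P) (tot P) (totA P) (tdim P) (tot P) (totA P) h' \<and>
       (\<forall>x\<in>Fix P h'. \<forall>c\<in>adapted_charts P. x \<in> fst c \<longrightarrow>
          (let D = jac (map_dom c c h') (map_rep c c h') (snd c x) in
            \<forall>u v :: rvec. (\<forall>i<bdim P. u i = v i) \<longrightarrow>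
              (\<exists>w z :: rvec. \<forall>i<tdim P.
                 u i = (\<Sum>l<tdim P. D i l * w l) + z i \<and> v i = w i + z i))))"

text \<open>
  \<open>R\<close> represents the part over the path component \<open>A\<close> of \<open>E\<^sub>B(h)\<close>: the underlying manifold is the
  part of \<open>C = Fix(h')\<close> mapped to \<open>A\<close> by \<open>x \<mapsto> (x, path from x = h'(x) to h(x))\<close>.  The map
  \<open>dh' - id : TE|C \<rightarrow> TF|C\<close> has kernel \<open>TC\<close> and so identifies the normal bundle with \<open>TF|C\<close>; the
  isomorphism \<open>TC \<oplus> TF|C \<cong> TE|C\<close> is the inclusion on \<open>TC\<close> and a section of \<open>dh' - id\<close> on \<open>TF|C\<close>
  (any two sections are homotopic).
\<close>

definition index_rep :: "('a::topological_space, 'b::topological_space) fibred \<Rightarrow> ('a \<Rightarrow> 'a) \<Rightarrow>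
    ('a \<times> (real \<Rightarrow> 'a)) set \<Rightarrow>
    ('a, 'a \<times> (real \<Rightarrow> 'a), 'a chart, 'a chart) nrep \<Rightarrow> bool" where
  "index_rep P h A R \<longleftrightarrow> (\<exists>H. transverse_approx P h H \<and>
     (let h' = (\<lambda>x. H (1, x));
          g = (\<lambda>x. (x, to_path (\<lambda>s. H (1 - s, x))));
          C = {x \<in> Fix P h'. g x \<in> A}
      in nr_set R = C \<and>
         nr_atlas R = slice_atlas (bdim P) (tdim P) (tot_max_atlas P) C \<and>
         nr_map R = g \<and> nr_r R = 0 \<and> nr_s R = 0 \<and>
         normal_rep (bdim P) (subtopology (EB P h) A) (vb_pull fst (TF P)) (vb_pull fst (TE P)) R \<and>
         (\<forall>c\<in>nr_atlas R. \<forall>d\<in>adapted_charts P. \<forall>x\<in>fst c \<inter> fst d.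
            (let T = nr_iso R ((c, d), ()) (d, ()) x;
                 M = (\<lambda>r l. jac (map_dom d d h') (map_rep d d h') (snd d x) r l - idm r l)
             in (\<forall>r<tdim P. \<forall>l<bdim P.
                   T r l = jac (trans_dom c d) (trans_map c d) (snd c x) r l) \<and>
                (\<forall>r<tdim P. \<forall>l<tdim P.
                   mmul (tdim P) M T r l = (if bdim P \<le> l then idm r l else 0))))))"

text \<open>
  The \<open>A\<close>-component of the bordism invariant of \<open>h\<close>.  All representatives are normally bordant, so
  the union over all choices is the bordism class of any one of them.
\<close>

definition index_comp :: "('a::topological_space, 'b::topological_space) fibred \<Rightarrow> ('a \<Rightarrow> 'a) \<Rightarrow>
    ('a \<times> (real \<Rightarrow> 'a)) set \<Rightarrow>
    (rvec, 'a \<times> (real \<Rightarrow> 'a), 'a chart, 'a chart) nrep set" where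
  "index_comp P h A = (\<Union>R\<in>{R. index_rep P h A R}.
     bordism_class (bdim P) (subtopology (EB P h) A) (vb_pull fst (TF P)) (vb_pull fst (TE P)) R)"

definition index_zero :: "('a::topological_space, 'b::topological_space) fibred \<Rightarrow> ('a \<Rightarrow> 'a) \<Rightarrow>
    ('a \<times> (real \<Rightarrow> 'a)) set \<Rightarrow>
    (rvec, 'a \<times> (real \<Rightarrow> 'a), 'a chart, 'a chart) nrep set" where
  "index_zero P h A =
     bordism_zero (bdim P) (subtopology (EB P h) A) (vb_pull fst (TF P)) (vb_pull fst (TE P))"

definition nielsen_index :: "('a::topological_space, 'b::topological_space) fibred \<Rightarrow> ('a \<Rightarrow> 'a) \<Rightarrow>
    'a set \<Rightarrow> (rvec, 'a \<times> (real \<Rightarrow> 'a), 'a chart, 'a chart) nrep set" where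
  "nielsen_index P h N = index_comp P h (nielsen_comp P h N)"

definition N_B :: "('a::topological_space, 'b::topological_space) fibred \<Rightarrow> ('a \<Rightarrow> 'a) \<Rightarrow> nat" where
  "N_B P h =
     card {N \<in> nielsen_classes P h. nielsen_index P h N \<noteq> index_zero P h (nielsen_comp P h N)}"


section \<open>Reidemeister classes\<close>

definition loops :: "'a::topological_space set \<Rightarrow> 'a \<Rightarrow> (real \<Rightarrow> 'a) set" where
  "loops S x = {\<theta>. path \<theta> \<and> path_image \<theta> \<subseteq> S \<and> pathstart \<theta> = x \<and> pathfinish \<theta> = x}"

definition pcls :: "'a::topological_space set \<Rightarrow> 'a \<Rightarrow> (real \<Rightarrow> 'a) \<Rightarrow> (real \<Rightarrow> 'a) set" where
  "pcls S x \<theta> = {\<theta>' \<in> loops S x. homotopic_paths S \<theta> \<theta>'}"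

definition pi1 :: "'a::topological_space set \<Rightarrow> 'a \<Rightarrow> (real \<Rightarrow> 'a) set set" where
  "pi1 S x = pcls S x ` loops S x"

abbreviation fibre_at :: "('a, 'b) fibred \<Rightarrow> 'a \<Rightarrow> 'a set" where
  "fibre_at P x \<equiv> fibre P (prj P x)"

definition reid_lift :: "('a::topological_space, 'b) fibred \<Rightarrow> ('a \<Rightarrow> 'a) \<Rightarrow>
    (real \<Rightarrow> 'a) \<Rightarrow> (real \<Rightarrow> 'a) \<Rightarrow> (real \<Rightarrow> 'a) \<Rightarrow> (real \<times> real \<Rightarrow> 'a) \<Rightarrow> bool" where
  "reid_lift P h \<eta> c \<theta> H \<longleftrightarrow>
     continuous_on ({0..1} \<times> {0..1}) H \<and>
     (\<forall>t\<in>{0..1}. \<forall>s\<in>{0..1}. H (t, s) \<in> fibre P (prj P (c t))) \<and>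
     (\<forall>t\<in>{0..1}. H (t, 0) = c t \<and> H (t, 1) = h (c t)) \<and>
     (\<forall>s\<in>{0..1}. H (0, s) = (\<theta> +++ \<eta>) s)"

text \<open>
  \<open>b\<close> is the result of the action of the class of \<open>c\<close> on \<open>a\<close>, both elements of the fundamental group
  of the fibre.  The result is independent of the choices, so it is stated as a relation.
\<close>

definition reid_rel :: "('a::topological_space, 'b) fibred \<Rightarrow> ('a \<Rightarrow> 'a) \<Rightarrow> 'a \<Rightarrow> (real \<Rightarrow> 'a) \<Rightarrow>
    ((real \<Rightarrow> 'a) set \<times> (real \<Rightarrow> 'a) set) set" where
  "reid_rel P h x0 \<eta> = {(a, b). a \<in> pi1 (fibre_at P x0) x0 \<and> b \<in> pi1 (fibre_at P x0) x0 \<and>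
     (\<exists>c\<in>loops (tot P) x0. \<exists>\<theta>\<in>a. \<exists>H. reid_lift P h \<eta> c \<theta> H \<and>
        b = pcls (fibre_at P x0) x0 ((\<lambda>s. H (1, s)) +++ reversepath \<eta>))}"

definition reid_classes :: "('a::topological_space, 'b) fibred \<Rightarrow> ('a \<Rightarrow> 'a) \<Rightarrow> 'a \<Rightarrow> (real \<Rightarrow> 'a) \<Rightarrow>
    (real \<Rightarrow> 'a) set set set" where
  "reid_classes P h x0 \<eta> = pi1 (fibre_at P x0) x0 // reid_rel P h x0 \<eta>"

definition rcls :: "('a::topological_space, 'b) fibred \<Rightarrow> ('a \<Rightarrow> 'a) \<Rightarrow> 'a \<Rightarrow> (real \<Rightarrow> 'a) \<Rightarrow>
    (real \<Rightarrow> 'a) \<Rightarrow> (real \<Rightarrow> 'a) set set" where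
  "rcls P h x0 \<eta> \<theta> = reid_rel P h x0 \<eta> `` {pcls (fibre_at P x0) x0 \<theta>}"

text \<open>If there are infinitely many classes, this is 0 by the convention for \<open>card\<close>.\<close>

definition R_B :: "('a::topological_space, 'b) fibred \<Rightarrow> ('a \<Rightarrow> 'a) \<Rightarrow> 'a \<Rightarrow> (real \<Rightarrow> 'a) \<Rightarrow> nat" where
  "R_B P h x0 \<eta> = card (reid_classes P h x0 \<eta>)"

text \<open>The injection \<open>\<phi>\<close> from Nielsen classes to Reidemeister classes.\<close>

definition nielsen_to_reid :: "('a::topological_space, 'b) fibred \<Rightarrow> ('a \<Rightarrow> 'a) \<Rightarrow> 'a \<Rightarrow>
    (real \<Rightarrow> 'a) \<Rightarrow> 'a set \<Rightarrow> (real \<Rightarrow> 'a) set set" where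
  "nielsen_to_reid P h x0 \<eta> N = (THE \<alpha>. \<alpha> \<in> reid_classes P h x0 \<eta> \<and>
     (\<exists>x\<in>N. \<exists>\<theta>\<in>\<Union>\<alpha>.
        path_component_of (EB P h) (x0, to_path (\<theta> +++ \<eta>)) (x, to_path (\<lambda>_. x))))"

definition reid_comp :: "('a::topological_space, 'b) fibred \<Rightarrow> ('a \<Rightarrow> 'a) \<Rightarrow> 'a \<Rightarrow>
    (real \<Rightarrow> 'a) \<Rightarrow> (real \<Rightarrow> 'a) set set \<Rightarrow> ('a \<times> (real \<Rightarrow> 'a)) set" where
  "reid_comp P h x0 \<eta> \<alpha> =
     (\<Union>\<theta>\<in>\<Union>\<alpha>. Collect (path_component_of (EB P h) (x0, to_path (\<theta> +++ \<eta>))))"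

definition reid_index :: "('a::topological_space, 'b::topological_space) fibred \<Rightarrow> ('a \<Rightarrow> 'a) \<Rightarrow>
    'a \<Rightarrow> (real \<Rightarrow> 'a) \<Rightarrow> (real \<Rightarrow> 'a) set set \<Rightarrow>
    (rvec, 'a \<times> (real \<Rightarrow> 'a), 'a chart, 'a chart) nrep set" where
  "reid_index P h x0 \<eta> \<alpha> =
     (if \<exists>N\<in>nielsen_classes P h. nielsen_to_reid P h x0 \<eta> N = \<alpha>
      then nielsen_index P h (THE N. N \<in> nielsen_classes P h \<and> nielsen_to_reid P h x0 \<eta> N = \<alpha>)
      else index_zero P h (reid_comp P h x0 \<eta> \<alpha>))"

definition essential :: "('a::topological_space, 'b::topological_space) fibred \<Rightarrow> ('a \<Rightarrow> 'a) \<Rightarrow>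
    'a \<Rightarrow> (real \<Rightarrow> 'a) \<Rightarrow> (real \<Rightarrow> 'a) set set \<Rightarrow> bool" where
  "essential P h x0 \<eta> \<alpha> \<longleftrightarrow>
     reid_index P h x0 \<eta> \<alpha> \<noteq> index_zero P h (reid_comp P h x0 \<eta> \<alpha>)"


section \<open>Periodic classes\<close>

text \<open>\<open>pconcat \<gamma> k\<close> is the concatenation \<open>\<gamma> 0 * \<dots> * \<gamma> k\<close>.\<close>

primrec pconcat :: "(nat \<Rightarrow> real \<Rightarrow> 'a::topological_space) \<Rightarrow> nat \<Rightarrow> real \<Rightarrow> 'a" where
  "pconcat \<gamma> 0 = \<gamma> 0"
| "pconcat \<gamma> (Suc k) = pconcat \<gamma> k +++ \<gamma> (Suc k)"

text \<open>The path \<open>n(\<omega>)\<close> and the loop \<open>f\<^sup>n\<^sup>\<omega>(\<theta>)\<close>, for \<open>n \<ge> 1\<close>.\<close>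

definition npath :: "('a::topological_space \<Rightarrow> 'a) \<Rightarrow> (real \<Rightarrow> 'a) \<Rightarrow> nat \<Rightarrow> real \<Rightarrow> 'a" where
  "npath f \<omega> n = pconcat (\<lambda>i. (f ^^ i) \<circ> \<omega>) (n - 1)"

definition fpow :: "('a::topological_space \<Rightarrow> 'a) \<Rightarrow> (real \<Rightarrow> 'a) \<Rightarrow> nat \<Rightarrow>
    (real \<Rightarrow> 'a) \<Rightarrow> real \<Rightarrow> 'a" where
  "fpow f \<omega> n \<theta> = (npath f \<omega> n +++ ((f ^^ n) \<circ> \<theta>)) +++ reversepath (npath f \<omega> n)"

definition gam :: "('a::topological_space \<Rightarrow> 'a) \<Rightarrow> (real \<Rightarrow> 'a) \<Rightarrow> nat \<Rightarrow> nat \<Rightarrow>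
    (real \<Rightarrow> 'a) \<Rightarrow> real \<Rightarrow> 'a" where
  "gam f \<omega> m n \<theta> = pconcat (\<lambda>i. if i = 0 then \<theta> else fpow f \<omega> (i * m) \<theta>) (n div m - 1)"

definition Rn :: "('a::topological_space, 'b) fibred \<Rightarrow> ('a \<Rightarrow> 'a) \<Rightarrow> 'a \<Rightarrow> (real \<Rightarrow> 'a) \<Rightarrow> nat \<Rightarrow>
    (real \<Rightarrow> 'a) set set set" where
  "Rn P f x0 \<omega> n = reid_classes P (f ^^ n) x0 (npath f \<omega> n)"

text \<open>Induced maps are computed on representing loops; \<open>the_elem\<close> expresses well-definedness.\<close>

definition fmap :: "('a::topological_space, 'b) fibred \<Rightarrow> ('a \<Rightarrow> 'a) \<Rightarrow> 'a \<Rightarrow> (real \<Rightarrow> 'a) \<Rightarrow> nat \<Rightarrow>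
    (real \<Rightarrow> 'a) set set \<Rightarrow> (real \<Rightarrow> 'a) set set" where
  "fmap P f x0 \<omega> n \<alpha> =
     the_elem ((\<lambda>\<theta>. rcls P (f ^^ n) x0 (npath f \<omega> n) (fpow f \<omega> 1 \<theta>)) ` \<Union>\<alpha>)"

definition gmap :: "('a::topological_space, 'b) fibred \<Rightarrow> ('a \<Rightarrow> 'a) \<Rightarrow> 'a \<Rightarrow> (real \<Rightarrow> 'a) \<Rightarrow>
    nat \<Rightarrow> nat \<Rightarrow> (real \<Rightarrow> 'a) set set \<Rightarrow> (real \<Rightarrow> 'a) set set" where
  "gmap P f x0 \<omega> m n \<alpha> =
     the_elem ((\<lambda>\<theta>. rcls P (f ^^ n) x0 (npath f \<omega> n) (gam f \<omega> m n \<theta>)) ` \<Union>\<alpha>)"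

definition class_orbit :: "('a::topological_space, 'b) fibred \<Rightarrow> ('a \<Rightarrow> 'a) \<Rightarrow> 'a \<Rightarrow> (real \<Rightarrow> 'a) \<Rightarrow>
    nat \<Rightarrow> (real \<Rightarrow> 'a) set set \<Rightarrow> (real \<Rightarrow> 'a) set set set" where
  "class_orbit P f x0 \<omega> n \<alpha> = {(fmap P f x0 \<omega> n ^^ r) \<alpha> | r. True}"

text \<open>Length and depth are constant on orbits and are defined on the elements.\<close>

definition orbit_length :: "('a::topological_space, 'b) fibred \<Rightarrow> ('a \<Rightarrow> 'a) \<Rightarrow> 'a \<Rightarrow> (real \<Rightarrow> 'a) \<Rightarrow>
    nat \<Rightarrow> (real \<Rightarrow> 'a) set set \<Rightarrow> nat" where
  "orbit_length P f x0 \<omega> n \<alpha> = (LEAST r. 1 \<le> r \<and> (fmap P f x0 \<omega> n ^^ r) \<alpha> = \<alpha>)"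

definition reducible_to :: "('a::topological_space, 'b) fibred \<Rightarrow> ('a \<Rightarrow> 'a) \<Rightarrow> 'a \<Rightarrow> (real \<Rightarrow> 'a) \<Rightarrow>
    nat \<Rightarrow> (real \<Rightarrow> 'a) set set \<Rightarrow> nat \<Rightarrow> bool" where
  "reducible_to P f x0 \<omega> n \<alpha> m \<longleftrightarrow> m dvd n \<and> \<alpha> \<in> gmap P f x0 \<omega> m n ` Rn P f x0 \<omega> m"

definition irreducible_class :: "('a::topological_space, 'b) fibred \<Rightarrow> ('a \<Rightarrow> 'a) \<Rightarrow> 'a \<Rightarrow>
    (real \<Rightarrow> 'a) \<Rightarrow> nat \<Rightarrow> (real \<Rightarrow> 'a) set set \<Rightarrow> bool" where
  "irreducible_class P f x0 \<omega> n \<alpha> \<longleftrightarrow> (\<forall>m<n. \<not> reducible_to P f x0 \<omega> n \<alpha> m)"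

definition class_depth :: "('a::topological_space, 'b) fibred \<Rightarrow> ('a \<Rightarrow> 'a) \<Rightarrow> 'a \<Rightarrow> (real \<Rightarrow> 'a) \<Rightarrow>
    nat \<Rightarrow> (real \<Rightarrow> 'a) set set \<Rightarrow> nat" where
  "class_depth P f x0 \<omega> n \<alpha> = (LEAST m. reducible_to P f x0 \<omega> n \<alpha> m)"

definition O_n :: "('a::topological_space, 'b::topological_space) fibred \<Rightarrow> ('a \<Rightarrow> 'a) \<Rightarrow> 'a \<Rightarrow>
    (real \<Rightarrow> 'a) \<Rightarrow> nat \<Rightarrow> nat" where
  "O_n P f x0 \<omega> n = card {class_orbit P f x0 \<omega> n \<alpha> | \<alpha>. \<alpha> \<in> Rn P f x0 \<omega> n \<and>
     irreducible_class P f x0 \<omega> n \<alpha> \<and> essential P (f ^^ n) x0 (npath f \<omega> n) \<alpha>}"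

definition N_BP :: "('a::topological_space, 'b::topological_space) fibred \<Rightarrow> ('a \<Rightarrow> 'a) \<Rightarrow> 'a \<Rightarrow>
    (real \<Rightarrow> 'a) \<Rightarrow> nat \<Rightarrow> nat" where
  "N_BP P f x0 \<omega> n = n * O_n P f x0 \<omega> n"

definition toral :: "('a::topological_space, 'b) fibred \<Rightarrow> ('a \<Rightarrow> 'a) \<Rightarrow> 'a \<Rightarrow> (real \<Rightarrow> 'a) \<Rightarrow>
    nat \<Rightarrow> bool" where
  "toral P f x0 \<omega> n \<longleftrightarrow>
     (\<forall>m. m dvd n \<longrightarrow> (\<forall>\<alpha>\<in>Rn P f x0 \<omega> m.
        class_depth P f x0 \<omega> m \<alpha> = orbit_length P f x0 \<omega> m \<alpha>)) \<and>
     (\<forall>m. m dvd n \<longrightarrow> inj_on (gmap P f x0 \<omega> m n) (Rn P f x0 \<omega> m))"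

function A_inv :: "('a::topological_space, 'b::topological_space) fibred \<Rightarrow> ('a \<Rightarrow> 'a) \<Rightarrow>
    nat \<Rightarrow> int" where
  "A_inv P f n = int (N_B P (f ^^ n)) - (\<Sum>k\<in>{k. k dvd n \<and> k < n}. A_inv P f k)"
  by auto
termination
  by (relation "Wellfounded.measure (\<lambda>(P, f, n). n)") auto

declare A_inv.simps [simp del]

end

theory Submission
  imports Defs
begin

text \<open>
  Let \<open>h\<close> be a map over \<open>B\<close>. The points of \<open>E\<^sub>B(h)\<close> are twisted paths, that is, paths inside a fibre from
  some point \<open>x\<close> to \<open>h x\<close>, and both kinds of classes amount to path components of \<open>E\<^sub>B(h)\<close>. A fixed point
  gives a constant twisted path, and two fixed points are Nielsen equivalent if and only if these
  lie in one component (lemma \<open>nielsen_rel_iff\<close>). A loop \<open>\<theta>\<close> in the fibre gives the twisted path \<open>\<theta> * \<eta>\<close>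
  at \<open>x0\<close>, and two loops are in the same Reidemeister class if and only if these lie in one
  component (lemma \<open>reid_rel_iff\<close>). The homotopy lifting property joins the constant path at a fixed
  point to a twisted path at \<open>x0\<close>, so the Nielsen classes inject into the Reidemeister classes. If
  \<open>N\<^sub>B(h) = R\<^sub>B(h)\<close> is not 0, the essential Nielsen classes already exhaust the finite set of
  Reidemeister classes under this injection, so every Reidemeister class is essential (lemma
  \<open>essential_if_N_B_eq_R_B\<close>).

  In terms of components the maps between Reidemeister classes have simple descriptions:
  \<open>[f\<^bsup>\<omega>\<^esup>]\<close> is induced by \<open>\<alpha> \<mapsto> f(\<alpha>)\<close>, and \<open>[\<gamma>\<^bsub>m,n\<^esub>]\<close> by
  \<open>\<alpha> \<mapsto> \<alpha> * f\<^sup>m(\<alpha>) * \<dots> * f\<^bsup>n-m\<^esup>(\<alpha>)\<close> (lemmas \<open>twist_fpow\<close> and \<open>twist_gam\<close>). These formulas show that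
  the maps are well defined, that \<open>[\<gamma>\<^bsub>m,n\<^esub>]\<close> commutes with \<open>[f\<^bsup>\<omega>\<^esup>]\<close> and is functorial, and that the
  \<open>n\<close>-th iterate of \<open>[f\<^bsup>\<omega>\<^esup>]\<close> is the identity on the classes of \<open>f\<^sup>n\<close>, because a twisted path \<open>\<alpha>\<close> and
  its image \<open>f\<^sup>n(\<alpha>)\<close> are joined by sliding the base point along \<open>\<alpha>\<close>.

  The rest is counting. For a toral map the maps \<open>[\<gamma>\<^bsub>k,m\<^esub>]\<close> are injective and equivariant, so they
  preserve the lengths of orbits; as length equals depth, \<open>[\<gamma>\<^bsub>k,m\<^esub>]\<close> maps the irreducible classes of \<open>f\<^sup>k\<close>
  bijectively onto the classes of \<open>f\<^sup>m\<close> of length \<open>k\<close>. Therefore \<open>N\<^sub>B(f\<^sup>m) = R\<^sub>B(f\<^sup>m)\<close> is the sum over the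
  divisors \<open>k\<close> of \<open>m\<close> of the numbers of irreducible classes of \<open>f\<^sup>k\<close> (lemma \<open>card_eq_sum_irred\<close>). This is
  the recursion for \<open>A\<^sub>m(f)\<close>, so \<open>A\<^sub>n(f)\<close> is the number of irreducible classes of \<open>f\<^sup>n\<close>. They fall into
  orbits of length \<open>n\<close> (lemma \<open>card_irred_orbits\<close>), all of them essential, so this number is \<open>n\<close> times
  the number of irreducible essential orbits.
\<close>

section \<open>Paths in a topological space\<close>

lemma homotopic_paths_const_right:
  assumes "path p" "path_image p \<subseteq> S"
  shows "homotopic_paths S (p +++ (\<lambda>_. pathfinish p)) p"
proof (rule homotopic_paths_sym, rule homotopic_paths_reparametrize[where f = "\<lambda>t. min 1 (2 * t)"])
  show "continuous_on {0..1} (\<lambda>t::real. min 1 (2 * t))"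
    by (intro continuous_intros)
  show "(p +++ (\<lambda>_. pathfinish p)) t = p (min 1 (2 * t))" for t
    by (cases "t = 1/2", hypsubst) (auto simp: joinpaths_def pathfinish_def min_def)
qed (use assms in auto)

lemma homotopic_paths_const_left:
  assumes "path p" "path_image p \<subseteq> S"
  shows "homotopic_paths S ((\<lambda>_. pathstart p) +++ p) p"
proof (rule homotopic_paths_sym, rule homotopic_paths_reparametrize[where f = "\<lambda>t. max 0 (2 * t - 1)"])
  show "continuous_on {0..1} (\<lambda>t::real. max 0 (2 * t - 1))"
    by (intro continuous_intros)
  show "((\<lambda>_. pathstart p) +++ p) t = p (max 0 (2 * t - 1))" for t
    by (cases "t = 1/2", hypsubst) (auto simp: joinpaths_def pathstart_def max_def)
qed (use assms in auto)

text \<open>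
  The contraction runs \<open>p\<close> out to the parameter \<open>1 - t\<close> at time \<open>t\<close> and back again; the tent function
  \<open>1 - \<bar>2 s - 1\<bar>\<close> describes the way out and back.
\<close>

lemma homotopic_paths_reverse_right:
  assumes "path p" "path_image p \<subseteq> S"
  shows "homotopic_paths S (p +++ reversepath p) (\<lambda>_. pathstart p)"
proof -
  define h where "h = (\<lambda>y::real \<times> real. p ((1 - fst y) * (1 - \<bar>2 * snd y - 1\<bar>)))"
  have rng: "(1 - t) * (1 - \<bar>2 * s - 1\<bar>) \<in> {0..1}" if "t \<in> {0..1}" "s \<in> {0..1}" for t s :: real
    using that by (auto intro!: mult_nonneg_nonneg mult_le_one)
  have "continuous_on ({0..1} \<times> {0..1}) h"
    unfolding h_def
  proof (rule continuous_on_compose2[of "{0..1}" p _ "\<lambda>y. (1 - fst y) * (1 - \<bar>2 * snd y - 1\<bar>)"])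
    show "continuous_on {0..1} p"
      using assms(1) by (simp add: path_def)
    show "continuous_on ({0..1} \<times> {0..1})
        (\<lambda>y::real \<times> real. (1 - fst y) * (1 - \<bar>2 * snd y - 1\<bar>))"
      by (intro continuous_intros)
    show "(\<lambda>y::real \<times> real. (1 - fst y) * (1 - \<bar>2 * snd y - 1\<bar>)) ` ({0..1} \<times> {0..1}) \<subseteq> {0..1}"
      by (intro image_subsetI rng) auto
  qed
  moreover have "h \<in> ({0..1} \<times> {0..1}) \<rightarrow> S"
    using assms(2) rng by (auto simp: h_def path_image_def)
  moreover have "h (0, s) = (p +++ reversepath p) s" for s
    by (cases "s \<le> 1/2") (auto simp: h_def joinpaths_def reversepath_def)
  moreover have "h (1, s) = p 0" "h (t, 0) = p 0" "h (t, 1) = p 0" for s t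
    by (simp_all add: h_def)
  ultimately show ?thesis
    unfolding homotopic_paths
    by (intro exI[of _ h]) (simp add: pathstart_def pathfinish_def joinpaths_def reversepath_def)
qed

text \<open>
  The hom-sets of the fundamental groupoid before passing to homotopy classes. Keeping the end
  points as arguments lets every calculation below be checked by composing typings.
\<close>

definition paths_between :: "'a::topological_space set \<Rightarrow> 'a \<Rightarrow> 'a \<Rightarrow> (real \<Rightarrow> 'a) set" where
  "paths_between S x y = {p. path p \<and> path_image p \<subseteq> S \<and> pathstart p = x \<and> pathfinish p = y}"

lemma loops_eq_paths_between: "loops S x = paths_between S x x"
  by (simp add: loops_def paths_between_def)

lemma paths_between_join:
  assumes "p \<in> paths_between S x y" "q \<in> paths_between S y z"
  shows "p +++ q \<in> paths_between S x z"
  using assms unfolding paths_between_def mem_Collect_eq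
  by (metis path_join_imp pathstart_join pathfinish_join subset_path_image_join)

lemma paths_between_reverse:
  assumes "p \<in> paths_between S x y"
  shows "reversepath p \<in> paths_between S y x"
  using assms unfolding paths_between_def mem_Collect_eq
  by (metis path_reversepath path_image_reversepath pathstart_reversepath pathfinish_reversepath)

lemma paths_between_compose:
  assumes "p \<in> paths_between S x y" "continuous_on S g" "g ` S \<subseteq> S'"
  shows "g \<circ> p \<in> paths_between S' (g x) (g y)"
  using assms by (auto simp: paths_between_def path_image_compose pathstart_compose pathfinish_compose
      intro!: path_continuous_image intro: continuous_on_subset)

lemma homotopic_paths_between:
  assumes "homotopic_paths S p q"
  shows "p \<in> paths_between S x y \<longleftrightarrow> q \<in> paths_between S x y"
  using homotopic_paths_imp_path[OF assms] homotopic_paths_imp_subset[OF assms]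
    homotopic_paths_imp_pathstart[OF assms] homotopic_paths_imp_pathfinish[OF assms]
  by (simp add: paths_between_def)

lemma homotopic_refl_between: "p \<in> paths_between S x y \<Longrightarrow> homotopic_paths S p p"
  by (simp add: paths_between_def)

lemma homotopic_join_assoc:
  assumes "p \<in> paths_between S w x" "q \<in> paths_between S x y" "r \<in> paths_between S y z"
  shows "homotopic_paths S ((p +++ q) +++ r) (p +++ (q +++ r))"
  using assms by (intro homotopic_paths_sym[OF homotopic_paths_assoc]) (auto simp: paths_between_def)

lemma homotopic_join_cong:
  assumes "homotopic_paths S p p'" "homotopic_paths S q q'"
    and "p \<in> paths_between S x y" "q \<in> paths_between S y z"
  shows "homotopic_paths S (p +++ q) (p' +++ q')"
  using assms by (intro homotopic_paths_join) (auto simp: paths_between_def)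

lemma homotopic_join_reverse_cancel:
  assumes "p \<in> paths_between S x y" "q \<in> paths_between S z y"
  shows "homotopic_paths S ((q +++ reversepath p) +++ p) q"
proof -
  note p' = paths_between_reverse[OF assms(1)]
  have "homotopic_paths S ((q +++ reversepath p) +++ p) (q +++ (reversepath p +++ p))"
    by (rule homotopic_join_assoc[OF assms(2) p' assms(1)])
  also have "homotopic_paths S \<dots> (q +++ (\<lambda>_. pathfinish q))"
    using assms homotopic_paths_reverse_right[of "reversepath p" S]
    by (intro homotopic_join_cong[OF homotopic_refl_between[OF assms(2)] _ assms(2) paths_between_join[OF p' assms(1)]])
       (auto simp: paths_between_def)
  also have "homotopic_paths S \<dots> q"
    using homotopic_paths_const_right[of q S] assms by (simp add: paths_between_def)
  finally show ?thesis .
qed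

lemma homotopic_join_cong_left:
  assumes "homotopic_paths S p p'" "p' \<in> paths_between S x y" "q \<in> paths_between S y z"
  shows "homotopic_paths S (p +++ q) (p' +++ q)"
  by (rule homotopic_join_cong[OF assms(1) homotopic_refl_between[OF assms(3)] iffD2[OF homotopic_paths_between[OF assms(1)] assms(2)] assms(3)])

lemma homotopic_join_cong_right:
  assumes "homotopic_paths S q q'" "p \<in> paths_between S x y" "q' \<in> paths_between S y z"
  shows "homotopic_paths S (p +++ q) (p +++ q')"
  by (rule homotopic_join_cong[OF homotopic_refl_between[OF assms(2)] assms(1) assms(2) iffD2[OF homotopic_paths_between[OF assms(1)] assms(3)]])

text \<open>
  The common core of the two word computations behind the maps between Reidemeister classes: the
  conjugating path \<open>W'\<close> cancels against the first factor of the path that follows.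
\<close>

lemma homotopic_conjugate_join:
  assumes W: "W \<in> paths_between S a b" and T: "T \<in> paths_between S b c" and Z: "Z \<in> paths_between S c d"
    and W': "W' \<in> paths_between S a c"
  shows "homotopic_paths S (((W +++ T) +++ reversepath W') +++ (W' +++ Z)) (W +++ (T +++ Z))"
proof -
  note WT = paths_between_join[OF W T]
  note WTW = paths_between_join[OF WT paths_between_reverse[OF W']]
  have "homotopic_paths S (((W +++ T) +++ reversepath W') +++ (W' +++ Z))
      ((((W +++ T) +++ reversepath W') +++ W') +++ Z)"
    by (rule homotopic_paths_sym[OF homotopic_join_assoc[OF WTW W' Z]])
  also have "homotopic_paths S \<dots> ((W +++ T) +++ Z)"
    by (rule homotopic_join_cong_left[OF homotopic_join_reverse_cancel[OF W' WT] WT Z])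
  also have "homotopic_paths S \<dots> (W +++ (T +++ Z))"
    by (rule homotopic_join_assoc[OF W T Z])
  finally show ?thesis .
qed

section \<open>The exponential law for the space of paths\<close>

lemma topspace_path_space: "topspace (path_space S) = paths_in S"
proof -
  have "paths_in S \<in> {{\<alpha> \<in> paths_in S. \<alpha> ` K \<subseteq> U} | K U.
      compact K \<and> K \<subseteq> {0..1} \<and> openin (top_of_set S) U}"
    by (rule CollectI, rule exI[of _ "{}"], rule exI[of _ S]) auto
  then show ?thesis
    unfolding path_space_def topology_generated_by_topspace by blast
qed

text \<open>
  The preimage of a subbasic open set is the complement of the projection of a compact set, because
  the second coordinate ranges over a compact interval.
\<close>

lemma continuous_map_path_space_curry:
  fixes F :: "real \<times> real \<Rightarrow> 'a::topological_space"
  assumes F: "continuous_on ({0..1} \<times> {0..1}) F" and S: "F ` ({0..1} \<times> {0..1}) \<subseteq> S"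
  shows "continuous_map (top_of_set {0..1}) (path_space S) (\<lambda>t. to_path (\<lambda>s. F (t, s)))"
  unfolding path_space_def
proof (rule continuous_on_generated_topo)
  have mem: "to_path (\<lambda>s. F (t, s)) \<in> paths_in S" if "t \<in> {0..1}" for t
    unfolding paths_in_def to_path_def
  proof (intro CollectI conjI)
    have "continuous_on {0..1} (\<lambda>s. F (t, s))"
      using that by (intro continuous_on_compose2[OF F] continuous_intros) auto
    then show "continuous_on {0..1} (restrict (\<lambda>s. F (t, s)) {0..1})"
      by (subst continuous_on_cong[OF refl, of _ _ "\<lambda>s. F (t, s)"]) auto
  qed (use that S in \<open>auto\<close>)
  show "(\<lambda>t. to_path (\<lambda>s. F (t, s))) ` topspace (top_of_set {0..1}) \<subseteq>
      \<Union> {{\<alpha> \<in> paths_in S. \<alpha> ` K \<subseteq> U} |K U. compact K \<and> K \<subseteq> {0..1} \<and> openin (top_of_set S) U}"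
    using mem topspace_path_space[of S] unfolding path_space_def topology_generated_by_topspace
    by (simp add: image_subset_iff)
  fix V
  assume "V \<in> {{\<alpha> \<in> paths_in S. \<alpha> ` K \<subseteq> U} |K U. compact K \<and> K \<subseteq> {0..1} \<and> openin (top_of_set S) U}"
  then obtain K U where V: "V = {\<alpha> \<in> paths_in S. \<alpha> ` K \<subseteq> U}" and K: "compact K" "K \<subseteq> {0..1}"
    and U: "openin (top_of_set S) U" by blast
  define C where "C = fst ` {z \<in> {0..1} \<times> K. F z \<in> S - U}"
  have "continuous_on ({0..1} \<times> K) F" "F ` ({0..1} \<times> K) \<subseteq> S"
    using F S K by (auto intro: continuous_on_subset)
  then have "closedin (top_of_set ({0..1} \<times> K)) (({0..1} \<times> K) \<inter> F -` (S - U))"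
    using U by (intro continuous_closedin_preimage_gen[of _ F S]) auto
  moreover have "compact ({0..1::real} \<times> K)"
    using K by (simp add: compact_Times)
  ultimately have "compact (({0..1} \<times> K) \<inter> F -` (S - U))"
    using closedin_compact by blast
  then have "compact (fst ` (({0..1} \<times> K) \<inter> F -` (S - U)))"
    by (intro compact_continuous_image continuous_on_fst continuous_on_id)
  then have "closed C"
    unfolding C_def by (simp add: compact_imp_closed vimage_def Int_def)
  have "(\<lambda>t. to_path (\<lambda>s. F (t, s))) -` V \<inter> topspace (top_of_set {0..1}) = {0..1} - C"
  proof (intro set_eqI)
    fix t
    have "to_path (\<lambda>s. F (t, s)) \<in> V \<longleftrightarrow> t \<notin> C" if t: "t \<in> {0..1}"
    proof -
      have "to_path (\<lambda>s. F (t, s)) ` K = (\<lambda>s. F (t, s)) ` K"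
        using K by (intro image_cong) (auto simp: to_path_def)
      moreover have "F (t, s) \<in> S" if "s \<in> K" for s
        using K S t that by blast
      moreover have "t \<in> C \<longleftrightarrow> (\<exists>s\<in>K. F (t, s) \<in> S - U)"
        using t by (auto simp: C_def image_iff)
      ultimately show ?thesis
        using mem[OF t] by (auto simp: V)
    qed
    then show "t \<in> (\<lambda>t. to_path (\<lambda>s. F (t, s))) -` V \<inter> topspace (top_of_set {0..1}) \<longleftrightarrow>
        t \<in> {0..1} - C"
      by auto
  qed
  then show "openin (top_of_set {0..1}) ((\<lambda>t. to_path (\<lambda>s. F (t, s))) -` V \<inter> topspace (top_of_set {0..1}))"
    using \<open>closed C\<close> by (metis Diff_eq closed_def openin_open_Int)
qed

text \<open>
  Evaluation is continuous because the interval is locally compact: near \<open>s0\<close> the path \<open>g t0\<close> keeps a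
  whole compact neighbourhood inside a given open set, and so do all nearby paths \<open>g t\<close>.
\<close>

lemma continuous_map_path_space_uncurry:
  fixes g :: "real \<Rightarrow> real \<Rightarrow> 'a::topological_space"
  assumes g: "continuous_map (top_of_set {0..1}) (path_space S) g"
  shows "continuous_on ({0..1} \<times> {0..1}) (\<lambda>(t, s). g t s)"
    and "t \<in> {0..1} \<Longrightarrow> s \<in> {0..1} \<Longrightarrow> g t s \<in> S"
proof -
  have mem: "g t \<in> paths_in S" if "t \<in> {0..1}" for t
    using continuous_map_image_subset_topspace[OF g] that by (auto simp: topspace_path_space)
  then show *: "g t s \<in> S" if "t \<in> {0..1}" "s \<in> {0..1}" for t s
    using mem[OF that(1)] that(2) by (auto simp: paths_in_def)
  have "continuous_map (top_of_set ({0..1} \<times> {0..1})) (top_of_set S) (\<lambda>(t, s). g t s)"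
    unfolding continuous_map_def
  proof (intro conjI allI impI)
    fix U assume U: "openin (top_of_set S) U"
    show "openin (top_of_set ({0..1} \<times> {0..1}))
        {z \<in> topspace (top_of_set ({0..1} \<times> {0..1})). (case z of (t, s) \<Rightarrow> g t s) \<in> U}"
    proof (subst openin_subopen, intro ballI)
      fix z assume "z \<in> {z \<in> topspace (top_of_set ({0..1} \<times> {0..1})). (case z of (t, s) \<Rightarrow> g t s) \<in> U}"
      then obtain t0 s0 where z: "z = (t0, s0)" "t0 \<in> {0..1}" "s0 \<in> {0..1}" "g t0 s0 \<in> U"
        by auto
      have "openin (top_of_set {0..1}) ({0..1} \<inter> g t0 -` U)"
        using mem[OF z(2)] U by (intro continuous_openin_preimage[of _ _ S]) (auto simp: paths_in_def)
      then have "\<exists>e>0. \<forall>s\<in>{0..1}. dist s s0 < e \<longrightarrow> s \<in> {0..1} \<inter> g t0 -` U"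
        unfolding openin_euclidean_subtopology_iff using z by blast
      then obtain e where e: "e > 0" "\<And>s. s \<in> {0..1} \<Longrightarrow> dist s s0 < e \<Longrightarrow> g t0 s \<in> U"
        by auto
      define K where "K = {0..1} \<inter> cball s0 (e / 2)"
      have "openin (path_space S) {\<alpha> \<in> paths_in S. \<alpha> ` K \<subseteq> U}"
        unfolding path_space_def
        by (rule topology_generated_by_Basis, rule CollectI, intro exI[of _ K] exI[of _ U])
          (simp add: U K_def compact_Int)
      from openin_continuous_map_preimage[OF g this]
      have V: "openin (top_of_set {0..1}) {t \<in> {0..1}. g t \<in> {\<alpha> \<in> paths_in S. \<alpha> ` K \<subseteq> U}}"
        (is "openin _ ?V") by simp
      have "openin (top_of_set ({0..1} \<times> {0..1})) (?V \<times> ({0..1} \<inter> ball s0 (e / 2)))"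
        by (intro openin_Times V openin_open_Int) auto
      moreover have "z \<in> ?V \<times> ({0..1} \<inter> ball s0 (e / 2))"
      proof -
        have "g t0 ` K \<subseteq> U"
          using e by (auto simp: K_def dist_commute)
        then show ?thesis
          using z e(1) mem[OF z(2)] by simp
      qed
      moreover have "?V \<times> ({0..1} \<inter> ball s0 (e / 2)) \<subseteq>
          {z \<in> topspace (top_of_set ({0..1} \<times> {0..1})). (case z of (t, s) \<Rightarrow> g t s) \<in> U}"
      proof safe
        fix t s
        assume "g t ` K \<subseteq> U" "t \<in> {0..1}" "s \<in> {0..1}" "s \<in> ball s0 (e / 2)"
        then show "(t, s) \<in> topspace (top_of_set ({0..1} \<times> {0..1}))" "g t s \<in> U"
          by (simp_all add: K_def image_subset_iff)
      qed
      ultimately show "\<exists>T. openin (top_of_set ({0..1} \<times> {0..1})) T \<and> z \<in> T \<and> T \<subseteq>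
          {z \<in> topspace (top_of_set ({0..1} \<times> {0..1})). (case z of (t, s) \<Rightarrow> g t s) \<in> U}"
        by blast
    qed
  qed (use * in auto)
  then show "continuous_on ({0..1} \<times> {0..1}) (\<lambda>(t, s). g t s)"
    by simp
qed

section \<open>Path components of \<open>E\<^sub>B(h)\<close>\<close>

text \<open>
  A path from \<open>x\<close> to \<open>h x\<close> inside a fibre is a point of \<open>E\<^sub>B(h)\<close>; such paths are called twisted paths
  below. Working with plain functions on \<open>real\<close> instead of points of the path space makes it possible
  to join them and to compose them with maps.
\<close>

definition same_component :: "('a::topological_space, 'b) fibred \<Rightarrow> ('a \<Rightarrow> 'a) \<Rightarrow>
    (real \<Rightarrow> 'a) \<Rightarrow> (real \<Rightarrow> 'a) \<Rightarrow> bool" where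
  "same_component P h \<alpha> \<beta> \<longleftrightarrow>
     path_component_of (EB P h) (\<alpha> 0, to_path \<alpha>) (\<beta> 0, to_path \<beta>)"

text \<open>
  By the exponential law these squares are exactly the paths in \<open>E\<^sub>B(h)\<close>; the first coordinate is the
  time.
\<close>

definition twisted_square :: "('a::topological_space, 'b) fibred \<Rightarrow> ('a \<Rightarrow> 'a) \<Rightarrow>
    (real \<times> real \<Rightarrow> 'a) \<Rightarrow> bool" where
  "twisted_square P h K \<longleftrightarrow> continuous_on ({0..1} \<times> {0..1}) K \<and>
     (\<forall>t\<in>{0..1}. \<forall>s\<in>{0..1}. K (t, s) \<in> fibre_at P (K (t, 0))) \<and>
     (\<forall>t\<in>{0..1}. K (t, 1) = h (K (t, 0)))"

lemma twisted_squareD: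
  assumes "twisted_square P h K" "t \<in> {0..1}"
  shows "(\<lambda>s. K (t, s)) \<in> paths_between (fibre_at P (K (t, 0))) (K (t, 0)) (h (K (t, 0)))"
proof -
  have "continuous_on {0..1} (\<lambda>s. K (t, s))"
  proof (rule continuous_on_compose2[of "{0..1} \<times> {0..1}" K])
    show "continuous_on {0..1} (\<lambda>s. (t, s))"
      by (intro continuous_intros)
  qed (use assms in \<open>auto simp: twisted_square_def\<close>)
  then show ?thesis
    using assms by (auto simp: paths_between_def path_def path_image_def pathstart_def
        pathfinish_def twisted_square_def)
qed

lemma same_componentI:
  assumes K: "twisted_square P h K" and \<alpha>: "\<And>s. s \<in> {0..1} \<Longrightarrow> K (0, s) = \<alpha> s"
    and \<beta>: "\<And>s. s \<in> {0..1} \<Longrightarrow> K (1, s) = \<beta> s"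
  shows "same_component P h \<alpha> \<beta>"
proof -
  define g where "g = (\<lambda>t. (K (t, 0), to_path (\<lambda>s. K (t, s))))"
  have cont: "continuous_on ({0..1} \<times> {0..1}) K" and fib: "\<And>t s. t \<in> {0..1} \<Longrightarrow> s \<in> {0..1} \<Longrightarrow>
      K (t, s) \<in> fibre_at P (K (t, 0))"
    and h: "\<And>t. t \<in> {0..1} \<Longrightarrow> K (t, 1) = h (K (t, 0))"
    using K by (auto simp: twisted_square_def)
  have tot: "K ` ({0..1} \<times> {0..1}) \<subseteq> tot P"
    using fib by (auto simp: fibre_def)
  have "continuous_on {0..1} (\<lambda>t. K (t, 0))"
    by (intro continuous_on_compose2[OF cont] continuous_intros) auto
  then have "continuous_map (top_of_set {0..1}) (top_of_set (tot P)) (\<lambda>t. K (t, 0))"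
    using tot by (auto simp: continuous_map_in_subtopology)
  then have "continuous_map (top_of_set {0..1}) (prod_topology (top_of_set (tot P)) (path_space (tot P))) g"
    unfolding g_def
    by (intro continuous_map_pairedI continuous_map_path_space_curry[OF cont tot])
  moreover have "g t \<in> {(x, \<alpha>). (\<forall>t\<in>{0..1}. prj P (\<alpha> t) = prj P x) \<and> \<alpha> 0 = x \<and> \<alpha> 1 = h x}"
    if "t \<in> {0..1}" for t
  proof -
    have "\<forall>s\<in>{0..1}. prj P (to_path (\<lambda>s. K (t, s)) s) = prj P (K (t, 0))"
      proof
      fix s :: real assume s: "s \<in> {0..1}"
      show "prj P (to_path (\<lambda>s. K (t, s)) s) = prj P (K (t, 0))"
        using s fib[OF that s] by (simp add: to_path_def fibre_def)
    qed
    moreover have "to_path (\<lambda>s. K (t, s)) 0 = K (t, 0)" "to_path (\<lambda>s. K (t, s)) 1 = h (K (t, 0))"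
      using h[OF that] by (simp_all add: to_path_def)
    ultimately show ?thesis
      unfolding g_def mem_Collect_eq prod.case by blast
  qed
  ultimately have "pathin (EB P h) g"
    by (auto simp: pathin_def EB_def continuous_map_in_subtopology)
  moreover have "g 0 = (\<alpha> 0, to_path \<alpha>)" "g 1 = (\<beta> 0, to_path \<beta>)"
    using \<alpha> \<beta> by (auto simp: g_def to_path_def)
  ultimately show ?thesis
    unfolding same_component_def path_component_of_def by blast
qed

lemma same_componentE:
  assumes "same_component P h \<alpha> \<beta>"
  obtains K where "twisted_square P h K" "\<And>s. s \<in> {0..1} \<Longrightarrow> K (0, s) = \<alpha> s"
    "\<And>s. s \<in> {0..1} \<Longrightarrow> K (1, s) = \<beta> s"
proof -
  obtain g where g: "pathin (EB P h) g" "g 0 = (\<alpha> 0, to_path \<alpha>)" "g 1 = (\<beta> 0, to_path \<beta>)"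
    using assms unfolding same_component_def path_component_of_def by blast
  define K where "K = (\<lambda>(t, s). snd (g t) s)"
  have gc: "continuous_map (top_of_set {0..1})
      (prod_topology (top_of_set (tot P)) (path_space (tot P))) g"
    and gT: "g \<in> {0..1} \<rightarrow> {(x, \<alpha>). (\<forall>t\<in>{0..1}. prj P (\<alpha> t) = prj P x) \<and> \<alpha> 0 = x \<and> \<alpha> 1 = h x}"
    using g(1) unfolding pathin_def EB_def continuous_map_in_subtopology by simp_all
  have gE: "\<And>t. t \<in> {0..1} \<Longrightarrow> (\<forall>s\<in>{0..1}. prj P (snd (g t) s) = prj P (fst (g t))) \<and>
        snd (g t) 0 = fst (g t) \<and> snd (g t) 1 = h (fst (g t))"
    using Pi_mem[OF gT] unfolding case_prod_beta mem_Collect_eq by blast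
  have "continuous_map (top_of_set {0..1}) (path_space (tot P)) (\<lambda>t. snd (g t))"
    using gc by (simp add: continuous_map_pairwise o_def)
  note u = continuous_map_path_space_uncurry[OF this]
  have "twisted_square P h K"
    unfolding twisted_square_def
  proof (intro conjI ballI)
    show "continuous_on ({0..1} \<times> {0..1}) K"
      using u(1) by (simp add: K_def)
    fix t :: real assume t: "t \<in> {0..1}"
    show "K (t, 1) = h (K (t, 0))"
      using gE[OF t] by (simp add: K_def)
    fix s :: real assume s: "s \<in> {0..1}"
    have "prj P (snd (g t) s) = prj P (fst (g t))" "snd (g t) 0 = fst (g t)"
      using gE[OF t] s by blast+
    then show "K (t, s) \<in> fibre_at P (K (t, 0))"
      using u(2)[OF t s] by (simp add: K_def fibre_def)
  qed
  moreover have "K (0, s) = \<alpha> s" "K (1, s) = \<beta> s" if "s \<in> {0..1}" for s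
    using that g by (auto simp: K_def to_path_def)
  ultimately show ?thesis
    using that by blast
qed

lemma same_component_sym: "same_component P h \<alpha> \<beta> \<Longrightarrow> same_component P h \<beta> \<alpha>"
  unfolding same_component_def by (rule path_component_of_sym)

lemma same_component_trans [trans]:
  "same_component P h \<alpha> \<beta> \<Longrightarrow> same_component P h \<beta> \<gamma> \<Longrightarrow> same_component P h \<alpha> \<gamma>"
  unfolding same_component_def by (rule path_component_of_trans)

lemma same_component_homotopic:
  assumes "homotopic_paths (fibre_at P x) \<alpha> \<beta>" "\<alpha> \<in> paths_between (fibre_at P x) x (h x)"
  shows "same_component P h \<alpha> \<beta>"
proof -
  obtain K :: "real \<times> real \<Rightarrow> 'a" where K: "continuous_on ({0..1} \<times> {0..1}) K" "K \<in> ({0..1} \<times> {0..1}) \<rightarrow> fibre_at P x"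
    "\<forall>s\<in>{0..1}. K (0, s) = \<alpha> s" "\<forall>s\<in>{0..1}. K (1, s) = \<beta> s"
    "\<forall>t\<in>{0..1}. pathstart (K \<circ> Pair t) = pathstart \<alpha> \<and> pathfinish (K \<circ> Pair t) = pathfinish \<alpha>"
    using assms(1) unfolding homotopic_paths by blast
  have K0: "K (t, 0) = x" "K (t, 1) = h x" if "t \<in> {0..1}" for t
    using K(5) that assms(2) by (simp_all add: paths_between_def pathstart_def pathfinish_def)
  show ?thesis
  proof (rule same_componentI)
    show "twisted_square P h K"
      unfolding twisted_square_def
    proof (intro conjI ballI K(1))
      fix t :: real assume t: "t \<in> {0..1}"
      show "K (t, 1) = h (K (t, 0))"
        using K0[OF t] by simp
      fix s :: real assume s: "s \<in> {0..1}"
      show "K (t, s) \<in> fibre_at P (K (t, 0))"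
        using K(2) K0(1)[OF t] t s by auto
    qed
  qed (use K in auto)
qed

lemma same_component_refl:
  assumes "\<alpha> \<in> paths_between (fibre_at P x) x (h x)"
  shows "same_component P h \<alpha> \<alpha>"
  using homotopic_refl_between[OF assms] assms by (rule same_component_homotopic)

lemma same_component_image:
  assumes "same_component P h \<alpha> \<beta>" "map_over P g" "\<And>x. x \<in> tot P \<Longrightarrow> g (h x) = h (g x)"
  shows "same_component P h (g \<circ> \<alpha>) (g \<circ> \<beta>)"
proof -
  from assms(1) obtain K where K: "twisted_square P h K" "\<And>s. s \<in> {0..1} \<Longrightarrow> K (0, s) = \<alpha> s"
    "\<And>s. s \<in> {0..1} \<Longrightarrow> K (1, s) = \<beta> s" by (rule same_componentE) blast
  have tot: "K (t, s) \<in> tot P" if "t \<in> {0..1}" "s \<in> {0..1}" for t s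
    using K(1) that by (auto simp: twisted_square_def fibre_def)
  show ?thesis
  proof (rule same_componentI)
    have "continuous_on ({0..1} \<times> {0..1}) (g \<circ> K)"
    proof (rule continuous_on_compose)
      show "continuous_on ({0..1} \<times> {0..1}) K"
        using K(1) by (simp add: twisted_square_def)
      show "continuous_on (K ` ({0..1} \<times> {0..1})) g"
        using assms(2) tot by (auto simp: map_over_def intro!: continuous_on_subset[of "tot P" g])
    qed
    moreover have "(g \<circ> K) (t, s) \<in> fibre_at P ((g \<circ> K) (t, 0))"
      if t: "t \<in> {0..1}" and s: "s \<in> {0..1}" for t s
    proof -
      have "K (t, s) \<in> fibre_at P (K (t, 0))"
        using K(1) t s by (simp add: twisted_square_def)
      then show ?thesis
        using assms(2) tot[OF t s] tot[OF t, of 0] by (simp add: map_over_def fibre_def image_subset_iff)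
    qed
    moreover have "(g \<circ> K) (t, 1) = h ((g \<circ> K) (t, 0))" if t: "t \<in> {0..1}" for t
      using K(1) assms(3)[OF tot[OF t, of 0]] t by (simp add: twisted_square_def)
    ultimately show "twisted_square P h (g \<circ> K)"
      unfolding twisted_square_def by blast
  qed (use K in auto)
qed

text \<open>
  Slide the base point of the twisted path along \<open>\<delta>\<close>: at time \<open>t\<close> use only the part of \<open>\<delta>\<close> after the
  parameter \<open>t\<close>, and follow the same part of \<open>h \<circ> \<delta>\<close> backwards at the end. This is the twisted form of
  the fact that conjugate loops are freely homotopic.
\<close>

lemma same_component_conjugate:
  assumes h: "map_over P h" and \<delta>: "\<delta> \<in> paths_between (fibre_at P x) y z"
    and \<beta>: "\<beta> \<in> paths_between (fibre_at P x) z (h z)"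
  shows "same_component P h ((\<delta> +++ \<beta>) +++ reversepath (h \<circ> \<delta>)) \<beta>"
proof -
  define Y where "Y = fibre_at P x"
  have Y: "Y \<subseteq> tot P" "continuous_on Y h" "h ` Y \<subseteq> Y" "\<And>y. y \<in> Y \<Longrightarrow> fibre_at P y = Y"
    using h by (auto simp: Y_def fibre_def map_over_def intro: continuous_on_subset)
  have \<delta>Y: "path \<delta>" "\<And>t. t \<in> {0..1} \<Longrightarrow> \<delta> t \<in> Y" "\<delta> 0 = y" "\<delta> 1 = z"
    using \<delta> by (auto simp: Y_def paths_between_def path_image_def pathstart_def pathfinish_def)
  have \<beta>Y: "path \<beta>" "\<And>t. t \<in> {0..1} \<Longrightarrow> \<beta> t \<in> Y" "\<beta> 0 = z" "\<beta> 1 = h z"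
    using \<beta> by (auto simp: Y_def paths_between_def path_image_def pathstart_def pathfinish_def)
  \<comment> \<open>\<open>d t\<close> is the part of \<open>\<delta>\<close> from the parameter \<open>t\<close> to the end.\<close>
  define d where "d = (\<lambda>t s. \<delta> (1 - (1 - t) * (1 - s)))"
  have rng: "1 - (1 - t) * (1 - s) \<in> {0..1}" if "t \<in> {0..1}" "s \<in> {0..1}" for t s :: real
    using that mult_nonneg_nonneg[of "1-t" "1-s"] mult_le_one[of "1-t" "1-s"] by auto
  have dY: "d t s \<in> Y" if "t \<in> {0..1}" "s \<in> {0..1}" for t s
    using rng[OF that] \<delta>Y by (simp add: d_def)
  have d: "continuous_on ({0..1} \<times> {0..1}) (\<lambda>y. d (fst y) (snd y))"
    unfolding d_def
  proof (rule continuous_on_compose2[of "{0..1}" \<delta> _ "\<lambda>y. 1 - (1 - fst y) * (1 - snd y)"])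
    show "continuous_on {0..1} \<delta>"
      using \<delta>Y by (simp add: path_def)
    show "continuous_on ({0..1} \<times> {0..1}) (\<lambda>y::real\<times>real. 1 - (1 - fst y) * (1 - snd y))"
      by (intro continuous_intros)
    show "(\<lambda>y::real\<times>real. 1 - (1 - fst y) * (1 - snd y)) ` ({0..1} \<times> {0..1}) \<subseteq> {0..1}"
      by (intro image_subsetI rng) auto
  qed
  have hd: "continuous_on ({0..1} \<times> {0..1}) (\<lambda>y. reversepath (h \<circ> d (fst y)) (snd y))"
    unfolding reversepath_def o_def
  proof (rule continuous_on_compose2[OF Y(2), of _ "\<lambda>y. d (fst y) (1 - snd y)"])
    show "continuous_on ({0..1} \<times> {0..1}) (\<lambda>y. d (fst y) (1 - snd y))"
      by (rule continuous_on_compose2[OF d, of _ "\<lambda>y. (fst y, 1 - snd y)", simplified])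
        (auto intro!: continuous_intros)
  qed (auto intro!: dY)
  have \<beta>c: "continuous_on ({0..1} \<times> {0..1}) (\<lambda>y::real\<times>real. \<beta> (snd y))"
    by (rule continuous_on_compose2[of "{0..1}" \<beta>])
       (use \<beta>Y in \<open>auto simp: path_def intro!: continuous_intros\<close>)
  define K where "K = (\<lambda>y. ((d (fst y) +++ \<beta>) +++ reversepath (h \<circ> d (fst y))) (snd y))"
  have ends: "pathfinish (d t) = z" "pathfinish (h \<circ> d t) = h z" "pathstart (h \<circ> d t) = h (d t 0)"
     "pathstart \<beta> = z" "pathfinish \<beta> = h z" for t
    using \<delta>Y \<beta>Y by (auto simp: pathfinish_def pathstart_def d_def)
  have Kc: "continuous_on ({0..1} \<times> {0..1}) K"
    unfolding K_def
    by (intro continuous_on_homotopic_join_lemma d hd \<beta>c) (simp_all add: ends ends[unfolded o_def])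
  have K0: "K (t, 0) = d t 0" "K (t, 1) = h (d t 0)" for t
    by (simp_all add: K_def joinpaths_def reversepath_def)
  have KY: "K (t, s) \<in> Y" if "t \<in> {0..1}" "s \<in> {0..1}" for t s
  proof -
    have "path_image (d t) \<subseteq> Y" "path_image \<beta> \<subseteq> Y"
      using dY[OF that(1)] \<beta>Y by (auto simp: path_image_def)
    moreover from this have "path_image (h \<circ> d t) \<subseteq> Y"
      using Y(3) by (auto simp: path_image_def)
    ultimately have "path_image ((d t +++ \<beta>) +++ reversepath (h \<circ> d t)) \<subseteq> Y"
      by (intro subset_path_image_join) simp_all
    then show ?thesis
      using that(2) by (auto simp: K_def path_image_def)
  qed
  have "twisted_square P h K"
    unfolding twisted_square_def
  proof (intro conjI ballI Kc)
    fix t :: real assume t: "t \<in> {0..1}"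
    show "K (t, 1) = h (K (t, 0))"
      by (simp add: K0)
    fix s :: real assume s: "s \<in> {0..1}"
    show "K (t, s) \<in> fibre_at P (K (t, 0))"
      using KY[OF t s] KY[OF t, of 0] Y(4) by simp
  qed
  then have "same_component P h ((d 0 +++ \<beta>) +++ reversepath (h \<circ> d 0)) ((d 1 +++ \<beta>) +++ reversepath (h \<circ> d 1))"
    by (rule same_componentI) (simp_all add: K_def)
  moreover have "d 0 = \<delta>"
    by (simp add: d_def)
  moreover have "d 1 = (\<lambda>_. pathstart \<beta>)"
    using ends \<delta>Y by (simp add: d_def)
  moreover have "same_component P h (((\<lambda>_. pathstart \<beta>) +++ \<beta>) +++ reversepath (h \<circ> (\<lambda>_. pathstart \<beta>))) \<beta>"
  proof -
    have zY: "z \<in> Y"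
      using \<delta>Y(2)[of 1] \<delta>Y(4) by simp
    have c: "(\<lambda>_. pathstart \<beta>) \<in> paths_between Y z z"
      using ends zY by (auto simp: paths_between_def path_image_def pathstart_def pathfinish_def path_def)
    have \<beta>b: "\<beta> \<in> paths_between Y z (h z)"
      using \<beta> by (simp add: Y_def)
    have e: "reversepath (h \<circ> (\<lambda>_. pathstart \<beta>)) = (\<lambda>_. pathfinish ((\<lambda>_. pathstart \<beta>) +++ \<beta>))"
      using ends by (auto simp: reversepath_def)
    have cb: "(\<lambda>_. pathstart \<beta>) +++ \<beta> \<in> paths_between Y z (h z)"
      by (rule paths_between_join[OF c \<beta>b])
    have "homotopic_paths Y (((\<lambda>_. pathstart \<beta>) +++ \<beta>) +++ reversepath (h \<circ> (\<lambda>_. pathstart \<beta>)))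
        ((\<lambda>_. pathstart \<beta>) +++ \<beta>)"
      unfolding e by (rule homotopic_paths_const_right) (use cb in \<open>simp_all add: paths_between_def\<close>)
    also have "homotopic_paths Y \<dots> \<beta>"
      by (rule homotopic_paths_const_left) (use \<beta>b in \<open>simp_all add: paths_between_def\<close>)
    finally have hp: "homotopic_paths Y (((\<lambda>_. pathstart \<beta>) +++ \<beta>) +++ reversepath (h \<circ> (\<lambda>_. pathstart \<beta>))) \<beta>" .
    show ?thesis
      using same_component_homotopic[of P z, unfolded Y(4)[OF zY], OF hp] \<beta>b
        homotopic_paths_between[OF hp] by blast
  qed
  ultimately show ?thesis
    by (metis same_component_trans)
qed

section \<open>Joining the iterates of a path\<close>

lemma map_over_funpow: "map_over P f \<Longrightarrow> map_over P (f ^^ n)"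
proof (induction n)
  case 0
  then show ?case by (simp add: map_over_def id_def continuous_on_id)
next
  case (Suc n)
  then have f: "map_over P f" "map_over P (f ^^ n)" by simp_all
  have "continuous_on (tot P) (f \<circ> (f ^^ n))"
    using f by (intro continuous_on_compose) (auto simp: map_over_def intro: continuous_on_subset)
  then show ?case
    using f by (auto simp: map_over_def image_subset_iff)
qed

lemma map_over_fibre:
  assumes "map_over P f"
  shows "continuous_on (fibre_at P x) f" "f ` fibre_at P x \<subseteq> fibre_at P x"
  using assms by (auto simp: map_over_def fibre_def intro: continuous_on_subset)

lemma map_over_paths_between:
  assumes "map_over P f" "p \<in> paths_between (fibre_at P x) y z"
  shows "f \<circ> p \<in> paths_between (fibre_at P x) (f y) (f z)"
  by (rule paths_between_compose[OF assms(2) map_over_fibre[OF assms(1)]])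

lemma npath_1 [simp]: "npath f \<omega> (Suc 0) = \<omega>"
  by (simp add: npath_def)

lemma npath_Suc: "1 \<le> k \<Longrightarrow> npath f \<omega> (Suc k) = npath f \<omega> k +++ ((f ^^ k) \<circ> \<omega>)"
  by (cases k) (simp_all add: npath_def)

lemma npath_between:
  assumes f: "map_over P f" and w: "\<omega> \<in> paths_between (fibre_at P x) y (f y)" and "1 \<le> k"
  shows "npath f \<omega> k \<in> paths_between (fibre_at P x) y ((f ^^ k) y)"
  using \<open>1 \<le> k\<close>
proof (induction k rule: dec_induct)
  case base
  then show ?case using w by simp
next
  case (step k)
  have "(f ^^ k) \<circ> \<omega> \<in> paths_between (fibre_at P x) ((f ^^ k) y) ((f ^^ k) (f y))"
    by (rule map_over_paths_between[OF map_over_funpow[OF f] w])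
  then show ?case
    using paths_between_join[OF step.IH] step.hyps by (simp add: npath_Suc funpow_swap1)
qed

text \<open>
  Since the \<open>i\<close>-th factor of \<open>npath f \<omega>\<close> is \<open>f\<^sup>i \<circ> \<omega>\<close>, the last \<open>b\<close> factors are the image under \<open>f\<^sup>a\<close> of the
  first \<open>b\<close>; only the bracketing differs.
\<close>

lemma npath_add:
  assumes f: "map_over P f" and w: "\<omega> \<in> paths_between (fibre_at P x) y (f y)"
    and a: "1 \<le> a" and "1 \<le> b"
  shows "homotopic_paths (fibre_at P x) (npath f \<omega> (a + b)) (npath f \<omega> a +++ ((f ^^ a) \<circ> npath f \<omega> b))"
  using \<open>1 \<le> b\<close>
proof (induction b rule: dec_induct)
  case base
  have "npath f \<omega> (a + 1) = npath f \<omega> a +++ ((f ^^ a) \<circ> npath f \<omega> 1)"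
    using npath_Suc[OF a, of f \<omega>] by simp
  then show ?case
    using homotopic_refl_between[OF npath_between[OF f w, of "a + 1"]] by (metis le_add2)
next
  case (step b)
  note fa = map_over_paths_between[OF map_over_funpow[OF f]]
  let ?A = "npath f \<omega> a" and ?B = "npath f \<omega> b" and ?w = "(f ^^ (a + b)) \<circ> \<omega>"
  have A: "?A \<in> paths_between (fibre_at P x) y ((f ^^ a) y)"
    by (rule npath_between[OF f w a])
  have B: "(f ^^ a) \<circ> ?B \<in> paths_between (fibre_at P x) ((f ^^ a) y) ((f ^^ a) ((f ^^ b) y))"
    by (rule fa[OF npath_between[OF f w step.hyps(1)]])
  have W: "?w \<in> paths_between (fibre_at P x) ((f ^^ a) ((f ^^ b) y)) ((f ^^ (a + b)) (f y))"
    using fa[OF w, of "a + b"] by (simp add: funpow_add)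
  have eq: "npath f \<omega> (a + Suc b) = npath f \<omega> (a + b) +++ ?w"
    using npath_Suc[of "a + b" f \<omega>] a by simp
  have "homotopic_paths (fibre_at P x) (npath f \<omega> (a + b) +++ ?w) ((?A +++ ((f ^^ a) \<circ> ?B)) +++ ?w)"
    by (rule homotopic_join_cong_left[OF step.IH paths_between_join[OF A B] W])
  also have "homotopic_paths (fibre_at P x) \<dots> (?A +++ (((f ^^ a) \<circ> ?B) +++ ?w))"
    by (rule homotopic_join_assoc[OF A B W])
  also have "((f ^^ a) \<circ> ?B) +++ ?w = (f ^^ a) \<circ> npath f \<omega> (Suc b)"
    using step.hyps by (simp add: npath_Suc path_compose_join funpow_add comp_assoc)
  finally show ?case unfolding eq .
qed

text \<open>
  For twisted paths this is the functoriality of the maps \<open>\<gamma>\<^bsub>m,n\<^esub>\<close>.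
\<close>

lemma npath_mult:
  assumes f: "map_over P f" and w: "\<omega> \<in> paths_between (fibre_at P x) y (f y)"
    and m: "1 \<le> m" and "1 \<le> k"
  shows "homotopic_paths (fibre_at P x) (npath (f ^^ m) (npath f \<omega> m) k) (npath f \<omega> (m * k))"
  using \<open>1 \<le> k\<close>
proof (induction k rule: dec_induct)
  case base
  then show ?case
    using homotopic_refl_between[OF npath_between[OF f w m]] by simp
next
  case (step k)
  note mk = npath_between[OF f w m]
  have A: "npath f \<omega> (m * k) \<in> paths_between (fibre_at P x) y ((f ^^ (m * k)) y)"
    using m step.hyps by (intro npath_between[OF f w]) simp
  have B: "(f ^^ (m * k)) \<circ> npath f \<omega> m \<in> paths_between (fibre_at P x) ((f ^^ (m * k)) y) ((f ^^ (m * k)) ((f ^^ m) y))"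
    by (rule map_over_paths_between[OF map_over_funpow[OF f] mk])
  have eq: "npath (f ^^ m) (npath f \<omega> m) (Suc k) =
      npath (f ^^ m) (npath f \<omega> m) k +++ ((f ^^ (m * k)) \<circ> npath f \<omega> m)"
    using step.hyps by (simp add: npath_Suc funpow_mult)
  have "homotopic_paths (fibre_at P x) (npath (f ^^ m) (npath f \<omega> m) k +++ ((f ^^ (m * k)) \<circ> npath f \<omega> m))
      (npath f \<omega> (m * k) +++ ((f ^^ (m * k)) \<circ> npath f \<omega> m))"
    by (rule homotopic_join_cong_left[OF step.IH A B])
  also have "homotopic_paths (fibre_at P x) \<dots> (npath f \<omega> (m * k + m))"
    using m step.hyps by (intro homotopic_paths_sym[OF npath_add[OF f w]]) simp_all
  also have "m * k + m = m * Suc k" by simp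
  finally show ?case unfolding eq .
qed

text \<open>
  An equality of functions, not only a homotopy; it makes the maps \<open>\<gamma>\<^bsub>m,n\<^esub>\<close> commute with \<open>f\<close>.
\<close>

lemma compose_npath:
  assumes "1 \<le> k"
  shows "f \<circ> npath (f ^^ m) \<alpha> k = npath (f ^^ m) (f \<circ> \<alpha>) k"
  using assms
proof (induction k rule: dec_induct)
  case (step k)
  have "f \<circ> ((f ^^ (m * k)) \<circ> \<alpha>) = (f ^^ (m * k)) \<circ> (f \<circ> \<alpha>)"
    by (simp add: fun_eq_iff funpow_swap1)
  then show ?case
    by (simp only: npath_Suc[OF step.hyps(1)] path_compose_join funpow_mult step.IH)
qed simp

lemma npath_cong:
  assumes "1 \<le> k" "\<And>s. s \<in> {0..1} \<Longrightarrow> p s = q s" "s \<in> {0..1}"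
  shows "npath f p k s = npath f q k s"
  using assms(1,3)
proof (induction k arbitrary: s rule: dec_induct)
  case base
  then show ?case using assms by simp
next
  case (step k)
  then show ?case
    using assms(2) by (auto simp: npath_Suc joinpaths_def)
qed

text \<open>
  The square for \<open>h ^^ k\<close> arises by placing \<open>k\<close> squares next to each other, the \<open>i\<close>-th one being the
  image of the given square under \<open>h ^^ i\<close>. They fit because the right edge of a twisted square is
  the image under \<open>h\<close> of its left edge.
\<close>

lemma same_component_npath:
  assumes h: "map_over P h" and ab: "same_component P h \<alpha> \<beta>" and "1 \<le> k"
  shows "same_component P (h ^^ k) (npath h \<alpha> k) (npath h \<beta> k)"
proof -
  from ab obtain K where K: "twisted_square P h K" "\<And>s. s \<in> {0..1} \<Longrightarrow> K (0, s) = \<alpha> s"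
    "\<And>s. s \<in> {0..1} \<Longrightarrow> K (1, s) = \<beta> s" by (rule same_componentE) blast
  define N where "N = (\<lambda>k t. npath h (\<lambda>s. K (t, s)) k)"
  have Kt: "(\<lambda>s. K (t, s)) \<in> paths_between (fibre_at P (K (t, 0))) (K (t, 0)) (h (K (t, 0)))"
    if "t \<in> {0..1}" for t
    by (rule twisted_squareD[OF K(1) that])
  have N: "N k t \<in> paths_between (fibre_at P (K (t, 0))) (K (t, 0)) ((h ^^ k) (K (t, 0)))"
    if "t \<in> {0..1}" "1 \<le> k" for t k
    unfolding N_def by (rule npath_between[OF h Kt[OF that(1)] that(2)])
  have Kc: "continuous_on ({0..1} \<times> {0..1}) K" "K ` ({0..1} \<times> {0..1}) \<subseteq> tot P"
    using K(1) by (auto simp: twisted_square_def fibre_def)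
  have "continuous_on ({0..1} \<times> {0..1}) (\<lambda>y. N k (fst y) (snd y))"
    using \<open>1 \<le> k\<close>
  proof (induction k rule: dec_induct)
    case base
    then show ?case using Kc by (simp add: N_def)
  next
    case (step k)
    have "continuous_on ({0..1} \<times> {0..1}) ((h ^^ k) \<circ> K)"
    proof (rule continuous_on_compose[OF Kc(1)])
      show "continuous_on (K ` ({0..1} \<times> {0..1})) (h ^^ k)"
        using map_over_funpow[OF h, of k] Kc(2) unfolding map_over_def by (metis continuous_on_subset)
    qed
    then have "continuous_on ({0..1} \<times> {0..1}) (\<lambda>y. ((h ^^ k) \<circ> (\<lambda>s. K (fst y, s))) (snd y))"
      by (simp add: o_def)
    then have "continuous_on ({0..1} \<times> {0..1})
        (\<lambda>y. (N k (fst y) +++ ((h ^^ k) \<circ> (\<lambda>s. K (fst y, s)))) (snd y))"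
    proof (rule continuous_on_homotopic_join_lemma[OF step.IH])
      fix t :: real assume "t \<in> {0..1}"
      then show "pathfinish (N k t) = pathstart ((h ^^ k) \<circ> (\<lambda>s. K (t, s)))"
        using N[of t k] step.hyps by (simp add: paths_between_def pathstart_def)
    qed
    then show ?case
      using step.hyps by (simp add: N_def npath_Suc)
  qed
  then have c: "continuous_on ({0..1} \<times> {0..1}) (\<lambda>(t, s). N k t s)"
    by (simp add: case_prod_beta)
  show ?thesis
  proof (rule same_componentI[where K = "\<lambda>(t, s). N k t s"])
    show "twisted_square P (h ^^ k) (\<lambda>(t, s). N k t s)"
      unfolding twisted_square_def
    proof (intro conjI ballI c)
      fix t :: real assume t: "t \<in> {0..1}"
      have NK: "N k t 0 = K (t, 0)" "N k t 1 = (h ^^ k) (K (t, 0))" "path_image (N k t) \<subseteq> fibre_at P (K (t, 0))"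
        using N[OF t \<open>1 \<le> k\<close>] by (auto simp: paths_between_def pathstart_def pathfinish_def)
      show "(case (t, 1) of (t, s) \<Rightarrow> N k t s) = (h ^^ k) (case (t, 0) of (t, s) \<Rightarrow> N k t s)"
        using NK by simp
      fix s :: real assume s: "s \<in> {0..1}"
      show "(case (t, s) of (t, s) \<Rightarrow> N k t s) \<in> fibre_at P (case (t, 0) of (t, s) \<Rightarrow> N k t s)"
        unfolding prod.case NK(1) using NK(3) s by (auto simp: path_image_def)
    qed
    fix s :: real assume s: "s \<in> {0..1}"
    show "(case (0, s) of (t, s) \<Rightarrow> N k t s) = npath h \<alpha> k s"
      unfolding prod.case N_def by (rule npath_cong[OF \<open>1 \<le> k\<close> K(2) s])
    show "(case (1, s) of (t, s) \<Rightarrow> N k t s) = npath h \<beta> k s"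
      unfolding prod.case N_def by (rule npath_cong[OF \<open>1 \<le> k\<close> K(3) s])
  qed
qed

text \<open>
  Conjugation by \<open>\<alpha>\<close> itself: sliding the base point of \<open>h \<circ> \<alpha>\<close> back along \<open>\<alpha>\<close> gives
  \<open>\<alpha> * h(\<alpha>) * h(\<alpha>)\<^bsup>-1\<^esup>\<close>, which is homotopic to \<open>\<alpha>\<close>.
\<close>

lemma same_component_map_self:
  assumes h: "map_over P h" and a: "\<alpha> \<in> paths_between (fibre_at P x) x (h x)"
  shows "same_component P h (h \<circ> \<alpha>) \<alpha>"
proof -
  have ha: "h \<circ> \<alpha> \<in> paths_between (fibre_at P x) (h x) (h (h x))"
    by (rule map_over_paths_between[OF h a])
  have "homotopic_paths (fibre_at P x) ((\<alpha> +++ (h \<circ> \<alpha>)) +++ reversepath (h \<circ> \<alpha>)) \<alpha>"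
    using homotopic_join_reverse_cancel[OF paths_between_reverse[OF ha] a] by simp
  then have "same_component P h \<alpha> ((\<alpha> +++ (h \<circ> \<alpha>)) +++ reversepath (h \<circ> \<alpha>))"
    using a by (intro same_component_homotopic[of P x]) (simp_all add: homotopic_paths_sym)
  also have "same_component P h \<dots> (h \<circ> \<alpha>)"
    by (rule same_component_conjugate[OF h a ha])
  finally show ?thesis by (rule same_component_sym)
qed

section \<open>Fixed points and the homotopy lifting property\<close>

text \<open>
  Let \<open>l\<close> be a path from \<open>x\<close> to \<open>x0\<close>. The twisted square sought lies over the map \<open>(t, s) \<mapsto> p(l t)\<close> and is
  prescribed on three sides: \<open>l\<close> and \<open>h \<circ> l\<close> on \<open>s = 0\<close> and \<open>s = 1\<close>, and the constant \<open>x\<close> on \<open>t = 0\<close>. These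
  sides together form one path \<open>l\<^bsup>-1\<^esup> * h(l)\<close> with parameter \<open>u\<close>, so the lifting property for an
  interval applies to the homotopy \<open>(u, r) \<mapsto> p(l(min 1 (\<bar>2 u - 1\<bar> + r)))\<close> with this path as
  initial lift. The substitution \<open>2 u - 1 = t (2 s - 1)\<close>, \<open>r = t (1 - \<bar>2 s - 1\<bar>)\<close> bends the square back:
  it has \<open>\<bar>2 u - 1\<bar> + r = t\<close>, and \<open>r\<close> vanishes exactly on the three sides.
\<close>

lemma fixed_point_joined_to_base_fibre:
  fixes P :: "('a::topological_space, 'b::topological_space) fibred"
  assumes P: "fibration P" and pc: "path_connected (tot P)" and h: "map_over P h"
    and x: "x \<in> Fix P h" and x0: "x0 \<in> tot P"
  shows "\<exists>\<beta>\<in>paths_between (fibre_at P x0) x0 (h x0). same_component P h \<beta> (\<lambda>_. x)"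
proof -
  have xt: "x \<in> tot P" "h x = x"
    using x by (auto simp: Fix_def)
  obtain l where l: "path l" "path_image l \<subseteq> tot P" "l 0 = x" "l 1 = x0"
    using pc xt x0 unfolding path_connected_def pathstart_def pathfinish_def by blast
  have lt: "l t \<in> tot P" if "t \<in> {0..1}" for t
    using l that by (auto simp: path_image_def)
  have ht: "h y \<in> tot P" "prj P (h y) = prj P y" if "y \<in> tot P" for y
    using h that by (auto simp: map_over_def)
  \<comment> \<open>The interval is placed in the type of the test spaces by a constant second component \<open>b\<close>.\<close>
  define b where "b = (x0, \<lambda>_::real. prj P x0)"
  define X where "X = top_of_set ({0..1::real} \<times> {b})"
  define g where "g = (\<lambda>u::real \<times> 'a \<times> (real \<Rightarrow> 'b). (reversepath l +++ (h \<circ> l)) (fst u)) "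
  define tau where "tau = (\<lambda>(u::real) r. min 1 (\<bar>2 * u - 1\<bar> + r))"
  define G where "G = (\<lambda>(v::(real \<times> 'a \<times> (real \<Rightarrow> 'b)) \<times> real). prj P (l (tau (fst (fst v)) (snd v))))"
  have taur: "tau u r \<in> {0..1}" if "r \<in> {0..1}" for u r
    using that by (auto simp: tau_def)
  have XI: "prod_topology X (top_of_set {0..1::real}) = top_of_set (({0..1} \<times> {b}) \<times> {0..1})"
    by (simp add: X_def)
  have prjc: "continuous_on (tot P) (prj P)" "prj P ` tot P \<subseteq> bas P"
    using P by (auto simp: fibration_def)
  have cG: "continuous_map (prod_topology X (top_of_set {0..1::real})) (top_of_set (bas P)) G"
  proof -
    have "continuous_on (({0..1} \<times> {b}) \<times> {0..1}) (\<lambda>v. l (tau (fst (fst v)) (snd v)))"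
    proof (rule continuous_on_compose2[of "{0..1}" l _ "\<lambda>v. tau (fst (fst v)) (snd v)"])
      show "continuous_on {0..1} l" using l by (simp add: path_def)
      show "continuous_on (({0..1} \<times> {b}) \<times> {0..1}) (\<lambda>v. tau (fst (fst v)) (snd v))"
        unfolding tau_def by (intro continuous_intros)
    qed (auto intro!: taur)
    then have "continuous_on (({0..1} \<times> {b}) \<times> {0..1}) G"
      unfolding G_def
      by (rule continuous_on_compose2[OF prjc(1)]) (use lt taur in auto)
    then show ?thesis
      unfolding XI using prjc(2) lt taur by (auto simp: G_def)
  qed
  have cg: "continuous_map X (top_of_set (tot P)) g"
  proof -
    have pg: "path (reversepath l +++ (h \<circ> l))"
    proof (rule path_join_imp)
      show "pathfinish (reversepath l) = pathstart (h \<circ> l)"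
        using l xt by (simp add: pathstart_def pathfinish_def reversepath_def)
      show "path (h \<circ> l)"
        using l h by (intro path_continuous_image) (auto simp: map_over_def intro: continuous_on_subset)
    qed (use l in simp)
    have "continuous_on ({0..1} \<times> {b}) g"
      unfolding g_def
      by (rule continuous_on_compose2[OF pg[unfolded path_def]]) (auto intro!: continuous_intros)
    moreover have "path_image (reversepath l +++ (h \<circ> l)) \<subseteq> tot P"
    proof (rule subset_path_image_join)
      show "path_image (h \<circ> l) \<subseteq> tot P"
        using l ht by (auto simp: path_image_def)
    qed (use l in simp)
    ultimately show ?thesis
      by (auto simp: X_def g_def path_image_def)
  qed
  have g0: "prj P (g u) = G (u, 0)" if u: "u \<in> topspace X" for u
  proof (cases "fst u \<le> 1 / 2")
    case True
    have "tau (fst u) 0 = 1 - 2 * fst u"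
      using True u by (auto simp: tau_def X_def)
    then show ?thesis
      using True by (simp add: G_def g_def joinpaths_def reversepath_def)
  next
    case False
    have "tau (fst u) 0 = 2 * fst u - 1"
      using False u by (auto simp: tau_def X_def)
    then show ?thesis
      using False u ht[OF lt, of "2 * fst u - 1"] by (auto simp: G_def g_def joinpaths_def X_def)
  qed
  obtain G' where G': "continuous_map (prod_topology X (top_of_set {0..1::real})) (top_of_set (tot P)) G'"
    "\<And>u. u \<in> topspace X \<Longrightarrow> G' (u, 0) = g u"
    "\<And>u r. u \<in> topspace X \<Longrightarrow> r \<in> {0..1} \<Longrightarrow> prj P (G' (u, r)) = G (u, r)"
  proof -
    note lift = P[unfolded fibration_def, THEN conjunct2, THEN conjunct2, THEN spec[of _ X],
      THEN spec[of _ G], THEN spec[of _ g], THEN mp]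
    show ?thesis
      using lift cG cg g0 that by blast
  qed
  define K where "K = (\<lambda>(t, s). G' (((t * (2 * s - 1) + 1) / 2, b), t * (1 - \<bar>2 * s - 1\<bar>)))"
  have rng: "(t * (2 * s - 1) + 1) / 2 \<in> {0..1}" "t * (1 - \<bar>2 * s - 1\<bar>) \<in> {0..1}"
    if "t \<in> {0..1}" "s \<in> {0..1}" for t s :: real
  proof -
    have "\<bar>t * (2 * s - 1)\<bar> \<le> 1"
      unfolding abs_mult using that by (intro mult_le_one) auto
    then show "(t * (2 * s - 1) + 1) / 2 \<in> {0..1}" by auto
    show "t * (1 - \<bar>2 * s - 1\<bar>) \<in> {0..1}"
      using that by (auto intro!: mult_nonneg_nonneg mult_le_one)
  qed
  have G'c: "continuous_on (({0..1} \<times> {b}) \<times> {0..1}) G'" "\<And>u r. u \<in> {0..1} \<Longrightarrow> r \<in> {0..1} \<Longrightarrow> G' ((u, b), r) \<in> tot P"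
    using G'(1) unfolding XI by auto
  have Kc: "continuous_on ({0..1} \<times> {0..1}) K"
    unfolding K_def case_prod_beta
  proof (rule continuous_on_compose2[OF G'c(1)])
    show "continuous_on ({0..1} \<times> {0..1})
        (\<lambda>y::real \<times> real. (((fst y * (2 * snd y - 1) + 1) / 2, b), fst y * (1 - \<bar>2 * snd y - 1\<bar>)))"
      by (intro continuous_intros) auto
  qed (use rng in auto)
  have K0: "K (t, 0) = l t" and K1: "K (t, 1) = h (l t)" if t: "t \<in> {0..1}" for t
  proof -
    have "K (t, 0) = g ((1 - t) / 2, b)" "K (t, 1) = g ((1 + t) / 2, b)"
      using t G'(2) by (auto simp: K_def X_def algebra_simps)
    moreover have "l (1 - (2 - 2 * t) / 2) = l t"
      by (rule arg_cong[of _ _ l]) (simp add: field_simps)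
    then have "g ((1 - t) / 2, b) = l t"
      using t by (auto simp: g_def joinpaths_def reversepath_def)
    moreover have "l ((2 + 2 * t) / 2 - 1) = l t"
      by (rule arg_cong[of _ _ l]) (simp add: field_simps)
    then have "g ((1 + t) / 2, b) = h (l t)"
      using t l xt by (cases "t = 0") (auto simp: g_def joinpaths_def reversepath_def)
    ultimately show "K (t, 0) = l t" "K (t, 1) = h (l t)" by simp_all
  qed
  have K0s: "K (0, s) = x" for s
    using G'(2)[of "(1 / 2, b)"] l by (simp add: K_def X_def g_def joinpaths_def reversepath_def)
  have Kl: "prj P (K (t, s)) = prj P (l t)" if t: "t \<in> {0..1}" and s: "s \<in> {0..1}" for t s
  proof -
    have u: "2 * ((t * (2 * s - 1) + 1) / 2) - 1 = t * (2 * s - 1)"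
      by (simp add: field_simps)
    have "\<bar>t * (2 * s - 1)\<bar> = t * \<bar>2 * s - 1\<bar>"
      using t by (simp add: abs_mult)
    then have "\<bar>t * (2 * s - 1)\<bar> + t * (1 - \<bar>2 * s - 1\<bar>) = t"
      by (simp only: right_diff_distrib)
    then have "tau ((t * (2 * s - 1) + 1) / 2) (t * (1 - \<bar>2 * s - 1\<bar>)) = t"
      unfolding tau_def u using t by simp
    moreover have "prj P (K (t, s)) = G (((t * (2 * s - 1) + 1) / 2, b), t * (1 - \<bar>2 * s - 1\<bar>))"
      using G'(3)[OF _ rng(2)[OF t s]] rng(1)[OF t s] by (simp add: K_def X_def)
    ultimately show ?thesis
      by (simp add: G_def)
  qed
  have "twisted_square P h K"
    unfolding twisted_square_def
  proof (intro conjI ballI Kc)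
    fix t :: real assume t: "t \<in> {0..1}"
    show "K (t, 1) = h (K (t, 0))"
      using K0[OF t] K1[OF t] by simp
    fix s :: real assume s: "s \<in> {0..1}"
    have "K (t, s) \<in> tot P"
      unfolding K_def prod.case by (rule G'c(2)[OF rng[OF t s]])
    then show "K (t, s) \<in> fibre_at P (K (t, 0))"
      using Kl[OF t s] K0[OF t] by (simp add: fibre_def)
  qed
  note sq = this
  have "same_component P h (\<lambda>_. x) (\<lambda>s. K (1, s))"
    by (rule same_componentI[OF sq]) (simp_all add: K0s)
  moreover have "(\<lambda>s. K (1, s)) \<in> paths_between (fibre_at P x0) x0 (h x0)"
    using twisted_squareD[OF sq, of 1] K0[of 1] l by simp
  ultimately show ?thesis
    using same_component_sym by blast
qed

section \<open>Reidemeister classes as path components\<close>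

lemma pcls_self: "\<theta> \<in> loops S x \<Longrightarrow> \<theta> \<in> pcls S x \<theta>"
  by (simp add: pcls_def loops_def)

lemma pcls_eq:
  assumes "homotopic_paths S \<theta> \<theta>'"
  shows "pcls S x \<theta> = pcls S x \<theta>'"
  unfolding pcls_def using assms by (meson homotopic_paths_sym homotopic_paths_trans)

text \<open>
  The lift that defines the Reidemeister action is a twisted square.
\<close>

lemma same_component_reid_lift:
  assumes "reid_lift P h \<eta> c \<theta> H"
  shows "same_component P h (\<theta> +++ \<eta>) (\<lambda>s. H (1, s))"
    and "(\<lambda>s. H (1, s)) \<in> paths_between (fibre_at P (c 1)) (c 1) (h (c 1))"
proof -
  have H: "continuous_on ({0..1} \<times> {0..1}) H"
    "\<And>t s. t \<in> {0..1} \<Longrightarrow> s \<in> {0..1} \<Longrightarrow> H (t, s) \<in> fibre P (prj P (c t))"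
    "\<And>t. t \<in> {0..1} \<Longrightarrow> H (t, 0) = c t" "\<And>t. t \<in> {0..1} \<Longrightarrow> H (t, 1) = h (c t)"
    "\<And>s. s \<in> {0..1} \<Longrightarrow> H (0, s) = (\<theta> +++ \<eta>) s"
    using assms unfolding reid_lift_def by blast+
  have sq: "twisted_square P h H"
    unfolding twisted_square_def
  proof (intro conjI ballI H(1))
    fix t s :: real assume t: "t \<in> {0..1}" and s: "s \<in> {0..1}"
    show "H (t, s) \<in> fibre_at P (H (t, 0))"
      using H(2)[OF t s] H(3)[OF t] by simp
  next
    fix t :: real assume t: "t \<in> {0..1}"
    show "H (t, 1) = h (H (t, 0))"
      using H(3,4)[OF t] by simp
  qed
  show "same_component P h (\<theta> +++ \<eta>) (\<lambda>s. H (1, s))"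
    by (rule same_componentI[OF sq H(5)]) simp_all
  show "(\<lambda>s. H (1, s)) \<in> paths_between (fibre_at P (c 1)) (c 1) (h (c 1))"
    using twisted_squareD[OF sq, of 1] H(3)[of 1] by simp
qed

text \<open>
  The action of a loop \<open>c\<close> transports the twisted path \<open>\<theta> * \<eta>\<close> along \<open>c\<close>. Conversely the edge \<open>s = 0\<close> of any
  twisted square joining two twisted paths at \<open>x0\<close> is such a loop. Multiplication by \<open>\<eta>\<close> and \<open>\<eta>\<^bsup>-1\<^esup>\<close>
  passes between loops and twisted paths.
\<close>

lemma reid_rel_iff:
  fixes x0 :: "'a::topological_space"
  assumes \<eta>: "\<eta> \<in> paths_between (fibre_at P x0) x0 (h x0)"
    and \<theta>: "\<theta> \<in> loops (fibre_at P x0) x0" and \<theta>': "\<theta>' \<in> loops (fibre_at P x0) x0"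
  shows "(pcls (fibre_at P x0) x0 \<theta>, pcls (fibre_at P x0) x0 \<theta>') \<in> reid_rel P h x0 \<eta> \<longleftrightarrow>
    same_component P h (\<theta> +++ \<eta>) (\<theta>' +++ \<eta>)"
proof -
  define Y where "Y = fibre_at P x0"
  note [folded Y_def] = \<eta> \<theta> \<theta>'
  have \<theta>s: "\<theta> \<in> paths_between Y x0 x0" "\<theta>' \<in> paths_between Y x0 x0"
    using \<theta> \<theta>' by (simp_all add: Y_def loops_eq_paths_between)
  have \<eta>Y: "\<eta> \<in> paths_between Y x0 (h x0)"
    using \<eta> by (simp add: Y_def)
  note rev = paths_between_reverse[OF \<eta>Y]
  have hom: "same_component P h p q" if "homotopic_paths Y p q" "p \<in> paths_between Y x0 (h x0)" for p q
    using same_component_homotopic[of P x0] that by (simp add: Y_def)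
  have "(pcls Y x0 \<theta>, pcls Y x0 \<theta>') \<in> reid_rel P h x0 \<eta> \<longleftrightarrow>
    (\<exists>c\<in>loops (tot P) x0. \<exists>\<theta>1\<in>pcls Y x0 \<theta>. \<exists>H. reid_lift P h \<eta> c \<theta>1 H \<and>
        pcls Y x0 \<theta>' = pcls Y x0 ((\<lambda>s. H (1, s)) +++ reversepath \<eta>))" (is "_ \<longleftrightarrow> ?R")
    using \<theta> \<theta>' by (auto simp: reid_rel_def pi1_def Y_def)
  also have "?R \<longleftrightarrow> same_component P h (\<theta> +++ \<eta>) (\<theta>' +++ \<eta>)"
  proof
    assume ?R
    then obtain c \<theta>1 H where c: "c \<in> loops (tot P) x0" and \<theta>1: "\<theta>1 \<in> pcls Y x0 \<theta>"
      and lift: "reid_lift P h \<eta> c \<theta>1 H"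
      and eq: "pcls Y x0 \<theta>' = pcls Y x0 ((\<lambda>s. H (1, s)) +++ reversepath \<eta>)"
      by blast
    define H1 where "H1 = (\<lambda>s. H (1, s))"
    have "c 1 = x0"
      using c by (simp add: loops_def pathfinish_def)
    then have H1: "H1 \<in> paths_between Y x0 (h x0)"
      using same_component_reid_lift(2)[OF lift] by (simp add: H1_def Y_def)
    have "homotopic_paths Y \<theta> \<theta>1"
      using \<theta>1 by (simp add: pcls_def)
    then have "same_component P h (\<theta> +++ \<eta>) (\<theta>1 +++ \<eta>)"
      using homotopic_paths_between[of Y \<theta> \<theta>1 x0 x0] \<theta>s \<eta>Y
      by (intro hom homotopic_join_cong_left paths_between_join) auto
    also have "same_component P h \<dots> H1"
      using same_component_reid_lift(1)[OF lift] by (simp add: H1_def)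
    also have "same_component P h H1 ((H1 +++ reversepath \<eta>) +++ \<eta>)"
      by (rule hom[OF homotopic_paths_sym[OF homotopic_join_reverse_cancel[OF \<eta>Y H1]] H1])
    also have "same_component P h \<dots> (\<theta>' +++ \<eta>)"
    proof (rule hom)
      have "\<theta>' \<in> pcls Y x0 (H1 +++ reversepath \<eta>)"
        using pcls_self[OF \<theta>'] eq by (simp add: Y_def H1_def)
      then show "homotopic_paths Y ((H1 +++ reversepath \<eta>) +++ \<eta>) (\<theta>' +++ \<eta>)"
        using \<theta>s \<eta>Y by (intro homotopic_join_cong_left) (auto simp: pcls_def)
      show "(H1 +++ reversepath \<eta>) +++ \<eta> \<in> paths_between Y x0 (h x0)"
        by (intro paths_between_join[OF paths_between_join[OF H1 rev] \<eta>Y])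
    qed
    finally show "same_component P h (\<theta> +++ \<eta>) (\<theta>' +++ \<eta>)" .
  next
    assume "same_component P h (\<theta> +++ \<eta>) (\<theta>' +++ \<eta>)"
    then obtain K where K: "twisted_square P h K" "\<And>s. s \<in> {0..1} \<Longrightarrow> K (0, s) = (\<theta> +++ \<eta>) s"
      "\<And>s. s \<in> {0..1} \<Longrightarrow> K (1, s) = (\<theta>' +++ \<eta>) s" by (rule same_componentE) blast
    have K00: "K (0, 0) = x0" "K (1, 0) = x0"
      using K(2)[of 0] K(3)[of 0] \<theta>s by (simp_all add: joinpaths_def paths_between_def pathstart_def)
    have Kc: "continuous_on ({0..1} \<times> {0..1}) K" "\<And>t s. t \<in> {0..1} \<Longrightarrow> s \<in> {0..1} \<Longrightarrow> K (t, s) \<in> tot P"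
      using K(1) by (auto simp: twisted_square_def fibre_def)
    have "continuous_on {0..1} (\<lambda>t. K (t, 0))"
      by (rule continuous_on_compose2[OF Kc(1)]) (auto intro!: continuous_intros)
    then have c: "(\<lambda>t. K (t, 0)) \<in> loops (tot P) x0"
      using K00 Kc(2) by (auto simp: loops_def path_def path_image_def pathstart_def pathfinish_def)
    have lift: "reid_lift P h \<eta> (\<lambda>t. K (t, 0)) \<theta> K"
      using K unfolding reid_lift_def twisted_square_def by blast
    define K1 where "K1 = (\<lambda>s. K (1, s))"
    have K1: "K1 \<in> paths_between Y x0 (h x0)"
      using twisted_squareD[OF K(1), of 1] K00 by (simp add: K1_def Y_def)
    have "homotopic_paths Y K1 (\<theta>' +++ \<eta>)"
      using K1 K(3) by (intro homotopic_paths_eq) (auto simp: K1_def paths_between_def)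
    then have "homotopic_paths Y (K1 +++ reversepath \<eta>) ((\<theta>' +++ \<eta>) +++ reversepath \<eta>)"
      by (rule homotopic_join_cong_left[OF _ paths_between_join[OF \<theta>s(2) \<eta>Y] rev])
    also have "homotopic_paths Y \<dots> \<theta>'"
      using homotopic_join_reverse_cancel[OF rev \<theta>s(2)] by simp
    finally have "pcls Y x0 \<theta>' = pcls Y x0 (K1 +++ reversepath \<eta>)"
      by (rule pcls_eq[OF homotopic_paths_sym])
    then show ?R
      using lift pcls_self[OF \<theta>]
      by (intro bexI[OF _ c] bexI[of _ \<theta>] exI[of _ K] conjI) (simp_all add: K1_def Y_def)
  qed
  finally show ?thesis by (simp add: Y_def)
qed

lemma Union_rcls:
  assumes \<eta>: "\<eta> \<in> paths_between (fibre_at P x0) x0 (h x0)"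
    and \<theta>: "\<theta> \<in> loops (fibre_at P x0) x0"
  shows "\<Union> (rcls P h x0 \<eta> \<theta>) = {\<theta>' \<in> loops (fibre_at P x0) x0. same_component P h (\<theta> +++ \<eta>) (\<theta>' +++ \<eta>)}"
proof -
  let ?Y = "fibre_at P x0"
  have "rcls P h x0 \<eta> \<theta> = pcls ?Y x0 ` {\<theta>' \<in> loops ?Y x0. same_component P h (\<theta> +++ \<eta>) (\<theta>' +++ \<eta>)}" (is "_ = _ ` ?L")
  proof (intro equalityI subsetI)
    fix b assume b: "b \<in> rcls P h x0 \<eta> \<theta>"
    then have "b \<in> pi1 ?Y x0"
      by (auto simp: rcls_def reid_rel_def)
    then obtain \<theta>' where "\<theta>' \<in> loops ?Y x0" "b = pcls ?Y x0 \<theta>'"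
      by (auto simp: pi1_def)
    then show "b \<in> pcls ?Y x0 ` ?L"
      using b reid_rel_iff[where h = h, OF assms] by (auto simp: rcls_def)
  next
    fix b assume "b \<in> pcls ?Y x0 ` ?L"
    then show "b \<in> rcls P h x0 \<eta> \<theta>"
      using reid_rel_iff[where h = h, OF assms] by (auto simp: rcls_def)
  qed
  moreover have "\<Union> (pcls ?Y x0 ` ?L) = ?L"
  proof (intro equalityI subsetI)
    fix \<theta>1 assume "\<theta>1 \<in> \<Union> (pcls ?Y x0 ` ?L)"
    then obtain \<theta>' where \<theta>': "\<theta>' \<in> loops ?Y x0" "same_component P h (\<theta> +++ \<eta>) (\<theta>' +++ \<eta>)"
      "\<theta>1 \<in> loops ?Y x0" "homotopic_paths ?Y \<theta>' \<theta>1"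
      by (auto simp: pcls_def)
    have "same_component P h (\<theta>' +++ \<eta>) (\<theta>1 +++ \<eta>)"
      using \<theta>' \<eta> unfolding loops_eq_paths_between
      by (intro same_component_homotopic[of P x0] homotopic_join_cong_left paths_between_join)
    then show "\<theta>1 \<in> ?L"
      using \<theta>' same_component_trans by blast
  next
    fix \<theta>1 assume "\<theta>1 \<in> ?L"
    then show "\<theta>1 \<in> \<Union> (pcls ?Y x0 ` ?L)"
      using pcls_self[of \<theta>1 ?Y x0] by blast
  qed
  ultimately show ?thesis by simp
qed

text \<open>
  In particular being related is an equivalence relation, as lying in one path component is.
\<close>

lemma rcls_eq_iff:
  assumes \<eta>: "\<eta> \<in> paths_between (fibre_at P x0) x0 (h x0)"
    and \<theta>: "\<theta> \<in> loops (fibre_at P x0) x0" and \<theta>': "\<theta>' \<in> loops (fibre_at P x0) x0"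
  shows "rcls P h x0 \<eta> \<theta> = rcls P h x0 \<eta> \<theta>' \<longleftrightarrow> same_component P h (\<theta> +++ \<eta>) (\<theta>' +++ \<eta>)"
proof
  have "same_component P h (\<theta>' +++ \<eta>) (\<theta>' +++ \<eta>)"
    using \<theta>' \<eta> unfolding loops_eq_paths_between by (intro same_component_refl[of _ P x0] paths_between_join)
  then have "\<theta>' \<in> \<Union> (rcls P h x0 \<eta> \<theta>')"
    using Union_rcls[where h = h, OF \<eta> \<theta>'] \<theta>' by simp
  moreover assume "rcls P h x0 \<eta> \<theta> = rcls P h x0 \<eta> \<theta>'"
  ultimately have "\<theta>' \<in> \<Union> (rcls P h x0 \<eta> \<theta>)"
    by (simp only:)
  then show "same_component P h (\<theta> +++ \<eta>) (\<theta>' +++ \<eta>)"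
    unfolding Union_rcls[where h = h, OF \<eta> \<theta>] by simp
next
  assume *: "same_component P h (\<theta> +++ \<eta>) (\<theta>' +++ \<eta>)"
  have iff: "same_component P h (\<theta> +++ \<eta>) q \<longleftrightarrow> same_component P h (\<theta>' +++ \<eta>) q" for q
    using * same_component_trans same_component_sym by blast
  have "b \<in> rcls P h x0 \<eta> \<theta> \<longleftrightarrow> b \<in> rcls P h x0 \<eta> \<theta>'" for b
  proof (cases "b \<in> pi1 (fibre_at P x0) x0")
    case True
    then obtain \<theta>1 where \<theta>1: "\<theta>1 \<in> loops (fibre_at P x0) x0" "b = pcls (fibre_at P x0) x0 \<theta>1"
      by (auto simp: pi1_def)
    show ?thesis
      unfolding rcls_def \<theta>1(2) Image_singleton_iff
      by (simp add: reid_rel_iff[where h = h, OF \<eta> _ \<theta>1(1)] \<theta> \<theta>' iff)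
  qed (auto simp: rcls_def reid_rel_def)
  then show "rcls P h x0 \<eta> \<theta> = rcls P h x0 \<eta> \<theta>'" by blast
qed

lemma reid_classes_eq: "reid_classes P h x0 \<eta> = rcls P h x0 \<eta> ` loops (fibre_at P x0) x0"
  by (auto simp: reid_classes_def quotient_def rcls_def pi1_def)

section \<open>Nielsen classes inside the Reidemeister classes\<close>

lemma nielsen_rel_iff:
  "(x, y) \<in> nielsen_rel P h \<longleftrightarrow> x \<in> Fix P h \<and> y \<in> Fix P h \<and> same_component P h (\<lambda>_. x) (\<lambda>_. y)"
proof (intro iffI conjI)
  assume "(x, y) \<in> nielsen_rel P h"
  then obtain l and H :: "real \<times> real \<Rightarrow> 'a" where xy: "x \<in> Fix P h" "y \<in> Fix P h"
    and H: "continuous_on ({0..1} \<times> {0..1}) H"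
      "\<forall>t\<in>{0..1}. H (t, 0) = l t \<and> H (t, 1) = h (l t)"
      "\<forall>s\<in>{0..1}. H (0, s) = x \<and> H (1, s) = y"
      "\<forall>t\<in>{0..1}. \<forall>s\<in>{0..1}. H (t, s) \<in> fibre P (prj P (l t))"
    unfolding nielsen_rel_def by blast
  show "x \<in> Fix P h" "y \<in> Fix P h" by fact+
  have "twisted_square P h H"
    unfolding twisted_square_def
  proof (intro conjI ballI H(1))
    fix t s :: real assume t: "t \<in> {0..1}" and s: "s \<in> {0..1}"
    show "H (t, s) \<in> fibre_at P (H (t, 0))"
      using H(2,4) t s by simp
  next
    fix t :: real assume t: "t \<in> {0..1}"
    show "H (t, 1) = h (H (t, 0))"
      using H(2) t by simp
  qed
  then show "same_component P h (\<lambda>_. x) (\<lambda>_. y)"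
    by (rule same_componentI) (use H(3) in auto)
next
  assume *: "x \<in> Fix P h \<and> y \<in> Fix P h \<and> same_component P h (\<lambda>_. x) (\<lambda>_. y)"
  then obtain K where K: "twisted_square P h K" "\<And>s. s \<in> {0..1} \<Longrightarrow> K (0, s) = x"
      "\<And>s. s \<in> {0..1} \<Longrightarrow> K (1, s) = y"
    by (auto elim: same_componentE)
  have Kc: "continuous_on ({0..1} \<times> {0..1}) K" "\<And>t s. t \<in> {0..1} \<Longrightarrow> s \<in> {0..1} \<Longrightarrow> K (t, s) \<in> tot P"
    using K(1) by (auto simp: twisted_square_def fibre_def)
  define l where "l = (\<lambda>t. K (t, 0))"
  have "continuous_on {0..1} l"
    unfolding l_def by (rule continuous_on_compose2[OF Kc(1)]) (auto intro!: continuous_intros)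
  then have "path l" "path_image l \<subseteq> tot P" "pathstart l = x" "pathfinish l = y"
    using K(2,3)[of 0] Kc(2) by (auto simp: l_def path_def path_image_def pathstart_def pathfinish_def)
  moreover have "\<forall>t\<in>{0..1}. K (t, 0) = l t \<and> K (t, 1) = h (l t)"
    "\<forall>t\<in>{0..1}. \<forall>s\<in>{0..1}. K (t, s) \<in> fibre P (prj P (l t))"
    using K(1) unfolding twisted_square_def l_def by blast+
  moreover have "\<forall>s\<in>{0..1}. K (0, s) = x \<and> K (1, s) = y"
    using K by blast
  ultimately show "(x, y) \<in> nielsen_rel P h"
    unfolding nielsen_rel_def using * Kc(1) by blast
qed

text \<open>
  The hypotheses under which the injection of Nielsen classes into Reidemeister classes exists: lifting
  along a path to \<open>x0\<close> assigns a Reidemeister class to every fixed point.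
\<close>

locale reidemeister_setting =
  fixes P :: "('a::topological_space, 'b::topological_space) fibred" and h :: "'a \<Rightarrow> 'a" and x0 :: 'a
    and \<eta> :: "real \<Rightarrow> 'a"
  assumes fib: "fibration P" and conn: "path_connected (tot P)" and map_over: "map_over P h"
    and x0_tot: "x0 \<in> tot P" and \<eta>: "\<eta> \<in> paths_between (fibre_at P x0) x0 (h x0)"
begin

abbreviation nclass where "nclass x \<equiv> nielsen_rel P h `` {x}"

lemma const_refl: "x \<in> Fix P h \<Longrightarrow> same_component P h (\<lambda>_. x) (\<lambda>_. x)"
  by (rule same_component_refl[of _ P x])
    (auto simp: Fix_def paths_between_def path_def path_image_def pathstart_def pathfinish_def fibre_def)

lemma mem_nclass: "x \<in> Fix P h \<Longrightarrow> y \<in> nclass x \<longleftrightarrow> y \<in> Fix P h \<and> same_component P h (\<lambda>_. x) (\<lambda>_. y)"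
  by (simp add: nielsen_rel_iff)

lemma nielsen_classes_eq: "nielsen_classes P h = nclass ` Fix P h"
  by (auto simp: nielsen_classes_def quotient_def)

lemma fixed_point_loop:
  assumes "x \<in> Fix P h"
  obtains \<theta> where "\<theta> \<in> loops (fibre_at P x0) x0" "same_component P h (\<theta> +++ \<eta>) (\<lambda>_. x)"
proof -
  obtain \<beta> where \<beta>: "\<beta> \<in> paths_between (fibre_at P x0) x0 (h x0)" "same_component P h \<beta> (\<lambda>_. x)"
    using fixed_point_joined_to_base_fibre[OF fib conn map_over assms x0_tot] by blast
  have "homotopic_paths (fibre_at P x0) \<beta> ((\<beta> +++ reversepath \<eta>) +++ \<eta>)"
    by (rule homotopic_paths_sym[OF homotopic_join_reverse_cancel[OF \<eta> \<beta>(1)]])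
  then have "same_component P h \<beta> ((\<beta> +++ reversepath \<eta>) +++ \<eta>)"
    using \<beta>(1) by (rule same_component_homotopic)
  then have "same_component P h ((\<beta> +++ reversepath \<eta>) +++ \<eta>) (\<lambda>_. x)"
    using \<beta>(2) same_component_sym same_component_trans by blast
  moreover have "\<beta> +++ reversepath \<eta> \<in> loops (fibre_at P x0) x0"
    unfolding loops_eq_paths_between by (rule paths_between_join[OF \<beta>(1) paths_between_reverse[OF \<eta>]])
  ultimately show ?thesis using that by blast
qed

lemma path_component_twist:
  assumes "\<theta> \<in> loops (fibre_at P x0) x0"
  shows "path_component_of (EB P h) (x0, to_path (\<theta> +++ \<eta>)) (x, to_path (\<lambda>_. x)) \<longleftrightarrow>
    same_component P h (\<theta> +++ \<eta>) (\<lambda>_. x)"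
proof -
  have "(\<theta> +++ \<eta>) 0 = x0"
    using assms by (simp add: loops_def joinpaths_def pathstart_def)
  then show ?thesis by (simp add: same_component_def)
qed

text \<open>
  The loop \<open>\<theta>\<close> with \<open>\<theta> * \<eta>\<close> in the component of the constant path at \<open>x\<close> determines the value: another
  loop with this property belongs to the same Reidemeister class.
\<close>

lemma nielsen_to_reid_nclass:
  assumes x: "x \<in> Fix P h" and \<theta>: "\<theta> \<in> loops (fibre_at P x0) x0"
    and x\<theta>: "same_component P h (\<theta> +++ \<eta>) (\<lambda>_. x)"
  shows "nielsen_to_reid P h x0 \<eta> (nclass x) = rcls P h x0 \<eta> \<theta>"
  unfolding nielsen_to_reid_def
proof (rule the_equality)
  have "same_component P h (\<theta> +++ \<eta>) (\<theta> +++ \<eta>)"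
    using x\<theta> same_component_sym same_component_trans by blast
  then have "\<theta> \<in> \<Union> (rcls P h x0 \<eta> \<theta>)"
    unfolding Union_rcls[where h = h, OF \<eta> \<theta>] using \<theta> by simp
  moreover have "x \<in> nclass x"
    using mem_nclass[OF x] const_refl[OF x] x by blast
  moreover have "rcls P h x0 \<eta> \<theta> \<in> reid_classes P h x0 \<eta>"
    using \<theta> by (simp add: reid_classes_eq)
  ultimately show "rcls P h x0 \<eta> \<theta> \<in> reid_classes P h x0 \<eta> \<and> (\<exists>y\<in>nclass x. \<exists>\<theta>'\<in>\<Union> (rcls P h x0 \<eta> \<theta>).
      path_component_of (EB P h) (x0, to_path (\<theta>' +++ \<eta>)) (y, to_path (\<lambda>_. y)))"
    using path_component_twist[OF \<theta>] x\<theta> by blast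
next
  fix \<alpha> assume \<alpha>: "\<alpha> \<in> reid_classes P h x0 \<eta> \<and> (\<exists>y\<in>nclass x. \<exists>\<theta>'\<in>\<Union> \<alpha>.
      path_component_of (EB P h) (x0, to_path (\<theta>' +++ \<eta>)) (y, to_path (\<lambda>_. y)))"
  then obtain \<theta>1 where \<theta>1: "\<theta>1 \<in> loops (fibre_at P x0) x0" "\<alpha> = rcls P h x0 \<eta> \<theta>1"
    by (auto simp: reid_classes_eq)
  obtain y \<theta>2 where y: "y \<in> nclass x" "\<theta>2 \<in> loops (fibre_at P x0) x0"
    "same_component P h (\<theta>1 +++ \<eta>) (\<theta>2 +++ \<eta>)" "same_component P h (\<theta>2 +++ \<eta>) (\<lambda>_. y)"
    using \<alpha> path_component_twist unfolding \<theta>1(2) Union_rcls[where h = h, OF \<eta> \<theta>1(1)] by blast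
  have "same_component P h (\<lambda>_. x) (\<lambda>_. y)"
    using y(1) mem_nclass[OF x] by blast
  then have "same_component P h (\<theta>1 +++ \<eta>) (\<theta> +++ \<eta>)"
    using x\<theta> y(3,4) same_component_sym same_component_trans by blast
  then show "\<alpha> = rcls P h x0 \<eta> \<theta>"
    unfolding \<theta>1(2) rcls_eq_iff[where h = h, OF \<eta> \<theta>1(1) \<theta>] .
qed

lemma inj_on_nielsen_to_reid: "inj_on (nielsen_to_reid P h x0 \<eta>) (nielsen_classes P h)"
  unfolding nielsen_classes_eq
proof (intro inj_onI, elim imageE)
  fix N N' x x' assume N: "N = nclass x" "N' = nclass x'" and x: "x \<in> Fix P h" "x' \<in> Fix P h"
    and eq: "nielsen_to_reid P h x0 \<eta> N = nielsen_to_reid P h x0 \<eta> N'"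
  obtain \<theta> where \<theta>: "\<theta> \<in> loops (fibre_at P x0) x0" "same_component P h (\<theta> +++ \<eta>) (\<lambda>_. x)"
    using fixed_point_loop[OF x(1)] .
  obtain \<theta>' where \<theta>': "\<theta>' \<in> loops (fibre_at P x0) x0" "same_component P h (\<theta>' +++ \<eta>) (\<lambda>_. x')"
    using fixed_point_loop[OF x(2)] .
  have "same_component P h (\<theta> +++ \<eta>) (\<theta>' +++ \<eta>)"
    using eq unfolding N nielsen_to_reid_nclass[OF x(1) \<theta>] nielsen_to_reid_nclass[OF x(2) \<theta>']
      rcls_eq_iff[where h = h, OF \<eta> \<theta>(1) \<theta>'(1)] .
  then have "same_component P h (\<lambda>_. x) (\<lambda>_. x')"
    using \<theta>(2) \<theta>'(2) same_component_sym same_component_trans by blast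
  then have "same_component P h (\<lambda>_. x) q \<longleftrightarrow> same_component P h (\<lambda>_. x') q" for q
    using same_component_sym same_component_trans by blast
  then show "N = N'"
    unfolding N using mem_nclass[OF x(1)] mem_nclass[OF x(2)] by blast
qed

lemma nielsen_to_reid_mem: "N \<in> nielsen_classes P h \<Longrightarrow> nielsen_to_reid P h x0 \<eta> N \<in> reid_classes P h x0 \<eta>"
proof -
  assume "N \<in> nielsen_classes P h"
  then obtain x where x: "x \<in> Fix P h" "N = nclass x"
    by (auto simp: nielsen_classes_eq)
  obtain \<theta> where \<theta>: "\<theta> \<in> loops (fibre_at P x0) x0" "same_component P h (\<theta> +++ \<eta>) (\<lambda>_. x)"
    using fixed_point_loop[OF x(1)] .
  show ?thesis
    unfolding x(2) nielsen_to_reid_nclass[OF x(1) \<theta>] reid_classes_eq using \<theta>(1) by simp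
qed

lemma component_eq:
  assumes "same_component P h \<alpha> \<beta>"
  shows "Collect (path_component_of (EB P h) (\<alpha> 0, to_path \<alpha>)) =
    Collect (path_component_of (EB P h) (\<beta> 0, to_path \<beta>))"
  using assms unfolding same_component_def
  by (metis path_component_of_equiv)

text \<open>
  Both unions consist of a single path component of \<open>E\<^sub>B(h)\<close>. Hence the zero element against which an
  index is compared is the same for a Nielsen class and for its image.
\<close>

lemma nielsen_comp_eq_reid_comp:
  assumes N: "N \<in> nielsen_classes P h"
  shows "nielsen_comp P h N = reid_comp P h x0 \<eta> (nielsen_to_reid P h x0 \<eta> N)"
proof -
  obtain x where x: "x \<in> Fix P h" "N = nclass x"
    using N by (auto simp: nielsen_classes_eq)
  obtain \<theta> where \<theta>: "\<theta> \<in> loops (fibre_at P x0) x0" "same_component P h (\<theta> +++ \<eta>) (\<lambda>_. x)"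
    using fixed_point_loop[OF x(1)] .
  let ?C = "Collect (path_component_of (EB P h) (x, to_path (\<lambda>_. x)))"
  have "Collect (path_component_of (EB P h) (y, to_path (\<lambda>_. y))) = ?C" if "y \<in> N" for y
    using that component_eq[of "\<lambda>_. x" "\<lambda>_. y"] mem_nclass[OF x(1)] x(2) by simp
  moreover have "x \<in> N"
    unfolding x(2) using mem_nclass[OF x(1)] const_refl[OF x(1)] x(1) by blast
  ultimately have "nielsen_comp P h N = ?C"
    unfolding nielsen_comp_def by blast
  moreover have "Collect (path_component_of (EB P h) (x0, to_path (\<theta>' +++ \<eta>))) = ?C"
    if "\<theta>' \<in> \<Union> (rcls P h x0 \<eta> \<theta>)" for \<theta>'
  proof -
    have \<theta>': "\<theta>' \<in> loops (fibre_at P x0) x0" "same_component P h (\<theta> +++ \<eta>) (\<theta>' +++ \<eta>)"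
      using that unfolding Union_rcls[where h = h, OF \<eta> \<theta>(1)] by blast+
    have "(\<theta>' +++ \<eta>) 0 = x0"
      using \<theta>'(1) by (simp add: loops_def joinpaths_def pathstart_def)
    moreover have "same_component P h (\<theta>' +++ \<eta>) (\<lambda>_. x)"
      using \<theta>'(2) \<theta>(2) same_component_sym same_component_trans by blast
    ultimately show ?thesis
      using component_eq[of "\<theta>' +++ \<eta>" "\<lambda>_. x"] by simp
  qed
  moreover have "\<theta> \<in> \<Union> (rcls P h x0 \<eta> \<theta>)"
  proof -
    have "same_component P h (\<theta> +++ \<eta>) (\<theta> +++ \<eta>)"
      using \<theta>(2) same_component_sym same_component_trans by blast
    then show ?thesis
      unfolding Union_rcls[where h = h, OF \<eta> \<theta>(1)] using \<theta>(1) by simp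
  qed
  ultimately show ?thesis
    unfolding reid_comp_def x(2) nielsen_to_reid_nclass[OF x(1) \<theta>] by blast
qed

text \<open>
  Pigeonhole: the essential Nielsen classes inject into the finite set of Reidemeister classes and have
  the same number, so every Reidemeister class is the image of one of them. A nonzero number is
  needed since \<open>card\<close> is 0 on infinite sets.
\<close>

lemma essential_if_N_B_eq_R_B:
  assumes "0 \<noteq> N_B P h" "N_B P h = R_B P h x0 \<eta>" and \<alpha>: "\<alpha> \<in> reid_classes P h x0 \<eta>"
  shows "essential P h x0 \<eta> \<alpha>"
proof -
  define \<E> where "\<E> = {N \<in> nielsen_classes P h. nielsen_index P h N \<noteq> index_zero P h (nielsen_comp P h N)}"
  let ?\<phi> = "nielsen_to_reid P h x0 \<eta>"
  have inj: "inj_on ?\<phi> \<E>"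
    using inj_on_nielsen_to_reid by (rule inj_on_subset) (auto simp: \<E>_def)
  have "finite (reid_classes P h x0 \<eta>)"
    using assms(1,2) by (metis R_B_def card.infinite)
  moreover have "?\<phi> ` \<E> \<subseteq> reid_classes P h x0 \<eta>"
    using nielsen_to_reid_mem by (auto simp: \<E>_def)
  moreover have "card (?\<phi> ` \<E>) = card (reid_classes P h x0 \<eta>)"
    using card_image[OF inj] assms(2) by (simp add: N_B_def R_B_def \<E>_def)
  ultimately have "?\<phi> ` \<E> = reid_classes P h x0 \<eta>"
    by (rule card_subset_eq)
  then have "\<alpha> \<in> ?\<phi> ` \<E>"
    using \<alpha> by (simp only:)
  then obtain N where N: "N \<in> \<E>" "?\<phi> N = \<alpha>"
    by (elim imageE) simp
  have Nc: "N \<in> nielsen_classes P h"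
    using N(1) by (simp add: \<E>_def)
  have "(THE N'. N' \<in> nielsen_classes P h \<and> ?\<phi> N' = \<alpha>) = N"
    using Nc N(2) inj_on_nielsen_to_reid by (intro the_equality) (auto dest: inj_onD)
  then have "reid_index P h x0 \<eta> \<alpha> = nielsen_index P h N"
    using Nc N(2) by (auto simp: reid_index_def)
  then show ?thesis
    using N nielsen_comp_eq_reid_comp[OF Nc] by (simp add: essential_def \<E>_def)
qed

end

section \<open>Counting in a family of finite dynamical systems\<close>

text \<open>
  The combinatorial content of an \<open>n\<close>-toral map: \<open>R m\<close> stands for the set of Reidemeister classes of
  \<open>f\<^sup>m\<close>, \<open>F m\<close> for the map induced by \<open>f\<close> and \<open>G k m\<close> for \<open>\<gamma>\<^bsub>k,m\<^esub>\<close>. A model to keep in mind is given by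
  the points fixed by the \<open>m\<close>-th power of a permutation, with inclusions as the maps \<open>G k m\<close>.
\<close>

locale toral_family =
  fixes n :: nat and R :: "nat \<Rightarrow> 'x set" and F :: "nat \<Rightarrow> 'x \<Rightarrow> 'x"
    and G :: "nat \<Rightarrow> nat \<Rightarrow> 'x \<Rightarrow> 'x"
  assumes n_pos: "1 \<le> n"
    and fin: "m dvd n \<Longrightarrow> finite (R m)"
    and F_mem: "m dvd n \<Longrightarrow> x \<in> R m \<Longrightarrow> F m x \<in> R m"
    and F_period: "m dvd n \<Longrightarrow> x \<in> R m \<Longrightarrow> (F m ^^ m) x = x"
    and G_mem: "k dvd m \<Longrightarrow> m dvd n \<Longrightarrow> x \<in> R k \<Longrightarrow> G k m x \<in> R m"
    and G_equivariant: "k dvd m \<Longrightarrow> m dvd n \<Longrightarrow> x \<in> R k \<Longrightarrow> F m (G k m x) = G k m (F k x)"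
    and G_id: "m dvd n \<Longrightarrow> x \<in> R m \<Longrightarrow> G m m x = x"
    and G_comp: "k dvd m \<Longrightarrow> m dvd n \<Longrightarrow> x \<in> R k \<Longrightarrow> G m n (G k m x) = G k n x"
    and G_inj: "m dvd n \<Longrightarrow> inj_on (G m n) (R m)"
    and depth_eq_length: "m dvd n \<Longrightarrow> x \<in> R m \<Longrightarrow>
      (LEAST k. k dvd m \<and> x \<in> G k m ` R k) = (LEAST r. 1 \<le> r \<and> (F m ^^ r) x = x)"
begin

definition orbit_len :: "nat \<Rightarrow> 'x \<Rightarrow> nat" where
  "orbit_len m x = (LEAST r. 1 \<le> r \<and> (F m ^^ r) x = x)"

definition irred :: "nat \<Rightarrow> 'x set" where
  "irred m = {x \<in> R m. \<forall>k<m. \<not> (k dvd m \<and> x \<in> G k m ` R k)}"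

lemma dvd_pos: "m dvd n \<Longrightarrow> 1 \<le> m"
  using n_pos by (metis One_nat_def Suc_leI dvd_0_left_iff gr0I not_one_le_zero)

lemma funpow_F_mem: "m dvd n \<Longrightarrow> x \<in> R m \<Longrightarrow> (F m ^^ r) x \<in> R m"
  by (induction r) (auto intro: F_mem)

lemma funpow_G:
  "k dvd m \<Longrightarrow> m dvd n \<Longrightarrow> x \<in> R k \<Longrightarrow> (F m ^^ r) (G k m x) = G k m ((F k ^^ r) x)"
proof (induction r)
  case (Suc r)
  then show ?case
    using G_equivariant[of k m "(F k ^^ r) x"] funpow_F_mem[of k x r] dvd_trans by auto
qed simp

text \<open>
  Injectivity into level \<open>n\<close> passes down to all intermediate levels by functoriality.
\<close>

lemma G_inj_on: "k dvd m \<Longrightarrow> m dvd n \<Longrightarrow> inj_on (G k m) (R k)"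
  using G_comp G_inj[of k] dvd_trans unfolding inj_on_def by metis

lemma orbit_len_G:
  assumes "k dvd m" "m dvd n" "x \<in> R k"
  shows "orbit_len m (G k m x) = orbit_len k x"
proof -
  have "(F m ^^ r) (G k m x) = G k m x \<longleftrightarrow> (F k ^^ r) x = x" for r
    using funpow_G[OF assms] inj_on_eq_iff[OF G_inj_on[OF assms(1,2)]] assms
      funpow_F_mem[of k x r] dvd_trans by metis
  then show ?thesis by (simp add: orbit_len_def)
qed

text \<open>
  The length of an orbit is its depth, that is, the least level to which its elements are reducible.
\<close>

lemma orbit_len_reducible:
  assumes "m dvd n" "x \<in> R m"
  shows "orbit_len m x dvd m" and "x \<in> G (orbit_len m x) m ` R (orbit_len m x)"
    and "k dvd m \<Longrightarrow> x \<in> G k m ` R k \<Longrightarrow> orbit_len m x \<le> k"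
proof -
  have "m dvd m \<and> x \<in> G m m ` R m"
    using G_id[OF assms] assms by (auto simp: image_iff intro!: bexI[of _ x])
  from LeastI[of "\<lambda>k. k dvd m \<and> x \<in> G k m ` R k", OF this]
  show "orbit_len m x dvd m" "x \<in> G (orbit_len m x) m ` R (orbit_len m x)"
    using depth_eq_length[OF assms] by (simp_all add: orbit_len_def)
  show "orbit_len m x \<le> k" if "k dvd m" "x \<in> G k m ` R k"
    using Least_le[of "\<lambda>k. k dvd m \<and> x \<in> G k m ` R k" k] that depth_eq_length[OF assms]
    by (simp add: orbit_len_def)
qed

lemma irred_eq: "m dvd n \<Longrightarrow> irred m = {x \<in> R m. orbit_len m x = m}"
  unfolding irred_def
  using orbit_len_reducible dvd_imp_le[of _ m] dvd_pos[of m]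
  by (smt (verit, best) Collect_cong le_neq_implies_less less_le_trans linorder_not_le nat_dvd_not_less not_one_le_zero zero_less_iff_neq_zero)

text \<open>
  An equivariant injection preserves the length of orbits, and the irreducible elements of level \<open>k\<close> are
  those of length \<open>k\<close>.
\<close>

lemma image_irred:
  assumes "k dvd m" "m dvd n"
  shows "G k m ` irred k = {x \<in> R m. orbit_len m x = k}"
proof -
  have k: "k dvd n" using assms by (rule dvd_trans)
  show ?thesis
  proof (intro equalityI subsetI)
    fix x assume "x \<in> G k m ` irred k"
    then show "x \<in> {x \<in> R m. orbit_len m x = k}"
      using G_mem[OF assms] orbit_len_G[OF assms] by (auto simp: irred_eq[OF k])
  next
    fix x assume x: "x \<in> {x \<in> R m. orbit_len m x = k}"
    then obtain y where "y \<in> R k" "x = G k m y"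
      using orbit_len_reducible(2)[OF assms(2)] by blast
    then show "x \<in> G k m ` irred k"
      using x orbit_len_G[OF assms] by (auto simp: irred_eq[OF k])
  qed
qed

text \<open>
  Sort the elements of \<open>R m\<close> by their orbit length. This is the recursion that defines the numbers
  \<open>A\<^sub>n(f)\<close>.
\<close>

lemma card_eq_sum_irred:
  assumes "m dvd n"
  shows "card (R m) = (\<Sum>k | k dvd m. card (irred k))"
proof -
  have "R m = (\<Union>k\<in>{k. k dvd m}. G k m ` irred k)"
    using orbit_len_reducible(1)[OF assms] by (auto simp: image_irred[OF _ assms])
  moreover have "card (\<Union>k\<in>{k. k dvd m}. G k m ` irred k) = (\<Sum>k | k dvd m. card (G k m ` irred k))"
  proof (rule card_UN_disjoint)
    show "finite {k. k dvd m}"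
      using dvd_pos[OF assms] by simp
    show "\<forall>k\<in>{k. k dvd m}. finite (G k m ` irred k)"
      using fin[OF assms] by (simp add: image_irred[OF _ assms])
    show "\<forall>k\<in>{k. k dvd m}. \<forall>l\<in>{k. k dvd m}. k \<noteq> l \<longrightarrow> G k m ` irred k \<inter> G l m ` irred l = {}"
      by (auto simp: image_irred[OF _ assms])
  qed
  moreover have "card (G k m ` irred k) = card (irred k)" if "k dvd m" for k
    using G_inj_on[OF that assms] by (intro card_image) (auto simp: irred_def intro: inj_on_subset)
  ultimately show ?thesis by simp
qed

definition orbit :: "nat \<Rightarrow> 'x \<Rightarrow> 'x set" where
  "orbit m x = {(F m ^^ r) x |r. True}"

lemma orbit_mod:
  assumes "m dvd n" "x \<in> R m"
  shows "(F m ^^ r) x = (F m ^^ (r mod m)) x"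
proof -
  have "((F m ^^ m) ^^ q) x = x" for q
    by (induction q) (simp_all add: F_period[OF assms])
  then have "(F m ^^ (m * q)) x = x" for q
    by (simp add: funpow_mult)
  then show ?thesis
    by (metis comp_apply funpow_add mod_mult_div_eq)
qed

lemma orbit_len_funpow:
  assumes "m dvd n" "x \<in> R m"
  shows "orbit_len m ((F m ^^ r) x) = orbit_len m x"
proof -
  have "(F m ^^ q) ((F m ^^ r) x) = (F m ^^ r) x \<longleftrightarrow> (F m ^^ q) x = x" for q
  proof
    assume *: "(F m ^^ q) ((F m ^^ r) x) = (F m ^^ r) x"
    \<comment> \<open>Applying \<open>F m\<close> this many times undoes its \<open>r\<close>-th iterate; one extra period avoids a truncated difference.\<close>
    define s where "s = m * (r + 1) - r"
    have "m * (r + 1) \<ge> r"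
      using dvd_pos[OF assms(1)] by (cases m) auto
    then have s: "s + r = m * (r + 1)"
      by (simp add: s_def)
    have "(s + r) mod m = 0"
      unfolding s by (rule mod_mult_self1_is_0)
    then have "(F m ^^ (s + r)) x = x"
      using orbit_mod[OF assms, of "s + r"] by simp
    then have return: "(F m ^^ s) ((F m ^^ r) x) = x"
      by (simp add: funpow_add)
    have "(F m ^^ q) x = (F m ^^ q) ((F m ^^ s) ((F m ^^ r) x))"
      by (simp only: return)
    also have "\<dots> = (F m ^^ s) ((F m ^^ q) ((F m ^^ r) x))"
      by (metis add.commute comp_apply funpow_add)
    also have "\<dots> = x"
      by (simp only: * return)
    finally show "(F m ^^ q) x = x" .
  next
    assume *: "(F m ^^ q) x = x"
    have "(F m ^^ q) ((F m ^^ r) x) = (F m ^^ r) ((F m ^^ q) x)"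
      by (metis add.commute comp_apply funpow_add)
    then show "(F m ^^ q) ((F m ^^ r) x) = (F m ^^ r) x"
      by (simp only: *)
  qed
  then show ?thesis by (simp add: orbit_len_def)
qed

lemma orbit_eq:
  assumes "m dvd n" "x \<in> R m" "y \<in> orbit m x"
  shows "orbit m y = orbit m x"
proof -
  obtain r where y: "y = (F m ^^ r) x"
    using assms(3) by (auto simp: orbit_def)
  have "(F m ^^ q) x \<in> orbit m y" for q
  proof -
    have "r \<le> m * r"
      using dvd_pos[OF assms(1)] by simp
    then have "(F m ^^ (q + (m * r - r))) y = (F m ^^ (q + m * r)) x"
      unfolding y by (metis (no_types, lifting) add.assoc comp_apply funpow_add le_add_diff_inverse2)
    also have "\<dots> = (F m ^^ q) x"
      using orbit_mod[OF assms(1,2), of "q + m * r"] orbit_mod[OF assms(1,2), of q] by simp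
    finally show ?thesis
      unfolding orbit_def by (metis (mono_tags, lifting) mem_Collect_eq)
  qed
  moreover have "(F m ^^ q) y \<in> orbit m x" for q
    unfolding y orbit_def by (metis (mono_tags, lifting) comp_apply funpow_add mem_Collect_eq)
  ultimately show ?thesis
    unfolding orbit_def by blast
qed

lemma card_orbit:
  assumes "m dvd n" "x \<in> irred m"
  shows "card (orbit m x) = m"
proof -
  have x: "x \<in> R m" "orbit_len m x = m"
    using assms by (auto simp: irred_eq)
  have "orbit m x = (\<lambda>r. (F m ^^ r) x) ` {..<m}"
  proof (intro equalityI subsetI)
    fix y assume "y \<in> orbit m x"
    then obtain r where "y = (F m ^^ (r mod m)) x"
      using orbit_mod[OF assms(1) x(1)] by (auto simp: orbit_def)
    then show "y \<in> (\<lambda>r. (F m ^^ r) x) ` {..<m}"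
      using dvd_pos[OF assms(1)] by auto
  qed (auto simp: orbit_def)
  moreover have "inj_on (\<lambda>r. (F m ^^ r) x) {..<m}"
  proof (rule linorder_inj_onI)
    fix r s assume rs: "r < s" "r \<in> {..<m}" "s \<in> {..<m}"
    show "(F m ^^ r) x \<noteq> (F m ^^ s) x"
    proof
      assume "(F m ^^ r) x = (F m ^^ s) x"
      then have "(F m ^^ (s - r)) ((F m ^^ r) x) = (F m ^^ r) x"
        using rs(1) by (metis comp_apply funpow_add le_add_diff_inverse2 less_imp_le)
      then have "orbit_len m ((F m ^^ r) x) \<le> s - r"
        unfolding orbit_len_def using rs(1) by (intro Least_le) simp
      then show False
        using orbit_len_funpow[OF assms(1) x(1)] x(2) rs by simp
    qed
  qed (use linear in blast)
  ultimately show ?thesis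
    by (simp add: card_image)
qed

text \<open>
  The irreducible elements are closed under \<open>F m\<close>, and each of their orbits has exactly \<open>m\<close> elements.
\<close>

lemma card_irred_orbits:
  assumes "m dvd n"
  shows "m * card (orbit m ` irred m) = card (irred m)"
proof -
  have sub: "orbit m x \<subseteq> irred m" if "x \<in> irred m" for x
    using that funpow_F_mem[OF assms] orbit_len_funpow[OF assms]
    by (auto simp: orbit_def irred_eq[OF assms])
  have self: "x \<in> orbit m x" for x
    unfolding orbit_def by (auto intro: exI[of _ 0])
  have R: "x \<in> R m" if "x \<in> irred m" for x
    using that by (simp add: irred_def)
  have U: "\<Union> (orbit m ` irred m) = irred m"
    using sub self by blast
  have fi: "finite (irred m)"
    using fin[OF assms] by (simp add: irred_def)
  have "m * card (orbit m ` irred m) = card (\<Union> (orbit m ` irred m))"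
  proof (rule card_partition)
    show "finite (orbit m ` irred m)" "finite (\<Union> (orbit m ` irred m))"
      using fi U by simp_all
    show "card c = m" if "c \<in> orbit m ` irred m" for c
      using that card_orbit[OF assms] by blast
    show "c \<inter> d = {}" if cd: "c \<in> orbit m ` irred m" "d \<in> orbit m ` irred m" "c \<noteq> d" for c d
    proof (rule ccontr)
      assume "c \<inter> d \<noteq> {}"
      then obtain z where "z \<in> c" "z \<in> d" by blast
      then have "orbit m z = c" "orbit m z = d"
        using cd orbit_eq[OF assms] R by blast+
      then show False using cd(3) by simp
    qed
  qed
  then show ?thesis by (simp add: U)
qed

end

section \<open>The Reidemeister classes of the iterates\<close>

lemma the_elem_image_const:
  assumes "A \<noteq> {}" "\<And>a. a \<in> A \<Longrightarrow> g a = c"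
  shows "the_elem (g ` A) = c"
  using assms by (metis image_cong image_constant_conv the_elem_eq)

text \<open>
  A map over the base with a path \<open>\<omega>\<close> from the base point to its image inside the fibre. The loop \<open>\<theta>\<close>
  enters the \<open>m\<close>-th level only through the twisted path \<open>\<theta> * m(\<omega>)\<close>, a point of \<open>E\<^sub>B(f\<^sup>m)\<close>; it is called
  \<open>twist m \<theta>\<close>.
\<close>

locale iterated_fibre_map =
  fixes P :: "('a::topological_space, 'b) fibred" and f :: "'a \<Rightarrow> 'a" and x0 :: 'a
    and \<omega> :: "real \<Rightarrow> 'a"
  assumes map_over: "map_over P f" and x0_tot: "x0 \<in> tot P"
    and \<omega>: "\<omega> \<in> paths_between (fibre_at P x0) x0 (f x0)"
begin

abbreviation Y where "Y \<equiv> fibre_at P x0"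

abbreviation twist :: "nat \<Rightarrow> (real \<Rightarrow> 'a) \<Rightarrow> real \<Rightarrow> 'a" where
  "twist m \<theta> \<equiv> \<theta> +++ npath f \<omega> m"

abbreviation rclass :: "nat \<Rightarrow> (real \<Rightarrow> 'a) \<Rightarrow> (real \<Rightarrow> 'a) set set" where
  "rclass m \<equiv> rcls P (f ^^ m) x0 (npath f \<omega> m)"

lemma map_over_pow: "map_over P (f ^^ m)"
  by (rule map_over_funpow[OF map_over])

lemma npath_m: "1 \<le> m \<Longrightarrow> npath f \<omega> m \<in> paths_between Y x0 ((f ^^ m) x0)"
  by (rule npath_between[OF map_over \<omega>])

lemma twist_between:
  "1 \<le> m \<Longrightarrow> \<theta> \<in> loops Y x0 \<Longrightarrow> twist m \<theta> \<in> paths_between Y x0 ((f ^^ m) x0)"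
  unfolding loops_eq_paths_between by (rule paths_between_join[OF _ npath_m])

lemma fpow_loop:
  assumes "1 \<le> k" "\<theta> \<in> loops Y x0"
  shows "fpow f \<omega> k \<theta> \<in> loops Y x0"
  using paths_between_join[OF paths_between_join[OF npath_m[OF assms(1)]
      map_over_paths_between[OF map_over_pow, of \<theta> x0 x0 x0 k]]
      paths_between_reverse[OF npath_m[OF assms(1)]]] assms(2)
  unfolding loops_eq_paths_between fpow_def by blast

lemma same_component_in_base_fibre:
  assumes "homotopic_paths Y p q" "q \<in> paths_between Y x0 ((f ^^ m) x0)"
  shows "same_component P (f ^^ m) p q"
  using same_component_sym[OF same_component_homotopic[where h = "f ^^ m", OF homotopic_paths_sym[OF assms(1)] assms(2)]] .

text \<open>
  In \<open>E\<^sub>B(f\<^sup>n)\<close> the map \<open>f\<^bsup>\<omega>\<^esup>\<close> becomes composition with \<open>f\<close>. Since \<open>n(\<omega>) * f\<^sup>n(\<omega>)\<close> and \<open>\<omega> * f(n(\<omega>))\<close>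
  are both \<open>(n + 1)(\<omega>)\<close> up to bracketing, \<open>\<omega> * f(\<theta>) * \<omega>\<^bsup>-1\<^esup> * n(\<omega>)\<close> is homotopic to
  \<open>\<omega> * f(\<theta> * n(\<omega>)) * f\<^sup>n(\<omega>)\<^bsup>-1\<^esup>\<close>, and the conjugation by \<open>\<omega>\<close> does not change the component.
\<close>

lemma twist_fpow:
  assumes n: "1 \<le> n" and \<theta>: "\<theta> \<in> loops Y x0"
  shows "same_component P (f ^^ n) (twist n (fpow f \<omega> 1 \<theta>)) (f \<circ> twist n \<theta>)"
proof -
  let ?N = "npath f \<omega> n" and ?V = "(f ^^ n) \<circ> \<omega>"
  note N = npath_m[OF n]
  have \<theta>b: "\<theta> \<in> paths_between Y x0 x0"
    using \<theta> by (simp add: loops_eq_paths_between)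
  have V: "?V \<in> paths_between Y ((f ^^ n) x0) ((f ^^ n) (f x0))"
    by (rule map_over_paths_between[OF map_over_pow \<omega>])
  have T: "f \<circ> \<theta> \<in> paths_between Y (f x0) (f x0)"
    by (rule map_over_paths_between[OF map_over \<theta>b])
  have fN: "f \<circ> ?N \<in> paths_between Y (f x0) ((f ^^ n) (f x0))"
    using map_over_paths_between[OF map_over N] by (simp add: funpow_swap1)
  have fT: "(f \<circ> \<theta>) +++ (f \<circ> ?N) = f \<circ> twist n \<theta>"
    by (simp add: path_compose_join)
  have fTb: "f \<circ> twist n \<theta> \<in> paths_between Y (f x0) ((f ^^ n) (f x0))"
    using paths_between_join[OF T fN] by (simp only: fT)
  let ?Q = "(\<omega> +++ (f \<circ> \<theta>)) +++ reversepath \<omega>"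
  have Q: "?Q \<in> paths_between Y x0 x0"
    by (intro paths_between_join[OF paths_between_join[OF \<omega> T]] paths_between_reverse[OF \<omega>])
  have "homotopic_paths Y (?N +++ ?V) (\<omega> +++ (f \<circ> ?N))"
    using npath_add[OF map_over \<omega> order_refl n] npath_Suc[OF n, of f \<omega>] by simp
  then have "homotopic_paths Y ((?N +++ ?V) +++ reversepath ?V) ((\<omega> +++ (f \<circ> ?N)) +++ reversepath ?V)"
    by (rule homotopic_join_cong_left[OF _ paths_between_join[OF \<omega> fN] paths_between_reverse[OF V]])
  moreover have "homotopic_paths Y ?N ((?N +++ ?V) +++ reversepath ?V)"
    using homotopic_join_reverse_cancel[OF paths_between_reverse[OF V] N] by (simp add: homotopic_paths_sym)
  ultimately have N': "homotopic_paths Y ?N ((\<omega> +++ (f \<circ> ?N)) +++ reversepath ?V)"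
    by (rule homotopic_paths_trans[rotated])
  have "homotopic_paths Y (?Q +++ ?N) (?Q +++ ((\<omega> +++ (f \<circ> ?N)) +++ reversepath ?V))"
    by (rule homotopic_join_cong_right[OF N' Q paths_between_join[OF paths_between_join[OF \<omega> fN] paths_between_reverse[OF V]]])
  also have "homotopic_paths Y \<dots> ((?Q +++ (\<omega> +++ (f \<circ> ?N))) +++ reversepath ?V)"
    by (rule homotopic_paths_sym[OF homotopic_join_assoc[OF Q paths_between_join[OF \<omega> fN] paths_between_reverse[OF V]]])
  also have "homotopic_paths Y \<dots> ((\<omega> +++ (f \<circ> twist n \<theta>)) +++ reversepath ?V)"
    unfolding fT[symmetric]
    by (rule homotopic_join_cong_left[OF homotopic_conjugate_join[OF \<omega> T fN \<omega>]
        paths_between_join[OF \<omega> paths_between_join[OF T fN]] paths_between_reverse[OF V]])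
  finally have "same_component P (f ^^ n) (?Q +++ ?N) ((\<omega> +++ (f \<circ> twist n \<theta>)) +++ reversepath ?V)"
    by (rule same_component_in_base_fibre)
      (intro paths_between_join[OF paths_between_join[OF \<omega> fTb] paths_between_reverse[OF V]])
  also have "same_component P (f ^^ n) \<dots> (f \<circ> twist n \<theta>)"
    by (rule same_component_conjugate[OF map_over_pow \<omega> fTb])
  finally show ?thesis
    by (simp add: fpow_def)
qed

text \<open>
  Here \<open>C k\<close> is the product of the first \<open>k\<close> factors of \<open>\<gamma>\<close>. Each factor \<open>f\<^bsup>km\<omega>\<^esup>(\<theta>)\<close> ends with the inverse
  of \<open>(km)(\<omega>)\<close>, which cancels against the beginning of \<open>((k + 1) m)(\<omega>)\<close>; what is left are the
  factors \<open>f\<^bsup>km\<^esup>(\<theta> * m(\<omega>))\<close>.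
\<close>

lemma gam_npath_homotopic:
  fixes m :: nat and \<theta> :: "real \<Rightarrow> 'a"
  defines "C \<equiv> \<lambda>k. pconcat (\<lambda>i. if i = 0 then \<theta> else fpow f \<omega> (i * m) \<theta>) (k - 1)"
  assumes m: "1 \<le> m" and \<theta>: "\<theta> \<in> loops Y x0" and "1 \<le> k"
  shows "C k \<in> loops Y x0 \<and>
    homotopic_paths Y (C k +++ npath f \<omega> (k * m)) (npath (f ^^ m) (twist m \<theta>) k)"
  using \<open>1 \<le> k\<close>
proof (induction k rule: dec_induct)
  case base
  then show ?case
    using homotopic_refl_between[OF twist_between[OF m \<theta>]] \<theta> by (simp add: C_def)
next
  case (step k)
  let ?A = "npath f \<omega> (k * m)" and ?B = "(f ^^ (k * m)) \<circ> \<theta>" and ?D = "(f ^^ (k * m)) \<circ> npath f \<omega> m"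
  have km: "1 \<le> k * m"
    using step.hyps m by simp
  have Csuc: "C (Suc k) = C k +++ ((?A +++ ?B) +++ reversepath ?A)"
    using step.hyps by (cases k) (simp_all add: C_def fpow_def)
  have \<theta>b: "\<theta> \<in> paths_between Y x0 x0"
    using \<theta> by (simp add: loops_eq_paths_between)
  have Ck: "C k \<in> paths_between Y x0 x0"
    using step.IH by (simp add: loops_eq_paths_between)
  note A = npath_m[OF km] and B = map_over_paths_between[OF map_over_pow[of "k * m"] \<theta>b]
    and D = map_over_paths_between[OF map_over_pow[of "k * m"] npath_m[OF m]]
  note Q = paths_between_join[OF paths_between_join[OF A B] paths_between_reverse[OF A]]
  have CS: "C (Suc k) \<in> paths_between Y x0 x0"
    unfolding Csuc by (rule paths_between_join[OF Ck Q])
  have BD: "?B +++ ?D = ((f ^^ m) ^^ k) \<circ> twist m \<theta>"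
    by (simp add: path_compose_join funpow_mult mult.commute)
  have "homotopic_paths Y (npath f \<omega> (Suc k * m)) (?A +++ ?D)"
    using npath_add[OF map_over \<omega> km m] by (simp add: add.commute)
  then have "homotopic_paths Y (C (Suc k) +++ npath f \<omega> (Suc k * m)) (C (Suc k) +++ (?A +++ ?D))"
    by (rule homotopic_join_cong_right[OF _ CS paths_between_join[OF A D]])
  also have "homotopic_paths Y \<dots> (C k +++ (((?A +++ ?B) +++ reversepath ?A) +++ (?A +++ ?D)))"
    unfolding Csuc by (rule homotopic_join_assoc[OF Ck Q paths_between_join[OF A D]])
  also have "homotopic_paths Y \<dots> (C k +++ (?A +++ (?B +++ ?D)))"
    by (rule homotopic_join_cong_right[OF homotopic_conjugate_join[OF A B D A] Ck
        paths_between_join[OF A paths_between_join[OF B D]]])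
  also have "homotopic_paths Y \<dots> ((C k +++ ?A) +++ (?B +++ ?D))"
    by (rule homotopic_paths_sym[OF homotopic_join_assoc[OF Ck A paths_between_join[OF B D]]])
  also have "homotopic_paths Y \<dots> (npath (f ^^ m) (twist m \<theta>) k +++ (?B +++ ?D))"
    using homotopic_paths_between[OF conjunct2[OF step.IH]] paths_between_join[OF Ck A]
    by (intro homotopic_join_cong_left[OF conjunct2[OF step.IH] _ paths_between_join[OF B D]]) blast
  finally show ?case
    using CS unfolding BD npath_Suc[OF step.hyps(1)] by (simp add: loops_eq_paths_between)
qed

lemma dvd_quotient:
  assumes "m dvd n" "1 \<le> (n::nat)"
  shows "1 \<le> m" "1 \<le> n div m" "n div m * m = n" "m * (n div m) = n"
  using assms by (auto simp: Suc_le_eq dvd_pos_nat dvd_div_eq_0_iff intro!: Nat.gr0I)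

lemma gam_loop:
  assumes "m dvd n" "1 \<le> n" "\<theta> \<in> loops Y x0"
  shows "gam f \<omega> m n \<theta> \<in> loops Y x0"
  using gam_npath_homotopic[OF dvd_quotient(1)[OF assms(1,2)] assms(3) dvd_quotient(2)[OF assms(1,2)]]
  by (simp add: gam_def)

lemma twist_npath_between:
  assumes "m dvd n" "1 \<le> n" "\<theta> \<in> loops Y x0"
  shows "npath (f ^^ m) (twist m \<theta>) (n div m) \<in> paths_between Y x0 ((f ^^ n) x0)"
  using npath_between[OF map_over_pow twist_between[OF dvd_quotient(1)[OF assms(1,2)] assms(3)]
      dvd_quotient(2)[OF assms(1,2)]]
  by (simp add: funpow_mult dvd_quotient(4)[OF assms(1,2)])

text \<open>
  In \<open>E\<^sub>B(f\<^sup>n)\<close> the map \<open>\<gamma>\<^bsub>m,n\<^esub>\<close> becomes \<open>\<alpha> \<mapsto> \<alpha> * f\<^sup>m(\<alpha>) * \<dots> * f\<^bsup>n-m\<^esup>(\<alpha>)\<close>.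
\<close>

lemma twist_gam:
  assumes "m dvd n" "1 \<le> n" "\<theta> \<in> loops Y x0"
  shows "same_component P (f ^^ n) (twist n (gam f \<omega> m n \<theta>)) (npath (f ^^ m) (twist m \<theta>) (n div m))"
  using gam_npath_homotopic[OF dvd_quotient(1)[OF assms(1,2)] assms(3) dvd_quotient(2)[OF assms(1,2)]]
  by (intro same_component_in_base_fibre twist_npath_between[OF assms])
    (simp add: gam_def dvd_quotient(3)[OF assms(1,2)])

lemma rclass_eq_iff:
  assumes "1 \<le> m" "\<theta> \<in> loops Y x0" "\<theta>' \<in> loops Y x0"
  shows "rclass m \<theta> = rclass m \<theta>' \<longleftrightarrow> same_component P (f ^^ m) (twist m \<theta>) (twist m \<theta>')"
  by (rule rcls_eq_iff[where h = "f ^^ m", OF npath_m[OF assms(1)] assms(2,3)])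

lemma Union_rclass:
  assumes "1 \<le> m" "\<theta> \<in> loops Y x0"
  shows "\<Union> (rclass m \<theta>) = {\<theta>' \<in> loops Y x0. same_component P (f ^^ m) (twist m \<theta>) (twist m \<theta>')}"
  by (rule Union_rcls[where h = "f ^^ m", OF npath_m[OF assms(1)] assms(2)])

lemma twist_refl:
  assumes "1 \<le> m" "\<theta> \<in> loops Y x0"
  shows "same_component P (f ^^ m) (twist m \<theta>) (twist m \<theta>)"
  using same_component_refl[where h = "f ^^ m", OF twist_between[OF assms]] .

lemma Rn_eq: "Rn P f x0 \<omega> m = rclass m ` loops Y x0"
  by (simp add: Rn_def reid_classes_eq)

lemma same_component_compose_f:
  "same_component P (f ^^ m) \<alpha> \<beta> \<Longrightarrow> same_component P (f ^^ m) (f \<circ> \<alpha>) (f \<circ> \<beta>)"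
  by (rule same_component_image[OF _ map_over]) (simp_all add: funpow_swap1)

lemma same_component_npath_div:
  assumes "m dvd n" "1 \<le> n" "same_component P (f ^^ m) \<alpha> \<beta>"
  shows "same_component P (f ^^ n) (npath (f ^^ m) \<alpha> (n div m)) (npath (f ^^ m) \<beta> (n div m))"
  using same_component_npath[OF map_over_pow assms(3) dvd_quotient(2)[OF assms(1,2)]]
  by (simp add: funpow_mult dvd_quotient(4)[OF assms(1,2)])

text \<open>
  The image that \<open>the_elem\<close> is applied to is a singleton, as composition with \<open>f\<close> respects components.
\<close>

lemma fmap_rclass:
  assumes n: "1 \<le> n" and \<theta>: "\<theta> \<in> loops Y x0"
  shows "fmap P f x0 \<omega> n (rclass n \<theta>) = rclass n (fpow f \<omega> 1 \<theta>)"
  unfolding fmap_def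
proof (rule the_elem_image_const)
  show "\<Union> (rclass n \<theta>) \<noteq> {}"
    using Union_rclass[OF n \<theta>] twist_refl[OF n \<theta>] \<theta> by blast
  fix \<theta>' assume "\<theta>' \<in> \<Union> (rclass n \<theta>)"
  then have \<theta>': "\<theta>' \<in> loops Y x0" "same_component P (f ^^ n) (twist n \<theta>) (twist n \<theta>')"
    unfolding Union_rclass[OF n \<theta>] by blast+
  have "same_component P (f ^^ n) (twist n (fpow f \<omega> 1 \<theta>')) (twist n (fpow f \<omega> 1 \<theta>))"
    using twist_fpow[OF n \<theta>] twist_fpow[OF n \<theta>'(1)] same_component_compose_f[OF \<theta>'(2)]
      same_component_sym same_component_trans by blast
  then show "rclass n (fpow f \<omega> 1 \<theta>') = rclass n (fpow f \<omega> 1 \<theta>)"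
    using rclass_eq_iff[OF n fpow_loop[OF order_refl \<theta>'(1)] fpow_loop[OF order_refl \<theta>]] by blast
qed

lemma gmap_rclass:
  assumes mn: "m dvd n" "1 \<le> n" and \<theta>: "\<theta> \<in> loops Y x0"
  shows "gmap P f x0 \<omega> m n (rclass m \<theta>) = rclass n (gam f \<omega> m n \<theta>)"
  unfolding gmap_def
proof (rule the_elem_image_const)
  note m = dvd_quotient(1)[OF mn]
  show "\<Union> (rclass m \<theta>) \<noteq> {}"
    using Union_rclass[OF m \<theta>] twist_refl[OF m \<theta>] \<theta> by blast
  fix \<theta>' assume "\<theta>' \<in> \<Union> (rclass m \<theta>)"
  then have \<theta>': "\<theta>' \<in> loops Y x0" "same_component P (f ^^ m) (twist m \<theta>) (twist m \<theta>')"
    unfolding Union_rclass[OF m \<theta>] by blast+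
  have "same_component P (f ^^ n) (twist n (gam f \<omega> m n \<theta>')) (twist n (gam f \<omega> m n \<theta>))"
    using twist_gam[OF mn \<theta>] twist_gam[OF mn \<theta>'(1)] same_component_npath_div[OF mn \<theta>'(2)]
      same_component_sym same_component_trans by blast
  then show "rclass n (gam f \<omega> m n \<theta>') = rclass n (gam f \<omega> m n \<theta>)"
    using rclass_eq_iff[OF mn(2) gam_loop[OF mn \<theta>'(1)] gam_loop[OF mn \<theta>]] by blast
qed

lemma fmap_funpow_rclass:
  assumes n: "1 \<le> n" and \<theta>: "\<theta> \<in> loops Y x0"
  shows "\<exists>\<theta>'\<in>loops Y x0. (fmap P f x0 \<omega> n ^^ r) (rclass n \<theta>) = rclass n \<theta>' \<and>
    same_component P (f ^^ n) (twist n \<theta>') ((f ^^ r) \<circ> twist n \<theta>)"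
proof (induction r)
  case 0
  then show ?case
    using twist_refl[OF n \<theta>] \<theta> by (auto intro!: bexI[of _ \<theta>])
next
  case (Suc r)
  then obtain \<theta>' where \<theta>': "\<theta>' \<in> loops Y x0" "(fmap P f x0 \<omega> n ^^ r) (rclass n \<theta>) = rclass n \<theta>'"
    "same_component P (f ^^ n) (twist n \<theta>') ((f ^^ r) \<circ> twist n \<theta>)" by blast
  have "same_component P (f ^^ n) (twist n (fpow f \<omega> 1 \<theta>')) (f \<circ> ((f ^^ r) \<circ> twist n \<theta>))"
    using twist_fpow[OF n \<theta>'(1)] same_component_compose_f[OF \<theta>'(3)] same_component_trans by blast
  then have "same_component P (f ^^ n) (twist n (fpow f \<omega> 1 \<theta>')) ((f ^^ Suc r) \<circ> twist n \<theta>)"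
    by (simp only: funpow.simps comp_assoc)
  moreover have "(fmap P f x0 \<omega> n ^^ Suc r) (rclass n \<theta>) = rclass n (fpow f \<omega> 1 \<theta>')"
    by (simp only: funpow.simps comp_apply \<theta>'(2) fmap_rclass[OF n \<theta>'(1)])
  ultimately show ?case
    using fpow_loop[OF order_refl \<theta>'(1)] by blast
qed

text \<open>
  The \<open>n\<close>-th iterate is composition with \<open>f\<^sup>n\<close>, which moves every point of \<open>E\<^sub>B(f\<^sup>n)\<close> within its component.
\<close>

lemma fmap_period:
  assumes n: "1 \<le> n" and "\<alpha> \<in> Rn P f x0 \<omega> n"
  shows "(fmap P f x0 \<omega> n ^^ n) \<alpha> = \<alpha>"
proof -
  obtain \<theta> where \<theta>: "\<theta> \<in> loops Y x0" "\<alpha> = rclass n \<theta>"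
    using assms(2) by (auto simp: Rn_eq)
  obtain \<theta>' where \<theta>': "\<theta>' \<in> loops Y x0" "(fmap P f x0 \<omega> n ^^ n) (rclass n \<theta>) = rclass n \<theta>'"
    "same_component P (f ^^ n) (twist n \<theta>') ((f ^^ n) \<circ> twist n \<theta>)"
    using fmap_funpow_rclass[OF n \<theta>(1)] by blast
  have "same_component P (f ^^ n) ((f ^^ n) \<circ> twist n \<theta>) (twist n \<theta>)"
    by (rule same_component_map_self[OF map_over_pow twist_between[OF n \<theta>(1)]])
  then have "same_component P (f ^^ n) (twist n \<theta>') (twist n \<theta>)"
    using \<theta>'(3) same_component_trans by blast
  then show ?thesis
    using \<theta>'(2) \<theta>(2) rclass_eq_iff[OF n \<theta>'(1) \<theta>(1)] by simp
qed

lemma fmap_gmap: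
  assumes mn: "m dvd n" "1 \<le> n" and "\<alpha> \<in> Rn P f x0 \<omega> m"
  shows "fmap P f x0 \<omega> n (gmap P f x0 \<omega> m n \<alpha>) = gmap P f x0 \<omega> m n (fmap P f x0 \<omega> m \<alpha>)"
proof -
  obtain \<theta> where \<theta>: "\<theta> \<in> loops Y x0" "\<alpha> = rclass m \<theta>"
    using assms(3) by (auto simp: Rn_eq)
  note m = dvd_quotient(1)[OF mn]
  let ?g = "gam f \<omega> m n" and ?\<phi> = "fpow f \<omega> 1"
  note g = gam_loop[OF mn \<theta>(1)] and \<phi> = fpow_loop[OF order_refl \<theta>(1)]
  have "same_component P (f ^^ n) (twist n (?\<phi> (?g \<theta>))) (f \<circ> twist n (?g \<theta>))"
    by (rule twist_fpow[OF mn(2) g])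
  also have "same_component P (f ^^ n) \<dots> (f \<circ> npath (f ^^ m) (twist m \<theta>) (n div m))"
    by (rule same_component_compose_f[OF twist_gam[OF mn \<theta>(1)]])
  also have "\<dots> = npath (f ^^ m) (f \<circ> twist m \<theta>) (n div m)"
    by (rule compose_npath[OF dvd_quotient(2)[OF mn]])
  also have "same_component P (f ^^ n) \<dots> (npath (f ^^ m) (twist m (?\<phi> \<theta>)) (n div m))"
    by (rule same_component_npath_div[OF mn same_component_sym[OF twist_fpow[OF m \<theta>(1)]]])
  also have "same_component P (f ^^ n) \<dots> (twist n (?g (?\<phi> \<theta>)))"
    by (rule same_component_sym[OF twist_gam[OF mn \<phi>]])
  finally have "rclass n (?\<phi> (?g \<theta>)) = rclass n (?g (?\<phi> \<theta>))"
    using rclass_eq_iff[OF mn(2) fpow_loop[OF order_refl g] gam_loop[OF mn \<phi>]] by blast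
  then show ?thesis
    by (simp only: \<theta>(2) gmap_rclass[OF mn \<theta>(1)] fmap_rclass[OF mn(2) g] fmap_rclass[OF m \<theta>(1)] gmap_rclass[OF mn \<phi>])
qed

lemma gmap_comp:
  assumes km: "k dvd m" and mn: "m dvd n" "1 \<le> n" and "\<alpha> \<in> Rn P f x0 \<omega> k"
  shows "gmap P f x0 \<omega> m n (gmap P f x0 \<omega> k m \<alpha>) = gmap P f x0 \<omega> k n \<alpha>"
proof -
  obtain \<theta> where \<theta>: "\<theta> \<in> loops Y x0" "\<alpha> = rclass k \<theta>"
    using assms(4) by (auto simp: Rn_eq)
  note m = dvd_quotient(1)[OF mn]
  note kn = dvd_trans[OF km mn(1)] mn(2)
  note k = dvd_quotient(1)[OF km m]
  note g = gam_loop[OF km m \<theta>(1)]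
  have "same_component P (f ^^ n) (twist n (gam f \<omega> m n (gam f \<omega> k m \<theta>)))
      (npath (f ^^ m) (twist m (gam f \<omega> k m \<theta>)) (n div m))"
    by (rule twist_gam[OF mn g])
  also have "same_component P (f ^^ n) \<dots> (npath (f ^^ m) (npath (f ^^ k) (twist k \<theta>) (m div k)) (n div m))"
    by (rule same_component_npath_div[OF mn twist_gam[OF km m \<theta>(1)]])
  also have "same_component P (f ^^ n) \<dots> (npath (f ^^ k) (twist k \<theta>) (n div k))"
  proof (rule same_component_in_base_fibre[OF _ twist_npath_between[OF kn \<theta>(1)]])
    have "m div k * (n div m) = n div k"
      using km mn(1) k m by (auto elim!: dvdE)
    then show "homotopic_paths Y (npath (f ^^ m) (npath (f ^^ k) (twist k \<theta>) (m div k)) (n div m))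
        (npath (f ^^ k) (twist k \<theta>) (n div k))"
      using npath_mult[OF map_over_pow twist_between[OF k \<theta>(1)] dvd_quotient(2)[OF km m] dvd_quotient(2)[OF mn]]
      by (simp add: funpow_mult dvd_quotient(4)[OF km m])
  qed
  also have "same_component P (f ^^ n) \<dots> (twist n (gam f \<omega> k n \<theta>))"
    by (rule same_component_sym[OF twist_gam[OF kn \<theta>(1)]])
  finally have "rclass n (gam f \<omega> m n (gam f \<omega> k m \<theta>)) = rclass n (gam f \<omega> k n \<theta>)"
    using rclass_eq_iff[OF mn(2) gam_loop[OF mn g] gam_loop[OF kn \<theta>(1)]] by blast
  then show ?thesis
    by (simp only: \<theta>(2) gmap_rclass[OF km m \<theta>(1)] gmap_rclass[OF mn g] gmap_rclass[OF kn \<theta>(1)])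
qed

lemma toral_family_Rn:
  assumes n: "1 \<le> n" and tor: "toral P f x0 \<omega> n"
    and fin: "\<And>m. m dvd n \<Longrightarrow> finite (Rn P f x0 \<omega> m)"
  shows "toral_family n (Rn P f x0 \<omega>) (fmap P f x0 \<omega>) (gmap P f x0 \<omega>)"
proof
  show "1 \<le> n" by fact
  fix m assume mn: "m dvd n"
  note m = dvd_quotient(1)[OF mn n]
  show "finite (Rn P f x0 \<omega> m)"
    by (rule fin[OF mn])
  show "inj_on (gmap P f x0 \<omega> m n) (Rn P f x0 \<omega> m)"
    using tor mn by (simp add: toral_def)
  show "fmap P f x0 \<omega> m \<alpha> \<in> Rn P f x0 \<omega> m" "(fmap P f x0 \<omega> m ^^ m) \<alpha> = \<alpha>"
    "gmap P f x0 \<omega> m m \<alpha> = \<alpha>"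
    "(LEAST k. k dvd m \<and> \<alpha> \<in> gmap P f x0 \<omega> k m ` Rn P f x0 \<omega> k) =
     (LEAST r. 1 \<le> r \<and> (fmap P f x0 \<omega> m ^^ r) \<alpha> = \<alpha>)" if \<alpha>: "\<alpha> \<in> Rn P f x0 \<omega> m" for \<alpha>
  proof -
    obtain \<theta> where \<theta>: "\<theta> \<in> loops Y x0" "\<alpha> = rclass m \<theta>"
      using \<alpha> by (auto simp: Rn_eq)
    show "fmap P f x0 \<omega> m \<alpha> \<in> Rn P f x0 \<omega> m"
      unfolding \<theta>(2) fmap_rclass[OF m \<theta>(1)] Rn_eq using fpow_loop[OF order_refl \<theta>(1)] by simp
    show "(fmap P f x0 \<omega> m ^^ m) \<alpha> = \<alpha>"
      by (rule fmap_period[OF m \<alpha>])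
    show "gmap P f x0 \<omega> m m \<alpha> = \<alpha>"
      unfolding \<theta>(2) gmap_rclass[OF dvd_refl m \<theta>(1)] using m by (simp add: gam_def)
    show "(LEAST k. k dvd m \<and> \<alpha> \<in> gmap P f x0 \<omega> k m ` Rn P f x0 \<omega> k) =
     (LEAST r. 1 \<le> r \<and> (fmap P f x0 \<omega> m ^^ r) \<alpha> = \<alpha>)"
      using tor mn \<alpha> by (simp add: toral_def class_depth_def orbit_length_def reducible_to_def)
  qed
  fix k \<alpha> assume km: "k dvd m" and \<alpha>: "\<alpha> \<in> Rn P f x0 \<omega> k"
  obtain \<theta> where \<theta>: "\<theta> \<in> loops Y x0" "\<alpha> = rclass k \<theta>"
    using \<alpha> by (auto simp: Rn_eq)
  show "gmap P f x0 \<omega> k m \<alpha> \<in> Rn P f x0 \<omega> m"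
    unfolding \<theta>(2) gmap_rclass[OF km m \<theta>(1)] Rn_eq using gam_loop[OF km m \<theta>(1)] by simp
  show "fmap P f x0 \<omega> m (gmap P f x0 \<omega> k m \<alpha>) = gmap P f x0 \<omega> k m (fmap P f x0 \<omega> k \<alpha>)"
    by (rule fmap_gmap[OF km m \<alpha>])
  show "gmap P f x0 \<omega> m n (gmap P f x0 \<omega> k m \<alpha>) = gmap P f x0 \<omega> k n \<alpha>"
    by (rule gmap_comp[OF km mn n \<alpha>])
qed

end

section \<open>The counting formula\<close>

theorem theorem5p3:
  fixes P :: "('a::topological_space, 'b::topological_space) fibred"
    and F :: "'c::topological_space set" and FA :: "'c chart set"
    and f :: "'a \<Rightarrow> 'a" and x0 :: 'a and \<omega> :: "real \<Rightarrow> 'a" and n :: nat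
  assumes "fibration P"
    and "smooth_fibre_bundle P F FA"
    and "compact (tot P)" and "path_connected (tot P)"
    and "compact (bas P)" and "path_connected (bas P)"
    and "compact F" and "path_connected F"
    and "map_over P f"
    and "x0 \<in> tot P"
    and "path \<omega>" and "path_image \<omega> \<subseteq> fibre_at P x0"
    and "pathstart \<omega> = x0" and "pathfinish \<omega> = f x0"
    and "1 \<le> n"
    and "toral P f x0 \<omega> n"
    and "\<And>m. m dvd n \<Longrightarrow>
           0 \<noteq> N_B P (f ^^ m) \<and> N_B P (f ^^ m) = R_B P (f ^^ m) x0 (npath f \<omega> m)"
  shows "A_inv P f n = int (N_BP P f x0 \<omega> n)"
proof -
  interpret iterated_fibre_map P f x0 \<omega>
    using assms by unfold_locales (auto simp: paths_between_def)
  have fin: "finite (Rn P f x0 \<omega> m)" and card: "N_B P (f ^^ m) = card (Rn P f x0 \<omega> m)" if "m dvd n" for m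
    using assms(17)[OF that] unfolding R_B_def Rn_def by (metis card.infinite)+
  interpret toral_family n "Rn P f x0 \<omega>" "fmap P f x0 \<omega>" "gmap P f x0 \<omega>"
    by (rule toral_family_Rn[OF assms(15,16) fin])
  interpret reidemeister_setting P "f ^^ n" x0 "npath f \<omega> n"
    using assms(1,4) map_over_pow x0_tot npath_m[OF assms(15)] by unfold_locales
  have A: "A_inv P f m = int (card (irred m))" if "m dvd n" for m
    using that
  proof (induction m rule: less_induct)
    case (less m)
    have pos: "0 < m"
      using dvd_pos[OF less.prems] by simp
    then have divisors: "{k. k dvd m} = insert m {k. k dvd m \<and> k < m}"
      by (auto dest: dvd_imp_le)
    have "(\<Sum>k | k dvd m. card (irred k)) = card (irred m) + (\<Sum>k | k dvd m \<and> k < m. card (irred k))"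
      unfolding divisors by (subst sum.insert) (use pos in auto)
    then have "int (N_B P (f ^^ m)) = int (card (irred m)) + (\<Sum>k | k dvd m \<and> k < m. int (card (irred k)))"
      using card[OF less.prems] card_eq_sum_irred[OF less.prems] by simp
    moreover have "(\<Sum>k | k dvd m \<and> k < m. A_inv P f k) = (\<Sum>k | k dvd m \<and> k < m. int (card (irred k)))"
      using less by (intro sum.cong) (auto dest: dvd_trans)
    ultimately show ?case
      unfolding A_inv.simps[of P f m] by simp
  qed
  have "essential P (f ^^ n) x0 (npath f \<omega> n) \<alpha>" if "\<alpha> \<in> Rn P f x0 \<omega> n" for \<alpha>
    using essential_if_N_B_eq_R_B assms(17)[OF dvd_refl] that by (simp add: Rn_def)
  then have "O_n P f x0 \<omega> n = card (orbit n ` irred n)"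
    unfolding O_n_def irred_def irreducible_class_def reducible_to_def class_orbit_def orbit_def image_def
    by (intro arg_cong[of _ _ card]) blast
  then show ?thesis
    using A[OF dvd_refl] card_irred_orbits[OF dvd_refl] by (simp add: N_BP_def)
qed

end
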